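(* Let $X$ be a complex Banach space with the approximation property. Let $A,B\in\mathcal{NP}(X)$ be such that $D(A)\subseteq D(B)$ and $A-B$ is nuclear. Then the spectral shift function $\xi_{A,B}$ has an analytic continuation (again denoted $\xi_{A,B}$) into the closure of some sector $S_\theta$ with $\theta\in(0,\pi/2)$, and for every negative operator monotone function $\varphi\in\mathcal{OM}_-$ with $\varphi'(-0)\neq\infty$ and with the property $$\int_0^\infty\frac{|\varphi(-x)|}{1+x^2}\,dx<\infty$$ the following trace formula holds: $$\mathrm{tr}(\varphi(A)-\varphi(B))=\lim_{\varepsilon\to+0}\frac{1}{2\pi i}\int_{\partial S_\theta}\xi_{A,B}(z+\varepsilon)\varphi'(z)\,dz,$$ where $\partial S_\theta$ is the positively oriented boundary of $S_\theta$.
   Context: $R(t,A)=(tI-A)^{-1}$ is the resolvent and $\rho(A)$ the resolvent set. A closed densely defined operator $A$ on $X$ is nonpositive, $A\in\mathcal{NP}(X)$, if $(0,\infty)\subset\rho(A)$ and $\sup_{t>0}\|tR(t,A)\|<\infty$. $\mathcal{OM}_-$ denotes the class of negative complete Bernstein (equivalently, negative operator monotone) functions, normalized to have no affine part, i.e. the functions $\varphi(z)=\int_{(0,\infty)}\frac{z}{t-z}\,d\mu(t)$, $z\in\mathbb{C}\setminus(0,\infty)$, where $\mu$ is a (unique) positive measure on $(0,\infty)$ with $\int_{(0,\infty)}\frac{d\mu(t)}{1+t}<\infty$. Put $\varphi'(-0)=\lim_{s\to0,\,s<0}\varphi'(s)\in[0,\infty]$. For $A\in\mathcal{NP}(X)$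 and $\varphi\in\mathcal{OM}_-$, $\varphi(A)$ is the closure of the operator $x\mapsto\int_{(0,\infty)}AR(t,A)x\,d\mu(t)$, $x\in D(A)$. If $D(A)\subseteq D(B)$, the differences $A-B$ and $\varphi(A)-\varphi(B)$ are considered on the dense subspace $D(A)$; when bounded there they are identified with their bounded extensions to $X$, and "$A-B$ is nuclear" refers to this extension. An operator on $X$ is nuclear if it is the sum of a series of rank one operators absolutely convergent in operator norm; since $X$ has the approximation property, nuclear operators have a well-defined trace $\mathrm{tr}$. For $\lambda>0$ the function $\psi_\lambda(s)=\log\lambda-\log(\lambda-s)$ belongs to $\mathcal{OM}_-$ (with measure $t^{-1}dt$ on $(\lambda,\infty)$), and $\log(\lambda I-A):=(\log\lambda)I-\psi_\lambda(A)$. For $A,B\in\mathcal{NP}(X)$ with $D(A)\subseteq D(B)$ and $A-B$ nuclear, the operator $\log(\lambda I-A)-\log(\lambda I-B)=\psi_\lambda(B)-\psi_\lambda(A)$ is nuclear, and the spectral shift function is $\xi_{A,B}(\lambda)=\mathrm{tr}(\log(\lambda I-A)-\log(\lambda I-B))$, $\lambda>0$. $S_\theta=\{z\neq0:|\arg z|<\theta\}$ is the open sector symmetric about the positive real axis with opening angle $2\theta$.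
   Formalization: The analytic continuation is into the closure of the sector with the vertex 0 removed; at 0 the claim fails in general (for A=0, B=-1 on the complex numbers the spectral shift function is log(λ/(λ+1))). *)

theory Defs
  imports "HOL-Complex_Analysis.Complex_Analysis"
begin

section \<open>Complex Banach spaces\<close>

text \<open>The distribution only has real normed spaces; the complex scalar multiplication extends the
  real one and is compatible with the given norm.\<close>

class complex_normed_vector = real_normed_vector +
  fixes scaleC :: "complex \<Rightarrow> 'a \<Rightarrow> 'a" (infixr \<open>*\<^sub>C\<close> 75)
  assumes scaleR_scaleC: "r *\<^sub>R x = complex_of_real r *\<^sub>C x"
    and scaleC_add_right: "a *\<^sub>C (x + y) = a *\<^sub>C x + a *\<^sub>C y"
    and scaleC_add_left: "(a + b) *\<^sub>C x = a *\<^sub>C x + b *\<^sub>C x"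
    and scaleC_scaleC: "a *\<^sub>C b *\<^sub>C x = (a * b) *\<^sub>C x"
    and scaleC_one: "1 *\<^sub>C x = x"
    and norm_scaleC: "norm (a *\<^sub>C x) = cmod a * norm x"

class complex_banach = complex_normed_vector + banach

instantiation complex :: complex_banach
begin

definition scaleC_complex :: "complex \<Rightarrow> complex \<Rightarrow> complex"
  where "scaleC_complex a x = a * x"

instance
  by standard (auto simp: scaleC_complex_def algebra_simps scaleR_conv_of_real norm_mult)

end

definition bounded_clinear :: "('a::complex_normed_vector \<Rightarrow> 'b::complex_normed_vector) \<Rightarrow> bool"
  where "bounded_clinear T \<longleftrightarrow> bounded_linear T \<and> (\<forall>c x. T (c *\<^sub>C x) = c *\<^sub>C T x)"

definition finite_rank :: "('a::complex_normed_vector \<Rightarrow> 'a) \<Rightarrow> bool"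
  where "finite_rank F \<longleftrightarrow>
    bounded_clinear F \<and> (\<exists>S. finite S \<and> range F \<subseteq> module.span scaleC S)"

definition approximation_property :: "'a::complex_banach itself \<Rightarrow> bool"
  where "approximation_property _ \<longleftrightarrow>
    (\<forall>K :: 'a set. compact K \<longrightarrow>
      (\<forall>\<epsilon>>0. \<exists>F. finite_rank F \<and> (\<forall>x\<in>K. norm (F x - x) < \<epsilon>)))"

section \<open>Nuclear operators and their trace\<close>

text \<open>\<open>T\<close> is the sum of the rank one operators \<open>v \<mapsto> f n v *\<^sub>C x n\<close>, whose operator norms are
  \<open>onorm (f n) * norm (x n)\<close>. Since these norms are summable, the pointwise sum is also the sum in
  operator norm. Zero summands are allowed, so finite sums are covered.\<close>

definition nuclear_rep ::
    "('a::complex_banach \<Rightarrow> 'a) \<Rightarrow> (nat \<Rightarrow> 'a \<Rightarrow> complex) \<Rightarrow> (nat \<Rightarrow> 'a) \<Rightarrow> bool"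
  where "nuclear_rep T f x \<longleftrightarrow>
    (\<forall>n. bounded_clinear (f n)) \<and>
    summable (\<lambda>n. onorm (f n) * norm (x n)) \<and>
    (\<forall>v. (\<lambda>n. f n v *\<^sub>C x n) sums T v)"

definition nuclear :: "('a::complex_banach \<Rightarrow> 'a) \<Rightarrow> bool"
  where "nuclear T \<longleftrightarrow> (\<exists>f x. nuclear_rep T f x)"

text \<open>Well defined for nuclear operators on spaces with the approximation property.\<close>

definition nuclear_trace :: "('a::complex_banach \<Rightarrow> 'a) \<Rightarrow> complex"
  where "nuclear_trace T = (THE c. \<exists>f x. nuclear_rep T f x \<and> c = (\<Sum>n. f n (x n)))"

section \<open>Unbounded operators\<close>

text \<open>An operator is identified with its graph: \<open>Domain A\<close> is its domain, it is closed iff its graph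
  is closed in the product, and its closure is the topological closure of the graph.\<close>

type_synonym 'a operator = "('a \<times> 'a) set"

definition linear_operator :: "'a::complex_normed_vector operator \<Rightarrow> bool"
  where "linear_operator A \<longleftrightarrow>
    single_valued A \<and> module.subspace (\<lambda>c (x, y). (c *\<^sub>C x, c *\<^sub>C y)) A"

definition app :: "'a operator \<Rightarrow> 'a \<Rightarrow> 'a"
  where "app A x = (THE y. (x, y) \<in> A)"

definition resolvent :: "complex \<Rightarrow> 'a::complex_normed_vector operator \<Rightarrow> 'a \<Rightarrow> 'a"
  where "resolvent z A = inv_into (Domain A) (\<lambda>x. z *\<^sub>C x - app A x)"

definition resolvent_set :: "'a::complex_normed_vector operator \<Rightarrow> complex set"
  where "resolvent_set A =
    {z. bij_betw (\<lambda>x. z *\<^sub>C x - app A x) (Domain A) UNIV \<and> bounded_clinear (resolvent z A)}"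

definition NP :: "'a::complex_banach operator set"
  where "NP = {A. linear_operator A \<and> closed A \<and> closure (Domain A) = UNIV \<and>
    (\<forall>t>0. complex_of_real t \<in> resolvent_set A) \<and>
    (\<exists>M. \<forall>t>0. onorm (\<lambda>x. t *\<^sub>R resolvent (complex_of_real t) A x) \<le> M)}"

text \<open>\<open>T\<close> is the bounded extension to the whole space of the operator \<open>P - Q\<close> considered on \<open>D\<close>; it
  is unique if \<open>D\<close> is dense.\<close>

definition extends_diff ::
    "'a set \<Rightarrow> 'a::complex_banach operator \<Rightarrow> 'a operator \<Rightarrow> ('a \<Rightarrow> 'a) \<Rightarrow> bool"
  where "extends_diff D P Q T \<longleftrightarrow>
    D \<subseteq> Domain P \<and> D \<subseteq> Domain Q \<and> bounded_clinear T \<and> (\<forall>x\<in>D. T x = app P x - app Q x)"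

definition diff_ext :: "'a set \<Rightarrow> 'a::complex_banach operator \<Rightarrow> 'a operator \<Rightarrow> 'a \<Rightarrow> 'a"
  where "diff_ext D P Q = (THE T. extends_diff D P Q T)"

definition nuclear_diff :: "'a set \<Rightarrow> 'a::complex_banach operator \<Rightarrow> 'a operator \<Rightarrow> bool"
  where "nuclear_diff D P Q \<longleftrightarrow> (\<exists>T. extends_diff D P Q T \<and> nuclear T)"

section \<open>Negative complete Bernstein functions and their operator calculus\<close>

text \<open>The measures live on the space \<open>(0,\<infinity>)\<close>, so integrals over \<open>\<mu>\<close> are integrals over \<open>(0,\<infinity>)\<close>. The
  values of \<open>\<phi>\<close> on the cut \<open>(0,\<infinity>)\<close> are irrelevant.\<close>

definition om_represents :: "real measure \<Rightarrow> (complex \<Rightarrow> complex) \<Rightarrow> bool"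
  where "om_represents \<mu> \<phi> \<longleftrightarrow>
    sets \<mu> = sets (restrict_space borel {0<..}) \<and>
    (\<integral>\<^sup>+t. ennreal (1 / (1 + t)) \<partial>\<mu>) < \<infinity> \<and>
    (\<forall>z. z \<notin> complex_of_real ` {0<..} \<longrightarrow> \<phi> z = (\<integral>t. z / (complex_of_real t - z) \<partial>\<mu>))"

definition OM_minus :: "(complex \<Rightarrow> complex) set"
  where "OM_minus = {\<phi>. \<exists>\<mu>. om_represents \<mu> \<phi>}"

definition om_measure :: "(complex \<Rightarrow> complex) \<Rightarrow> real measure"
  where "om_measure \<phi> = (THE \<mu>. om_represents \<mu> \<phi>)"

definition om_deriv_minus_zero :: "(complex \<Rightarrow> complex) \<Rightarrow> ereal"
  where "om_deriv_minus_zero \<phi> =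
    Lim (at_left 0) (\<lambda>s::real. ereal (Re (deriv \<phi> (complex_of_real s))))"

text \<open>This is \<^const>\<open>has_bochner_integral\<close> word for word, but without its restriction to second
  countable range types, which would exclude nonseparable spaces.\<close>

definition has_bochner_int :: "'b measure \<Rightarrow> ('b \<Rightarrow> 'a::real_normed_vector) \<Rightarrow> 'a \<Rightarrow> bool"
  where "has_bochner_int M f x \<longleftrightarrow>
    f \<in> borel_measurable M \<and>
    (\<exists>s. (\<forall>i. Bochner_Integration.simple_bochner_integrable M (s i)) \<and>
      (\<lambda>i::nat. \<integral>\<^sup>+t. ennreal (norm (f t - s i t)) \<partial>M) \<longlonglongrightarrow> 0 \<and>
      (\<lambda>i. Bochner_Integration.simple_bochner_integral M (s i)) \<longlonglongrightarrow> x)"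

definition om_calc :: "(complex \<Rightarrow> complex) \<Rightarrow> 'a::complex_banach operator \<Rightarrow> 'a operator"
  where "om_calc \<phi> A = closure {(x, y). x \<in> Domain A \<and>
    has_bochner_int (om_measure \<phi>) (\<lambda>t. app A (resolvent (complex_of_real t) A x)) y}"

section \<open>The spectral shift function\<close>

text \<open>\<open>log_fun l\<close> belongs to \<^const>\<open>OM_minus\<close> for \<open>l > 0\<close>, with the measure \<open>dt / t\<close> on \<open>(l,\<infinity>)\<close>.\<close>

definition log_fun :: "real \<Rightarrow> complex \<Rightarrow> complex"
  where "log_fun l s = complex_of_real (ln l) - Ln (complex_of_real l - s)"

text \<open>The operator \<open>log (l I - A)\<close>.\<close>

definition log_op :: "real \<Rightarrow> 'a::complex_banach operator \<Rightarrow> 'a operator"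
  where "log_op l A = {(x, complex_of_real (ln l) *\<^sub>C x - y) | x y. (x, y) \<in> om_calc (log_fun l) A}"

definition spectral_shift ::
    "'a::complex_banach operator \<Rightarrow> 'a operator \<Rightarrow> real \<Rightarrow> complex"
  where "spectral_shift A B l = nuclear_trace (diff_ext (Domain A) (log_op l A) (log_op l B))"

section \<open>Sectors and integrals over their boundary\<close>

definition sector :: "real \<Rightarrow> complex set"
  where "sector \<theta> = {z. z \<noteq> 0 \<and> \<bar>Arg z\<bar> < \<theta>}"

definition sector_boundary_integrable :: "real \<Rightarrow> (complex \<Rightarrow> complex) \<Rightarrow> bool"
  where "sector_boundary_integrable \<theta> f \<longleftrightarrow>
    set_integrable lborel {0<..} (\<lambda>r. f (rcis r (- \<theta>)) * cis (- \<theta>)) \<and>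
    set_integrable lborel {0<..} (\<lambda>r. f (rcis r \<theta>) * cis \<theta>)"

text \<open>Positive orientation keeps the sector on the left: come in from infinity along the upper ray
  and leave along the lower ray.\<close>

definition sector_boundary_integral :: "real \<Rightarrow> (complex \<Rightarrow> complex) \<Rightarrow> complex"
  where "sector_boundary_integral \<theta> f =
    (LINT r:{0<..}|lborel. f (rcis r (- \<theta>)) * cis (- \<theta>)) -
    (LINT r:{0<..}|lborel. f (rcis r \<theta>) * cis \<theta>)"

end

(* With T = A - B = sum_n f_n (x) x_n one has AR(t,A) - BR(t,B) = t R(t,B) T R(t,A), so phi(A) - phi(B)
   is the integral of this nuclear operator against mu, of nuclear norm at most a constant times the
   integral of dmu(t)/t = phi'(-0), and tr(phi(A) - phi(B)) is the integral of t tau(t) dmu(t), where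
   tau(z) = tr(R(z,B) T R(z,A)). No integral with values in a space of nuclear operators is formed: power
   series of the resolvents on a countable cover of (0,oo) separate t from the operators and give a
   nuclear representation at once.

   The function tau is holomorphic with |tau(z)| <= K/(Re z)^2 on a cone around the positive axis. For the
   logarithm, dmu(t) = dt/t on (l,oo), whence xi(l) is minus the integral of tau over (l,oo); so xi is the
   primitive of tau that vanishes at infinity, and |xi(z)| <= K/Re z. By Cauchy's formula the integral of
   xi(z+eps)/(z-t)^2 along the boundary of the sector is 2 pi i tau(t+eps). Integrating against t dmu(t)
   gives the integral of xi(z+eps) phi'(z), by Fubini, whose hypothesis is the growth condition on phi;
   dominated convergence then allows eps -> 0. *)

theory Submission
  imports Defs "HOL-Probability.Levy" "HOL-Real_Asymp.Real_Asymp"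
begin

section \<open>Bounded complex linear maps\<close>

text \<open>One obstacle is the generality of X: it may be nonseparable, so Borel measurability need
  not survive the addition of two functions, and integrals of operators are reached through scalar
  integrals of the coefficients of series. The shift by \<epsilon> is due to the vertex of the
  sector: the bound K/Re z allows \<xi> to blow up at 0, whereas \<xi>(z+\<epsilon>) stays bounded
  on the rays. In Fubini's theorem the finiteness of \<phi>'(-0) handles small radii r and the
  growth condition large ones: for r > 1 the kernel t/((t+r)^2 (1+r)) is at most r/((t+r)(1+r^2)),
  whose \<mu>-integral is |\<phi>(-r)|/(1+r^2). The aperture depends only on a common bound M of t
  R(t,A) and t R(t,B): a contraction argument around the real point Re z works as long as |Im z| is
  at most Re z/(2M), whence c = 1/(2M) and \<theta> = arctan(c/2). The representing measure and the
  trace are definite descriptions, so the uniqueness of both is part of the proof; the approximation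
  property serves that of the trace.\<close>

interpretation complex_vector: vector_space "scaleC :: complex \<Rightarrow> 'a \<Rightarrow> 'a::complex_normed_vector"
  by standard (simp_all add: scaleC_add_right scaleC_add_left scaleC_scaleC scaleC_one)

lemma bounded_bilinear_scaleC:
  "bounded_bilinear (scaleC :: complex \<Rightarrow> 'a \<Rightarrow> 'a::complex_normed_vector)"
proof
  show "(r *\<^sub>R a) *\<^sub>C b = r *\<^sub>R (a *\<^sub>C b)" for r a and b :: 'a
    by (simp add: scaleR_scaleC[where 'a='a] scaleR_conv_of_real scaleC_scaleC)
  show "a *\<^sub>C (r *\<^sub>R b) = r *\<^sub>R (a *\<^sub>C b)" for r a and b :: 'a
    by (simp add: scaleR_scaleC[where 'a='a] scaleC_scaleC mult.commute)
  show "\<exists>K. \<forall>a (b::'a). norm (a *\<^sub>C b) \<le> norm a * norm b * K"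
    by (rule exI[of _ 1]) (simp add: norm_scaleC)
qed (simp_all add: scaleC_add_right scaleC_add_left)

lemmas tendsto_scaleC = bounded_bilinear.tendsto[OF bounded_bilinear_scaleC]

lemma bounded_clinearI:
  assumes "\<And>x y. T (x + y) = T x + T y" "\<And>c x. T (c *\<^sub>C x) = c *\<^sub>C T x" "\<And>x. norm (T x) \<le> norm x * K"
  shows "bounded_clinear T"
  unfolding bounded_clinear_def
  by (safe intro!: bounded_linear_intro[where K=K] assms) (simp_all add: scaleR_scaleC assms)

lemma bounded_clinear_imp_bounded_linear: "bounded_clinear T \<Longrightarrow> bounded_linear T"
  by (simp add: bounded_clinear_def)

lemma bounded_clinear_scaleC: "bounded_clinear T \<Longrightarrow> T (c *\<^sub>C x) = c *\<^sub>C T x"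
  by (simp add: bounded_clinear_def)

lemma bounded_clinear_scaleR: "bounded_clinear T \<Longrightarrow> T (c *\<^sub>R x) = c *\<^sub>R T x"
  by (simp add: scaleR_scaleC bounded_clinear_scaleC)

lemma
  assumes "bounded_clinear T"
  shows bounded_clinear_add: "T (x + y) = T x + T y"
    and bounded_clinear_diff: "T (x - y) = T x - T y"
    and bounded_clinear_minus: "T (- x) = - T x"
    and bounded_clinear_zero: "T 0 = 0"
    and bounded_clinear_onorm: "norm (T x) \<le> onorm T * norm x"
    and bounded_clinear_onorm_nonneg: "0 \<le> onorm T"
proof -
  interpret bounded_linear T using assms by (rule bounded_clinear_imp_bounded_linear)
  show "T (x + y) = T x + T y" "T (x - y) = T x - T y" "T (- x) = - T x" "T 0 = 0"
    by (rule add diff neg zero)+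
  show "norm (T x) \<le> onorm T * norm x" "0 \<le> onorm T"
    by (rule onorm[OF bounded_linear] onorm_pos_le[OF bounded_linear])+
qed

lemma bounded_clinear_tendsto:
  "bounded_clinear T \<Longrightarrow> (f \<longlongrightarrow> l) F \<Longrightarrow> ((\<lambda>x. T (f x)) \<longlongrightarrow> T l) F"
  by (rule bounded_linear.tendsto[OF bounded_clinear_imp_bounded_linear])

lemma bounded_clinear_sums:
  "bounded_clinear T \<Longrightarrow> f sums l \<Longrightarrow> (\<lambda>x. T (f x)) sums T l"
  by (rule bounded_linear.sums[OF bounded_clinear_imp_bounded_linear])

lemma bounded_clinear_compose:
  assumes "bounded_clinear S" "bounded_clinear T"
  shows "bounded_clinear (\<lambda>x. S (T x))"
  using assms by (auto simp: bounded_clinear_def intro: bounded_linear_compose)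

lemma bounded_clinear_plus:
  "bounded_clinear S \<Longrightarrow> bounded_clinear T \<Longrightarrow> bounded_clinear (\<lambda>x. S x + T x)"
  by (auto simp: bounded_clinear_def scaleC_add_right intro: bounded_linear_add)

lemma bounded_clinear_uminus: "bounded_clinear T \<Longrightarrow> bounded_clinear (\<lambda>x. - T x)"
  by (auto simp: bounded_clinear_def intro: bounded_linear_minus)

lemma bounded_clinear_const_scaleC:
  assumes "bounded_clinear T" shows "bounded_clinear (\<lambda>x. c *\<^sub>C T x)"
  using assms bounded_linear_compose[OF bounded_bilinear.bounded_linear_right[OF bounded_bilinear_scaleC, of c],
      of T]
  by (auto simp: bounded_clinear_def scaleC_scaleC mult.commute)

lemma bounded_clinear_scaleC_const:
  assumes "bounded_clinear T" shows "bounded_clinear (\<lambda>x. T x *\<^sub>C c)"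
  using assms bounded_linear_compose[OF bounded_bilinear.bounded_linear_left[OF bounded_bilinear_scaleC, of c],
      of T]
  by (auto simp: bounded_clinear_def scaleC_scaleC scaleC_complex_def)

lemma bounded_clinear_ident: "bounded_clinear (\<lambda>x. x)"
  by (simp add: bounded_clinear_def)

lemma bounded_clinear_0: "bounded_clinear (\<lambda>x. 0)"
  by (simp add: bounded_clinear_def)

lemma bounded_clinear_funpow:
  fixes T :: "'a::complex_normed_vector \<Rightarrow> 'a"
  shows "bounded_clinear T \<Longrightarrow> bounded_clinear (T ^^ n)"
proof (induction n)
  case 0
  have "T ^^ 0 = (\<lambda>x. x)" by (simp add: fun_eq_iff)
  then show ?case using bounded_clinear_ident by metis
next
  case (Suc n)
  then show ?case using bounded_clinear_compose[of T "T ^^ n"] by (simp add: o_def)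
qed

section \<open>Resolvents\<close>

lemma app_eqI: "single_valued A \<Longrightarrow> (x, y) \<in> A \<Longrightarrow> app A x = y"
  by (auto simp: app_def single_valued_def)

lemma app_in: "single_valued A \<Longrightarrow> x \<in> Domain A \<Longrightarrow> (x, app A x) \<in> A"
  by (auto simp: app_eqI)

text \<open>The scalar multiplication on pairs in \<open>linear_operator\<close> comes from no type
  class instance, so the module axioms are checked here once before
  \<open>module.subspace_def\<close> can be unfolded.\<close>

lemma subspace_graph_iff:
  "module.subspace (\<lambda>c (x, y). (c *\<^sub>C x, c *\<^sub>C y)) (A :: ('a::complex_normed_vector \<times> 'a) set) \<longleftrightarrow>
    (0, 0) \<in> A \<and> (\<forall>x y x' y'. (x, y) \<in> A \<longrightarrow> (x', y') \<in> A \<longrightarrow> (x + x', y + y') \<in> A) \<and>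
    (\<forall>c x y. (x, y) \<in> A \<longrightarrow> (c *\<^sub>C x, c *\<^sub>C y) \<in> A)"
proof -
  have "module (\<lambda>c (x::'a, y::'a). (c *\<^sub>C x, c *\<^sub>C y))"
    by standard (auto simp: scaleC_add_right scaleC_add_left scaleC_scaleC scaleC_one)
  note * = module.subspace_def[OF this, of A]
  show ?thesis unfolding * by (simp add: zero_prod_def Ball_def split_paired_all)
qed

lemma
  assumes "linear_operator A"
  shows linear_operator_single_valued: "single_valued A"
    and linear_operator_add: "(x, y) \<in> A \<Longrightarrow> (x', y') \<in> A \<Longrightarrow> (x + x', y + y') \<in> A"
    and linear_operator_scaleC: "(x, y) \<in> A \<Longrightarrow> (c *\<^sub>C x, c *\<^sub>C y) \<in> A"
  using assms unfolding linear_operator_def subspace_graph_iff by auto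

lemma
  assumes "linear_operator A" "x \<in> Domain A"
  shows Domain_scaleC: "c *\<^sub>C x \<in> Domain A" and app_scaleC: "app A (c *\<^sub>C x) = c *\<^sub>C app A x"
proof -
  have "(c *\<^sub>C x, c *\<^sub>C app A x) \<in> A"
    by (intro linear_operator_scaleC app_in linear_operator_single_valued assms)
  then show "c *\<^sub>C x \<in> Domain A" "app A (c *\<^sub>C x) = c *\<^sub>C app A x"
    using app_eqI linear_operator_single_valued[OF assms(1)] by auto
qed

lemma
  assumes "linear_operator A" "x \<in> Domain A" "y \<in> Domain A"
  shows Domain_add: "x + y \<in> Domain A" and app_add: "app A (x + y) = app A x + app A y"
proof -
  have "(x + y, app A x + app A y) \<in> A"
    by (intro linear_operator_add app_in linear_operator_single_valued assms)
  then show "x + y \<in> Domain A" "app A (x + y) = app A x + app A y"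
    using app_eqI linear_operator_single_valued[OF assms(1)] by auto
qed

section \<open>Algebraic identities for resolvents\<close>

lemma
  assumes "z \<in> resolvent_set A"
  shows resolvent_in_Domain: "resolvent z A x \<in> Domain A"
    and resolvent_right: "z *\<^sub>C resolvent z A x - app A (resolvent z A x) = x"
    and resolvent_left: "x \<in> Domain A \<Longrightarrow> resolvent z A (z *\<^sub>C x - app A x) = x"
    and bounded_clinear_resolvent: "bounded_clinear (resolvent z A)"
proof -
  have b: "bij_betw (\<lambda>x. z *\<^sub>C x - app A x) (Domain A) UNIV"
    and r: "bounded_clinear (resolvent z A)"
    using assms by (auto simp: resolvent_set_def)
  then show "resolvent z A x \<in> Domain A" "z *\<^sub>C resolvent z A x - app A (resolvent z A x) = x"
    unfolding resolvent_def bij_betw_def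
    by (metis UNIV_I inv_into_into) (use b in \<open>auto simp: bij_betw_def f_inv_into_f[where f="\<lambda>x. z *\<^sub>C x - app A x"]\<close>)
  show "x \<in> Domain A \<Longrightarrow> resolvent z A (z *\<^sub>C x - app A x) = x"
    using b unfolding resolvent_def bij_betw_def by (metis (mono_tags, lifting) inv_into_f_f)
  show "bounded_clinear (resolvent z A)" by fact
qed

lemma resolvent_eqI:
  "z \<in> resolvent_set A \<Longrightarrow> x \<in> Domain A \<Longrightarrow> z *\<^sub>C x - app A x = y \<Longrightarrow> resolvent z A y = x"
  using resolvent_left by blast

lemma app_resolvent:
  "z \<in> resolvent_set A \<Longrightarrow> app A (resolvent z A x) = z *\<^sub>C resolvent z A x - x"
  using resolvent_right[of z A x] by (simp add: algebra_simps)

lemma resolvent_app: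
  "z \<in> resolvent_set A \<Longrightarrow> x \<in> Domain A \<Longrightarrow> resolvent z A (app A x) = z *\<^sub>C resolvent z A x - x"
  using resolvent_left[of z A x] bounded_clinear_diff[OF bounded_clinear_resolvent, of z A "z *\<^sub>C x" "app A x"]
  by (simp add: algebra_simps bounded_clinear_scaleC[OF bounded_clinear_resolvent])

text \<open>First resolvent identity, checked by applying z - A to the right-hand side, which lies
  in the domain. The factors stand in the order that this computation needs; that they commute is a
  consequence.\<close>

lemma resolvent_identity:
  assumes "linear_operator A" "z \<in> resolvent_set A" "w \<in> resolvent_set A"
  shows "resolvent z A x = resolvent w A x + (w - z) *\<^sub>C resolvent z A (resolvent w A x)"
proof (rule resolvent_eqI)
  let ?u = "resolvent w A x" and ?v = "resolvent z A (resolvent w A x)"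
  have d: "?u \<in> Domain A" "?v \<in> Domain A" "(w - z) *\<^sub>C ?v \<in> Domain A"
    by (intro resolvent_in_Domain Domain_scaleC assms)+
  show "?u + (w - z) *\<^sub>C ?v \<in> Domain A" by (intro Domain_add d assms)
  have "app A (?u + (w - z) *\<^sub>C ?v) = (w *\<^sub>C ?u - x) + (w - z) *\<^sub>C (z *\<^sub>C ?v - ?u)"
    by (simp only: app_add[OF assms(1) d(1,3)] app_scaleC[OF assms(1) d(2)] app_resolvent assms)
  then show "z *\<^sub>C (?u + (w - z) *\<^sub>C ?v) - app A (?u + (w - z) *\<^sub>C ?v) = x"
    by (simp add: complex_vector.scale_right_distrib complex_vector.scale_right_diff_distrib
        complex_vector.scale_left_diff_distrib algebra_simps)
qed fact

text \<open>The resolvent identity and its version with z and w exchanged express the same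
  difference of resolvents with the two orders of the product; for distinct points the factor w - z
  cancels.\<close>

lemma resolvent_commute:
  assumes "linear_operator A" "z \<in> resolvent_set A" "w \<in> resolvent_set A"
  shows "resolvent z A (resolvent w A x) = resolvent w A (resolvent z A x)"
proof (cases "z = w")
  case False
  have "(w - z) *\<^sub>C resolvent z A (resolvent w A x) = (w - z) *\<^sub>C resolvent w A (resolvent z A x)"
  proof -
    have "(w - z) *\<^sub>C resolvent z A (resolvent w A x) = resolvent z A x - resolvent w A x"
      using resolvent_identity[OF assms, of x] by (metis add_diff_cancel_left')
    moreover have "(z - w) *\<^sub>C resolvent w A (resolvent z A x) = resolvent w A x - resolvent z A x"
      using resolvent_identity[OF assms(1,3,2), of x] by (metis add_diff_cancel_left')
    ultimately show ?thesis by (metis complex_vector.scale_minus_left minus_diff_eq)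
  qed
  then show ?thesis using False by (simp add: complex_vector.scale_cancel_left)
qed simp

text \<open>Second resolvent identity. \<open>T\<close> is known to be A - B only on the domain of
  \<open>A\<close>, so R(z,A) has to stand to its right: it maps into that domain, and there (z - B)
  R(z,A) x = x + T R(z,A) x.\<close>

lemma resolvent_diff:
  assumes "z \<in> resolvent_set A" "z \<in> resolvent_set B" "linear_operator B" "Domain A \<subseteq> Domain B"
    and T: "\<And>x. x \<in> Domain A \<Longrightarrow> T x = app A x - app B x"
  shows "resolvent z A x - resolvent z B x = resolvent z B (T (resolvent z A x))"
proof -
  have d: "resolvent z A x \<in> Domain A" by (intro resolvent_in_Domain assms)
  then have "z *\<^sub>C resolvent z A x - app B (resolvent z A x) = x + T (resolvent z A x)"
    using T[OF d] resolvent_right[OF assms(1), of x] by (simp add: algebra_simps)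
  then have "resolvent z B (x + T (resolvent z A x)) = resolvent z A x"
    using resolvent_eqI assms d by blast
  then show ?thesis
    by (simp add: bounded_clinear_add[OF bounded_clinear_resolvent[OF assms(2)]] algebra_simps)
qed

text \<open>\<open>(z - A) x = y\<close> iff \<open>x = R(w) (y + (w - z) x)\<close>, and the right-hand side is a contraction in \<open>x\<close>.\<close>

lemma resolvent_perturb:
  fixes A :: "'a::complex_banach operator"
  assumes A: "linear_operator A" and w: "w \<in> resolvent_set A"
    and m: "\<And>x. norm (resolvent w A x) \<le> m * norm x" and z: "cmod (z - w) * m \<le> 1 / 2"
  shows "z \<in> resolvent_set A" and "norm (resolvent z A x) \<le> 2 * m * norm x"
proof -
  let ?R = "resolvent w A"
  note lin = bounded_clinear_add[OF bounded_clinear_resolvent[OF w]]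
    bounded_clinear_scaleC[OF bounded_clinear_resolvent[OF w]]
    bounded_clinear_diff[OF bounded_clinear_resolvent[OF w]]
  have eq: "x \<in> Domain A \<and> z *\<^sub>C x - app A x = y \<longleftrightarrow> x = ?R (y + (w - z) *\<^sub>C x)" for x y
  proof
    assume "x \<in> Domain A \<and> z *\<^sub>C x - app A x = y"
    then have "w *\<^sub>C x - app A x = y + (w - z) *\<^sub>C x" "x \<in> Domain A"
      by (auto simp: complex_vector.scale_left_diff_distrib algebra_simps)
    then show "x = ?R (y + (w - z) *\<^sub>C x)" using resolvent_eqI[OF w] by metis
  next
    assume x: "x = ?R (y + (w - z) *\<^sub>C x)"
    then have "w *\<^sub>C x - app A x = y + (w - z) *\<^sub>C x" using resolvent_right[OF w] by metis
    then show "x \<in> Domain A \<and> z *\<^sub>C x - app A x = y" using x resolvent_in_Domain[OF w]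
      by (metis (no_types, lifting) add.commute add_diff_cancel_left' complex_vector.scale_left_diff_distrib
          diff_add_eq diff_diff_eq2)
  qed
  have contr: "norm (?R ((w - z) *\<^sub>C x)) \<le> norm x / 2" for x
  proof -
    have "norm (?R ((w - z) *\<^sub>C x)) \<le> m * (cmod (w - z) * norm x)"
      using m[of "(w - z) *\<^sub>C x"] by (simp add: norm_scaleC)
    also have "\<dots> = (cmod (z - w) * m) * norm x" by (simp add: norm_minus_commute)
    also have "\<dots> \<le> 1 / 2 * norm x" using z by (intro mult_right_mono) auto
    finally show ?thesis by simp
  qed
  have ex: "\<exists>!x. ?R (y + (w - z) *\<^sub>C x) = x" for y
  proof -
    show "\<exists>!x. ?R (y + (w - z) *\<^sub>C x) = x"
    proof (rule banach_fix_type[where c="1/2"])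
      show "\<forall>x x'. dist (?R (y + (w - z) *\<^sub>C x)) (?R (y + (w - z) *\<^sub>C x')) \<le> 1 / 2 * dist x x'"
      proof safe
        fix x x'
        have "?R (y + (w - z) *\<^sub>C x) - ?R (y + (w - z) *\<^sub>C x') = ?R ((w - z) *\<^sub>C (x - x'))"
          by (simp add: lin complex_vector.scale_right_diff_distrib)
        with contr[of "x - x'"]
        show "dist (?R (y + (w - z) *\<^sub>C x)) (?R (y + (w - z) *\<^sub>C x')) \<le> 1 / 2 * dist x x'"
          by (simp add: dist_norm)
      qed
    qed auto
  qed
  have bij: "bij_betw (\<lambda>x. z *\<^sub>C x - app A x) (Domain A) UNIV"
    unfolding bij_betw_def
  proof (intro conjI inj_onI)
    fix x x' assume "x \<in> Domain A" "x' \<in> Domain A" "z *\<^sub>C x - app A x = z *\<^sub>C x' - app A x'"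
    then show "x = x'" using ex eq by metis
  next
    show "(\<lambda>x. z *\<^sub>C x - app A x) ` Domain A = UNIV" using ex eq by (metis (no_types, lifting) UNIV_eq_I image_iff)
  qed
  have inv: "x = resolvent z A y \<longleftrightarrow> x = ?R (y + (w - z) *\<^sub>C x)" for x y
  proof -
    have d: "resolvent z A y \<in> Domain A \<and> z *\<^sub>C resolvent z A y - app A (resolvent z A y) = y"
      using bij unfolding resolvent_def bij_betw_def
      by (metis (mono_tags, lifting) UNIV_I f_inv_into_f inv_into_into)
    show ?thesis using d eq ex by metis
  qed
  have bd: "norm (resolvent z A y) \<le> 2 * m * norm y" for y
  proof -
    let ?x = "resolvent z A y"
    have "?x = ?R y + ?R ((w - z) *\<^sub>C ?x)" using inv[of ?x y] by (simp add: lin)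
    then have "norm ?x \<le> norm (?R y) + norm (?R ((w - z) *\<^sub>C ?x))"
      by (metis norm_triangle_ineq)
    also have "\<dots> \<le> m * norm y + norm ?x / 2" by (intro add_mono m contr)
    finally show ?thesis by simp
  qed
  then show "norm (resolvent z A x) \<le> 2 * m * norm x" .
  \<comment> \<open>Additivity and homogeneity follow from the uniqueness of the fixed point: the
    expected value solves the equation of \<open>inv\<close> for the new argument.\<close>
  have "bounded_clinear (resolvent z A)"
  proof (rule bounded_clinearI[where K="2 * m"])
    show "resolvent z A (x + y) = resolvent z A x + resolvent z A y" for x y
    proof (rule inv[THEN iffD2, symmetric])
      have "resolvent z A x + resolvent z A y = ?R (x + (w - z) *\<^sub>C resolvent z A x) + ?R (y + (w - z) *\<^sub>C resolvent z A y)"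
        using inv by metis
      moreover have "x + y + (w - z) *\<^sub>C (resolvent z A x + resolvent z A y) =
          (x + (w - z) *\<^sub>C resolvent z A x) + (y + (w - z) *\<^sub>C resolvent z A y)"
        by (simp add: complex_vector.scale_right_distrib)
      ultimately show "resolvent z A x + resolvent z A y =
          ?R (x + y + (w - z) *\<^sub>C (resolvent z A x + resolvent z A y))"
        by (metis lin(1))
    qed
    show "resolvent z A (c *\<^sub>C x) = c *\<^sub>C resolvent z A x" for c x
    proof (rule inv[THEN iffD2, symmetric])
      have "c *\<^sub>C resolvent z A x = c *\<^sub>C ?R (x + (w - z) *\<^sub>C resolvent z A x)"
        using inv by metis
      moreover have "c *\<^sub>C x + (w - z) *\<^sub>C (c *\<^sub>C resolvent z A x) =
          c *\<^sub>C (x + (w - z) *\<^sub>C resolvent z A x)"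
        by (simp add: scaleC_add_right mult.commute)
      ultimately show "c *\<^sub>C resolvent z A x = ?R (c *\<^sub>C x + (w - z) *\<^sub>C (c *\<^sub>C resolvent z A x))"
        by (metis lin(2))
    qed
    show "norm (resolvent z A x) \<le> norm x * (2 * m)" for x using bd[of x] by (simp add: mult.commute)
  qed
  with bij show "z \<in> resolvent_set A" by (simp add: resolvent_set_def)
qed

lemma norm_funpow_le:
  fixes S :: "'a::real_normed_vector \<Rightarrow> 'a"
  assumes "\<And>x. norm (S x) \<le> m * norm x" "0 \<le> m"
  shows "norm ((S ^^ n) x) \<le> m ^ n * norm x"
proof (induction n)
  case (Suc n)
  have "norm ((S ^^ Suc n) x) \<le> m * norm ((S ^^ n) x)" using assms(1) by simp
  also have "\<dots> \<le> m * (m ^ n * norm x)" by (intro mult_left_mono Suc assms)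
  finally show ?case by (simp add: ac_simps)
qed simp

text \<open>Iterating the resolvent identity n times leaves the remainder (w - z)^n R(w)^n R(z) x,
  whose norm is at most 2^(-n) times that of R(z) x. Existence of R(z) is a hypothesis here; it
  comes from \<open>resolvent_perturb\<close> or from nonpositivity.\<close>

lemma resolvent_power_series:
  fixes A :: "'a::complex_banach operator"
  assumes A: "linear_operator A" and w: "w \<in> resolvent_set A" and z: "z \<in> resolvent_set A"
    and m: "\<And>x. norm (resolvent w A x) \<le> m * norm x" "0 \<le> m" and zw: "cmod (z - w) * m \<le> 1 / 2"
  shows "(\<lambda>k. (w - z) ^ k *\<^sub>C (resolvent w A ^^ Suc k) x) sums resolvent z A x"
proof -
  let ?R = "resolvent w A"
  have step: "(?R ^^ n) (resolvent z A x) = (?R ^^ Suc n) x + (w - z) *\<^sub>C (?R ^^ Suc n) (resolvent z A x)" for n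
  proof -
    have "resolvent z A x = ?R x + (w - z) *\<^sub>C ?R (resolvent z A x)"
      using resolvent_identity[OF A z w, of x] resolvent_commute[OF A z w, of x] by simp
    then have "(?R ^^ n) (resolvent z A x) = (?R ^^ n) (?R x + (w - z) *\<^sub>C ?R (resolvent z A x))"
      by simp
    then show ?thesis
      by (simp add: bounded_clinear_add[OF bounded_clinear_funpow[OF bounded_clinear_resolvent[OF w]]]
          bounded_clinear_scaleC[OF bounded_clinear_funpow[OF bounded_clinear_resolvent[OF w]]]
          funpow_Suc_right del: funpow.simps(2))
  qed
  have eq: "resolvent z A x = (\<Sum>k<n. (w - z) ^ k *\<^sub>C (?R ^^ Suc k) x) +
      (w - z) ^ n *\<^sub>C (?R ^^ n) (resolvent z A x)" for n
  proof (induction n)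
    case (Suc n)
    then show ?case unfolding step[of n]
      by (simp add: complex_vector.scale_right_distrib algebra_simps)
  qed simp
  have "(\<lambda>n. (w - z) ^ n *\<^sub>C (?R ^^ n) (resolvent z A x)) \<longlonglongrightarrow> 0"
  proof (rule Lim_null_comparison)
    have "norm ((w - z) ^ n *\<^sub>C (?R ^^ n) (resolvent z A x)) \<le> (1 / 2) ^ n * norm (resolvent z A x)" for n
    proof -
      have "norm ((w - z) ^ n *\<^sub>C (?R ^^ n) (resolvent z A x)) \<le>
          cmod (w - z) ^ n * (m ^ n * norm (resolvent z A x))"
        unfolding norm_scaleC norm_power by (intro mult_left_mono norm_funpow_le m) auto
      also have "\<dots> = (cmod (z - w) * m) ^ n * norm (resolvent z A x)"
        by (simp add: power_mult_distrib norm_minus_commute)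
      also have "\<dots> \<le> (1 / 2) ^ n * norm (resolvent z A x)"
        using m zw by (intro mult_right_mono power_mono) auto
      finally show ?thesis .
    qed
    then show "\<forall>\<^sub>F n in sequentially. norm ((w - z) ^ n *\<^sub>C (?R ^^ n) (resolvent z A x)) \<le>
        (1 / 2) ^ n * norm (resolvent z A x)" by simp
    show "(\<lambda>n. (1 / 2) ^ n * norm (resolvent z A x)) \<longlonglongrightarrow> 0"
      by (intro tendsto_mult_left_zero LIMSEQ_realpow_zero) auto
  qed
  then have "(\<lambda>n. resolvent z A x - (w - z) ^ n *\<^sub>C (?R ^^ n) (resolvent z A x)) \<longlonglongrightarrow> resolvent z A x"
    using tendsto_diff[OF tendsto_const] by fastforce
  moreover have "resolvent z A x - (w - z) ^ n *\<^sub>C (?R ^^ n) (resolvent z A x) =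
      (\<Sum>k<n. (w - z) ^ k *\<^sub>C (?R ^^ Suc k) x)" for n
    using eq[of n] by (metis add_diff_cancel)
  ultimately show ?thesis by (simp add: sums_def)
qed

section \<open>Resolvents of nonpositive operators\<close>

lemma NP_linear_operator: "A \<in> NP \<Longrightarrow> linear_operator A"
  by (simp add: NP_def)

lemma NP_resolvent_set: "A \<in> NP \<Longrightarrow> t > 0 \<Longrightarrow> complex_of_real t \<in> resolvent_set A"
  by (simp add: NP_def)

text \<open>The bound is raised to at least 1, so that constants such as 1/(2M) are positive and
  make sense even if the supremum is 0.\<close>

lemma NP_resolvent_bound:
  assumes "A \<in> NP"
  obtains M where "M \<ge> 1" "\<And>t x. t > 0 \<Longrightarrow> norm (resolvent (complex_of_real t) A x) \<le> M / t * norm x"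
proof -
  obtain M where M: "\<And>t. t > 0 \<Longrightarrow> onorm (\<lambda>x. t *\<^sub>R resolvent (complex_of_real t) A x) \<le> M"
    using assms by (auto simp: NP_def)
  show thesis
  proof (rule that[of "max 1 M"])
    fix t :: real and x assume t: "t > 0"
    have b: "bounded_clinear (\<lambda>x. t *\<^sub>R resolvent (complex_of_real t) A x)"
      using bounded_clinear_const_scaleC[OF bounded_clinear_resolvent[OF NP_resolvent_set[OF assms t]]]
      by (simp add: scaleR_scaleC)
    have "t * norm (resolvent (complex_of_real t) A x) \<le> M * norm x"
      using bounded_clinear_onorm[OF b, of x] mult_right_mono[OF M[OF t], of "norm x"] t by simp
    also have "\<dots> \<le> max 1 M * norm x" by (intro mult_right_mono) auto
    finally show "norm (resolvent (complex_of_real t) A x) \<le> max 1 M / t * norm x"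
      using t by (simp add: field_simps)
  qed simp
qed

text \<open>A series over k is spread over an enumeration of all pairs, with zeros off the fibre of
  j. The enumeration may permute the terms, hence the absolute convergence and the detour through
  unconditional sums.\<close>

lemma sums_fiber:
  fixes g :: "nat \<Rightarrow> 'b::banach"
  assumes e: "bij (e :: nat \<Rightarrow> 'c \<times> nat)" and g: "summable (\<lambda>k. norm (g k))" "g sums s"
  shows "(\<lambda>n. if fst (e n) = j then g (snd (e n)) else 0) sums s"
proof -
  let ?h = "\<lambda>(i, k). if i = j then g k else 0"
  have "(g has_sum s) UNIV" using g by (rule norm_summable_imp_has_sum)
  then have "(?h has_sum s) (Pair j ` UNIV)"
    by (subst has_sum_reindex) (auto simp: o_def inj_on_def)
  then have "(?h has_sum s) UNIV"
    by (rule has_sum_cong_neutral[THEN iffD1, rotated -1]) auto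
  then have "((\<lambda>n. ?h (e n)) has_sum s) UNIV"
    using has_sum_reindex_bij_betw[OF e, of ?h s] by simp
  then show ?thesis using has_sum_imp_sums by (fastforce simp: case_prod_beta)
qed

text \<open>After taking logarithms to the base q, membership in a cell is a floor condition; hence
  the cells are disjoint and cover (0,\<infinity>).\<close>

lemma cell_iff_floor:
  fixes q t :: real
  assumes "q > 1" "t > 0"
  shows "q powi j \<le> t \<and> t < q powi (j + 1) \<longleftrightarrow> j = \<lfloor>log q t\<rfloor>"
  using assms by (simp add: powr_real_of_int'[symmetric] powr_le_iff less_powr_iff eq_commute[of j] floor_eq_iff ac_simps)

text \<open>Cover \<open>(0,\<infinity>)\<close> by the cells \<open>[q^j, q^(j+1))\<close> with \<open>q > 1\<close> so close to \<open>1\<close> that on each of them the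
  resolvent is given by its power series at \<open>q^j\<close>. The result separates the variable \<open>t\<close> from the
  operator, which turns integrals of resolvents into series.\<close>

lemma resolvent_series:
  fixes A :: "'a::complex_banach operator"
  assumes A: "A \<in> NP"
  obtains E :: "nat \<Rightarrow> real \<Rightarrow> real" and P :: "nat \<Rightarrow> 'a \<Rightarrow> 'a" and p :: "nat \<Rightarrow> real" and C :: real
  where "\<And>i. E i \<in> borel_measurable borel" "\<And>i. bounded_clinear (P i)" "0 \<le> C"
    "\<And>i. 0 < p i" "\<And>i x. norm (P i x) \<le> p i * norm x"
    "\<And>i s x. s \<in> resolvent_set A \<Longrightarrow> P i (resolvent s A x) = resolvent s A (P i x)"
    "\<And>t x. t > 0 \<Longrightarrow> (\<lambda>i. E i t *\<^sub>R P i x) sums resolvent (complex_of_real t) A x"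
    "\<And>t. t > 0 \<Longrightarrow> summable (\<lambda>i. \<bar>E i t\<bar> * p i)"
    "\<And>t. t > 0 \<Longrightarrow> (\<Sum>i. \<bar>E i t\<bar> * p i) \<le> C / t"
    "\<And>i t. t > 0 \<Longrightarrow> \<bar>E i t\<bar> \<le> C / p i / t"
proof -
  obtain M where M: "M \<ge> 1" "\<And>t x. t > 0 \<Longrightarrow> norm (resolvent (complex_of_real t) A x) \<le> M / t * norm x"
    using NP_resolvent_bound[OF A] by blast
  note lin = NP_linear_operator[OF A] and rs = NP_resolvent_set[OF A]
  \<comment> \<open>The cell with left end g has length (q - 1) g = g/(2M), so |g - t| M/g is at
    most 1/2 on it, which is the condition for the power series at g. That q is at most 2 makes g
    and t comparable up to a factor 2.\<close>
  define q where "q = 1 + 1 / (2 * M)"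
  have q: "q > 1" "(q - 1) * M = 1 / 2" "q \<le> 2" using M(1) by (auto simp: q_def field_simps)
  define g where "g j = q powi j" for j
  have g: "g j > 0" for j using q by (simp add: g_def zero_less_power_int)
  define e where "e n = (int_decode (fst (prod_decode n)), snd (prod_decode n))" for n
  have e: "bij e"
    by (rule bij_betw_byWitness[where f'="\<lambda>(j, k). prod_encode (int_encode j, k)"]) (auto simp: e_def)
  \<comment> \<open>The index n encodes a cell and a power of the local expansion. Since the
    coefficient vanishes off its cell, only the terms of one cell survive for a given t.\<close>
  define E where "E n t = (let (j, k) = e n in if g j \<le> t \<and> t < g (j + 1) then (g j - t) ^ k else 0)" for n t
  define P where "P n = (let (j, k) = e n in resolvent (complex_of_real (g j)) A ^^ Suc k)" for n
  have P: "bounded_clinear (P n)" for n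
    unfolding P_def Let_def case_prod_beta by (intro bounded_clinear_funpow bounded_clinear_resolvent rs g)
  define p where "p n = (M / g (fst (e n))) ^ Suc (snd (e n))" for n
  have p: "p n > 0" for n using M g by (auto simp: p_def)
  have Pn: "norm (P n x) \<le> p n * norm x" for n x
    unfolding P_def p_def Let_def case_prod_beta
    by (rule norm_funpow_le) (use M g in \<open>auto intro: less_imp_le\<close>)
  have cell: "\<exists>j. (\<forall>i. g i \<le> t \<and> t < g (i + 1) \<longleftrightarrow> i = j) \<and> \<bar>g j - t\<bar> * (M / g j) \<le> 1 / 2 \<and> M / g j \<le> 2 * M / t"
    if t: "t > 0" for t
  proof (intro exI conjI allI)
    let ?j = "\<lfloor>log q t\<rfloor>"
    show "g i \<le> t \<and> t < g (i + 1) \<longleftrightarrow> i = ?j" for i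
      unfolding g_def by (rule cell_iff_floor[OF q(1) t])
    then have j: "g ?j \<le> t" "t < g (?j + 1)" by auto
    have s: "g (?j + 1) = q * g ?j" using q by (simp add: g_def power_int_add)
    then have "\<bar>g ?j - t\<bar> \<le> (q - 1) * g ?j" using j by (simp add: algebra_simps)
    then have "\<bar>g ?j - t\<bar> * (M / g ?j) \<le> (q - 1) * g ?j * (M / g ?j)"
      using M g[of ?j] by (intro mult_right_mono) auto
    also have "\<dots> = 1 / 2" using g[of ?j] q by simp
    finally show "\<bar>g ?j - t\<bar> * (M / g ?j) \<le> 1 / 2" .
    have "q * g ?j \<le> 2 * g ?j" using q(3) g[of ?j] by (intro mult_right_mono) auto
    then have "t \<le> 2 * g ?j" using j s by linarith
    then show "M / g ?j \<le> 2 * M / t" using t g[of ?j] M by (simp add: field_simps)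
  qed
  show thesis
  proof (rule that[of E P "4 * M" p])
    show "E n \<in> borel_measurable borel" for n
      unfolding E_def Let_def case_prod_beta by measurable
    show "bounded_clinear (P n)" for n by (rule P)
    show "P i (resolvent s A x) = resolvent s A (P i x)" if "s \<in> resolvent_set A" for i s x
    proof -
      have "(resolvent (complex_of_real (g j)) A ^^ k) (resolvent s A x) =
          resolvent s A ((resolvent (complex_of_real (g j)) A ^^ k) x)" for j k
        by (induction k) (simp_all add: resolvent_commute[OF lin rs[OF g] that])
      then show ?thesis unfolding P_def Let_def case_prod_beta by blast
    qed
    fix t :: real assume t: "t > 0"
    obtain j where j: "\<And>i. g i \<le> t \<and> t < g (i + 1) \<longleftrightarrow> i = j" "\<bar>g j - t\<bar> * (M / g j) \<le> 1 / 2"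
      "M / g j \<le> 2 * M / t" using cell[OF t] by blast
    have En: "E n t = (if fst (e n) = j then (g j - t) ^ snd (e n) else 0)" for n
      unfolding E_def Let_def case_prod_beta j(1) by simp
    have ab: "\<bar>g j - t\<bar> ^ k * (M / g j) ^ Suc k \<le> 2 * M / t * (1 / 2) ^ k" for k
    proof -
      have "\<bar>g j - t\<bar> ^ k * (M / g j) ^ Suc k = M / g j * (\<bar>g j - t\<bar> * (M / g j)) ^ k"
        by (simp only: power_Suc power_mult_distrib ac_simps)
      also have "\<dots> \<le> 2 * M / t * (1 / 2) ^ k"
        using j g[of j] M t by (intro mult_mono power_mono) auto
      finally show ?thesis .
    qed
    \<comment> \<open>On the active cell M/g is at most 2M/t, and the powers of 1/2 sum to 2: this
      is the origin of the constant 4M.\<close>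
    have geo: "(\<lambda>n. if fst (e n) = j then 2 * M / t * (1 / 2) ^ snd (e n) else 0) sums (4 * M / t)"
    proof (rule sums_fiber[OF e, where g="\<lambda>k. 2 * M / t * (1 / 2) ^ k"])
      show "summable (\<lambda>k. norm (2 * M / t * (1 / 2) ^ k))"
        using M t by (simp add: norm_mult norm_power summable_mult complete_algebra_summable_geometric)
      show "(\<lambda>k. 2 * M / t * (1 / 2) ^ k) sums (4 * M / t)"
        using sums_mult[OF geometric_sums[of "1/2::real"], of "2 * M / t"] by simp
    qed
    have le: "\<bar>E n t\<bar> * p n \<le> (if fst (e n) = j then 2 * M / t * (1 / 2) ^ snd (e n) else 0)" for n
    proof (cases "fst (e n) = j")
      case True
      then have "\<bar>E n t\<bar> * p n = \<bar>g j - t\<bar> ^ snd (e n) * (M / g j) ^ Suc (snd (e n))"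
        by (simp add: En p_def power_abs del: power_Suc)
      also have "\<dots> \<le> 2 * M / t * (1 / 2) ^ snd (e n)" by (rule ab)
      finally show ?thesis using True by simp
    qed (simp add: En)
    show su: "summable (\<lambda>i. \<bar>E i t\<bar> * p i)"
      by (rule summable_comparison_test'[OF sums_summable[OF geo], of 0])
        (use le p in \<open>auto simp: abs_mult less_imp_le\<close>)
    show sum_le: "(\<Sum>i. \<bar>E i t\<bar> * p i) \<le> 4 * M / t"
      using suminf_le[OF le su sums_summable[OF geo]] sums_unique[OF geo] by simp
    show "\<bar>E i t\<bar> \<le> 4 * M / p i / t" for i
    proof -
      have "\<bar>E i t\<bar> * p i \<le> (\<Sum>i. \<bar>E i t\<bar> * p i)"
        using sum_le_suminf[OF su, of "{i}"] p by (simp add: less_imp_le)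
      then have "\<bar>E i t\<bar> * p i \<le> 4 * M / t" using sum_le by linarith
      then have "\<bar>E i t\<bar> \<le> 4 * M / t / p i" using p[of i] by (simp only: pos_le_divide_eq)
      then show ?thesis by (simp add: mult.commute)
    qed
    fix x
    have ps: "(\<lambda>k. (g j - t) ^ k *\<^sub>R (resolvent (complex_of_real (g j)) A ^^ Suc k) x)
        sums resolvent (complex_of_real t) A x"
    proof -
      have "cmod (complex_of_real t - complex_of_real (g j)) = \<bar>g j - t\<bar>"
        by (metis abs_minus_commute norm_of_real of_real_diff)
      then have "cmod (complex_of_real t - complex_of_real (g j)) * (M / g j) \<le> 1 / 2"
        using j(2) by simp
      from resolvent_power_series[OF lin rs[OF g[of j]] rs[OF t] M(2)[OF g[of j]] _ this]
      have "(\<lambda>k. (complex_of_real (g j) - complex_of_real t) ^ k *\<^sub>C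
          (resolvent (complex_of_real (g j)) A ^^ Suc k) x) sums resolvent (complex_of_real t) A x"
        using M g[of j] by auto
      then show ?thesis by (simp only: scaleR_scaleC of_real_power of_real_diff)
    qed
    have "summable (\<lambda>k. norm ((g j - t) ^ k *\<^sub>R (resolvent (complex_of_real (g j)) A ^^ Suc k) x))"
    proof (rule summable_comparison_test'[of "\<lambda>k. 2 * M / t * (1 / 2) ^ k * norm x" 0])
      show "summable (\<lambda>k. 2 * M / t * (1 / 2) ^ k * norm x)"
        by (intro summable_mult2 summable_mult complete_algebra_summable_geometric) auto
      fix k
      have "norm ((g j - t) ^ k *\<^sub>R (resolvent (complex_of_real (g j)) A ^^ Suc k) x)
          \<le> \<bar>g j - t\<bar> ^ k * ((M / g j) ^ Suc k * norm x)"
        unfolding norm_scaleR power_abs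
        by (intro mult_left_mono norm_funpow_le M g) (use M g[of j] in auto)
      also have "\<dots> \<le> 2 * M / t * (1 / 2) ^ k * norm x"
        using mult_right_mono[OF ab[of k] norm_ge_zero[of x]] by (simp add: ac_simps)
      finally show "norm (norm ((g j - t) ^ k *\<^sub>R (resolvent (complex_of_real (g j)) A ^^ Suc k) x))
          \<le> 2 * M / t * (1 / 2) ^ k * norm x" by simp
    qed
    from sums_fiber[OF e this ps, of j]
    show "(\<lambda>i. E i t *\<^sub>R P i x) sums resolvent (complex_of_real t) A x"
      by (rule sums_cong[THEN iffD1, rotated]) (simp add: En P_def Let_def case_prod_beta)
  qed (use M p Pn in simp_all)
qed

section \<open>Vector-valued integrals\<close>

abbreviation step_integrable where "step_integrable \<equiv> Bochner_Integration.simple_bochner_integrable"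
abbreviation step_integral where "step_integral \<equiv> Bochner_Integration.simple_bochner_integral"

text \<open>In a nonseparable space a difference of Borel maps need not be Borel. A simple function
  does no harm: on each of its finitely many level sets a constant is subtracted.\<close>

lemma borel_measurable_norm_diff_simple:
  fixes f s :: "'b \<Rightarrow> 'a::real_normed_vector"
  assumes f: "f \<in> borel_measurable M" and s: "simple_function M s"
  shows "(\<lambda>x. norm (f x - s x)) \<in> borel_measurable M"
proof -
  have fin: "finite (s ` space M)" using s by (rule simple_functionD)
  have "(\<lambda>x. \<Sum>c\<in>s ` space M. indicator (s -` {c} \<inter> space M) x * norm (f x - c)) \<in> borel_measurable M"
  proof (intro borel_measurable_sum borel_measurable_times borel_measurable_indicator)
    show "s -` {c} \<inter> space M \<in> sets M" for c using s by (rule simple_functionD)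
    show "(\<lambda>x. norm (f x - c)) \<in> borel_measurable M" for c
      by (rule measurable_compose[OF f]) (intro borel_measurable_continuous_onI continuous_intros)
  qed
  then show ?thesis
  proof (rule measurable_cong[THEN iffD1, rotated])
    fix x assume x: "x \<in> space M"
    have "(\<Sum>c\<in>s ` space M. indicator (s -` {c} \<inter> space M) x * norm (f x - c)) =
        (\<Sum>c\<in>s ` space M. if c = s x then norm (f x - c) else 0)"
      using x by (intro sum.cong) (auto simp: indicator_def)
    then show "(\<Sum>c\<in>s ` space M. indicator (s -` {c} \<inter> space M) x * norm (f x - c)) = norm (f x - s x)"
      using x fin by simp
  qed
qed

text \<open>Two simple functions are compared through \<open>f\<close> by the triangle inequality.
  If both approximate \<open>f\<close>, their integrals have the same limit.\<close>

lemma simple_bochner_integral_diff_le: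
  fixes f :: "'b \<Rightarrow> 'a::real_normed_vector"
  assumes f: "f \<in> borel_measurable M"
    and s: "step_integrable M s"
    and t: "step_integrable M t"
  shows "ennreal (norm (step_integral M s - step_integral M t))
    \<le> (\<integral>\<^sup>+x. ennreal (norm (f x - s x)) \<partial>M) + (\<integral>\<^sup>+x. ennreal (norm (f x - t x)) \<partial>M)"
proof -
  have st: "step_integrable M (\<lambda>x. s x - t x)"
    "step_integrable M (\<lambda>x. norm (s x - t x))"
    using s t by (auto intro: Bochner_Integration.simple_bochner_integrable_compose2[where p="(-)"]
        Bochner_Integration.simple_bochner_integrable_compose2[where p="\<lambda>x y. norm (x - y)"])
  have sf: "simple_function M s" "simple_function M t"
    using s t by (auto elim: Bochner_Integration.simple_bochner_integrable.cases)
  have "ennreal (norm (step_integral M s - step_integral M t))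
      \<le> ennreal (step_integral M (\<lambda>x. norm (s x - t x)))"
    using Bochner_Integration.simple_bochner_integral_norm_bound[OF st(1)] s t
    by (intro ennreal_leI) (simp add: Bochner_Integration.simple_bochner_integral_diff)
  also have "\<dots> = (\<integral>\<^sup>+x. ennreal (norm (s x - t x)) \<partial>M)"
    using st(2) by (intro Bochner_Integration.simple_bochner_integral_eq_nn_integral) auto
  also have "\<dots> \<le> (\<integral>\<^sup>+x. ennreal (norm (f x - s x)) + ennreal (norm (f x - t x)) \<partial>M)"
    by (intro nn_integral_mono) (auto simp flip: ennreal_plus intro!: ennreal_leI
        intro: norm_triangle_ineq4[THEN order_trans] simp: norm_diff_triangle_le dist_norm[symmetric] dist_triangle3)
  also have "\<dots> = (\<integral>\<^sup>+x. ennreal (norm (f x - s x)) \<partial>M) + (\<integral>\<^sup>+x. ennreal (norm (f x - t x)) \<partial>M)"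
    using borel_measurable_norm_diff_simple[OF f] sf by (intro nn_integral_add) auto
  finally show ?thesis .
qed

text \<open>Makes the core of the calculus single valued, since \<open>om_calc\<close> relates
  points to integrals by a relation. It also serves to identify two evaluations of the same
  integral.\<close>

lemma has_bochner_int_unique:
  assumes "has_bochner_int M f x" "has_bochner_int M f y"
  shows "x = y"
proof -
  obtain s where f: "f \<in> borel_measurable M" and s: "\<And>i. step_integrable M (s i)"
    "(\<lambda>i::nat. \<integral>\<^sup>+t. ennreal (norm (f t - s i t)) \<partial>M) \<longlonglongrightarrow> 0"
    "(\<lambda>i. step_integral M (s i)) \<longlonglongrightarrow> x"
    using assms(1) by (auto simp: has_bochner_int_def)
  obtain t where t: "\<And>i. step_integrable M (t i)"
    "(\<lambda>i::nat. \<integral>\<^sup>+x. ennreal (norm (f x - t i x)) \<partial>M) \<longlonglongrightarrow> 0"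
    "(\<lambda>i. step_integral M (t i)) \<longlonglongrightarrow> y"
    using assms(2) by (auto simp: has_bochner_int_def)
  let ?d = "\<lambda>i. step_integral M (s i) - step_integral M (t i)"
  have "(\<lambda>i. ennreal (norm (?d i))) \<longlonglongrightarrow> 0"
  proof (rule tendsto_sandwich[OF _ _ tendsto_const])
    show "(\<lambda>i. (\<integral>\<^sup>+x. ennreal (norm (f x - s i x)) \<partial>M) + (\<integral>\<^sup>+x. ennreal (norm (f x - t i x)) \<partial>M)) \<longlonglongrightarrow> 0"
      using tendsto_add[OF s(2) t(2)] by simp
  qed (auto intro!: always_eventually simple_bochner_integral_diff_le[OF f s(1) t(1)])
  then have "(\<lambda>i. norm (?d i)) \<longlonglongrightarrow> 0"
    using tendsto_ennreal_iff[of "\<lambda>i. norm (?d i)" sequentially 0] by simp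
  then have "?d \<longlonglongrightarrow> 0" by (rule tendsto_norm_zero_cancel)
  moreover have "?d \<longlonglongrightarrow> x - y" using s(3) t(3) by (rule tendsto_diff)
  ultimately show ?thesis using LIMSEQ_unique by fastforce
qed

lemma integrable_simple_approx:
  fixes g :: "'b \<Rightarrow> real"
  assumes "integrable M g" "0 < e"
  obtains s where "step_integrable M s"
    "(\<integral>\<^sup>+x. ennreal \<bar>g x - s x\<bar> \<partial>M) \<le> ennreal e"
    "\<bar>integral\<^sup>L M g - step_integral M s\<bar> \<le> e"
proof -
  obtain s where s: "\<And>i. step_integrable M (s i)"
    "(\<lambda>i::nat. \<integral>\<^sup>+t. ennreal (norm (g t - s i t)) \<partial>M) \<longlonglongrightarrow> 0"
    "(\<lambda>i. step_integral M (s i)) \<longlonglongrightarrow> integral\<^sup>L M g"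
    using has_bochner_integral_integrable[OF assms(1)] unfolding has_bochner_integral.simps by blast
  have "\<forall>\<^sub>F i in sequentially. (\<integral>\<^sup>+t. ennreal (norm (g t - s i t)) \<partial>M) < ennreal e"
    using assms(2) by (intro order_tendstoD(2)[OF s(2)]) simp
  moreover have "\<forall>\<^sub>F i in sequentially. dist (step_integral M (s i)) (integral\<^sup>L M g) < e"
    using s(3) assms(2) by (rule tendstoD)
  ultimately have "\<forall>\<^sub>F i in sequentially. (\<integral>\<^sup>+t. ennreal (norm (g t - s i t)) \<partial>M) < ennreal e \<and>
      dist (step_integral M (s i)) (integral\<^sup>L M g) < e"
    by eventually_elim auto
  then obtain i where "(\<integral>\<^sup>+t. ennreal (norm (g t - s i t)) \<partial>M) < ennreal e"
      "dist (step_integral M (s i)) (integral\<^sup>L M g) < e"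
    by (auto dest: eventually_happens)
  then show thesis using that[of "s i"] s(1) by (auto simp: dist_real_def abs_minus_commute less_imp_le)
qed

lemma simple_bochner_integrable_sum:
  fixes u :: "nat \<Rightarrow> 'a::real_normed_vector"
  assumes "\<And>i. step_integrable M (s i)"
  shows "step_integrable M (\<lambda>x. \<Sum>i<n. s i x *\<^sub>R u i) \<and>
    step_integral M (\<lambda>x. \<Sum>i<n. s i x *\<^sub>R u i) =
    (\<Sum>i<n. step_integral M (s i) *\<^sub>R u i)"
proof (induction n)
  case 0
  show ?case
    by (auto simp: Bochner_Integration.simple_bochner_integral_def image_constant_conv
        intro!: Bochner_Integration.simple_bochner_integrable.intros)
next
  case (Suc n)
  have 1: "step_integrable M (\<lambda>x. s n x *\<^sub>R u n)"
    by (rule Bochner_Integration.simple_bochner_integrable_compose2[where p="\<lambda>x y. x *\<^sub>R u n", OF _ assms assms]) simp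
  have 2: "step_integral M (\<lambda>x. s n x *\<^sub>R u n) =
      step_integral M (s n) *\<^sub>R u n"
    by (rule Bochner_Integration.simple_bochner_integral_linear[where f="\<lambda>x. x *\<^sub>R u n"])
      (auto intro: linearI assms simp: scaleR_add_left)
  show ?case
    using Suc 1 2 by (auto simp: Bochner_Integration.simple_bochner_integral_add
        intro: Bochner_Integration.simple_bochner_integrable_compose2[where p="(+)"])
qed

text \<open>For real coefficients and fixed vectors the integral reduces to scalar ones. The n-th
  simple function keeps the first n terms and replaces each coefficient by a simple one; the error
  in the mean is the tail of \<open>su\<close> plus n small errors.\<close>

lemma has_bochner_int_series:
  fixes f :: "'b \<Rightarrow> 'a::banach" and g :: "nat \<Rightarrow> 'b \<Rightarrow> real"
  assumes f: "f \<in> borel_measurable M" and g: "\<And>i. integrable M (g i)"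
    and sums: "\<And>t. t \<in> space M \<Longrightarrow> (\<lambda>i. g i t *\<^sub>R u i) sums f t"
    and su: "summable (\<lambda>i. (\<integral>t. \<bar>g i t\<bar> \<partial>M) * norm (u i))"
  shows "has_bochner_int M f (\<Sum>i. integral\<^sup>L M (g i) *\<^sub>R u i)"
proof -
  \<comment> \<open>Chosen so that n errors, weighted by the norms of the vectors, add up to at most
    n/(n+1)^2, hence to at most 1/(n+1). The summand 1 avoids a division by 0.\<close>
  define e where "e i n = 1 / (real (Suc n) ^ 2 * (1 + norm (u i)))" for i n
  have e: "e i n > 0" "e i n * norm (u i) \<le> 1 / real (Suc n) ^ 2" for i n
  proof -
    have "1 + norm (u i) > 0" using norm_ge_zero[of "u i"] by linarith
    then show "e i n > 0" by (auto simp: e_def)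
    have "e i n * norm (u i) = 1 / real (Suc n) ^ 2 * (norm (u i) / (1 + norm (u i)))"
      by (simp add: e_def)
    also have "\<dots> \<le> 1 / real (Suc n) ^ 2 * 1" using \<open>1 + norm (u i) > 0\<close> by (intro mult_left_mono) auto
    finally show "e i n * norm (u i) \<le> 1 / real (Suc n) ^ 2" by simp
  qed
  have "\<exists>s. step_integrable M s \<and>
    (\<integral>\<^sup>+x. ennreal \<bar>g i x - s x\<bar> \<partial>M) \<le> ennreal (e i n) \<and>
    \<bar>integral\<^sup>L M (g i) - step_integral M s\<bar> \<le> e i n" for i n
    using integrable_simple_approx[OF g e(1)] by metis
  then obtain s where s: "\<And>i n. step_integrable M (s i n)"
    "\<And>i n. (\<integral>\<^sup>+x. ennreal \<bar>g i x - s i n x\<bar> \<partial>M) \<le> ennreal (e i n)"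
    "\<And>i n. \<bar>integral\<^sup>L M (g i) - step_integral M (s i n)\<bar> \<le> e i n"
    by metis
  have sm: "s i n \<in> borel_measurable M" for i n
    using s(1)[of i n] by (auto elim!: Bochner_Integration.simple_bochner_integrable.cases intro: borel_measurable_simple_function)
  define S where "S n x = (\<Sum>i<n. s i n x *\<^sub>R u i)" for n x
  have S: "step_integrable M (S n)"
    "step_integral M (S n) =
      (\<Sum>i<n. step_integral M (s i n) *\<^sub>R u i)" for n
    unfolding S_def using simple_bochner_integrable_sum[where s="\<lambda>i. s i n" and n=n and u=u and M=M] s(1) by auto
  define a where "a i = (\<integral>t. \<bar>g i t\<bar> \<partial>M) * norm (u i)" for i
  have a: "a i \<ge> 0" "(\<integral>\<^sup>+x. ennreal (\<bar>g i x\<bar> * norm (u i)) \<partial>M) = ennreal (a i)" for i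
    using g[of i] by (auto simp: a_def nn_integral_eq_integral)
  have sua: "summable a" using su unfolding a_def .
  have norm_le: "ennreal (norm (f x - S n x)) \<le>
      (\<Sum>i. ennreal (\<bar>g (i + n) x\<bar> * norm (u (i + n)))) + (\<Sum>i<n. ennreal (\<bar>g i x - s i n x\<bar> * norm (u i)))"
    if x: "x \<in> space M" for x n
  proof -
    let ?r = "\<lambda>i. g (i + n) x *\<^sub>R u (i + n)"
    have r: "?r sums (f x - (\<Sum>i<n. g i x *\<^sub>R u i))"
      using sums_split_initial_segment[OF sums[OF x]] .
    have 1: "ennreal (norm (f x - (\<Sum>i<n. g i x *\<^sub>R u i))) \<le> (\<Sum>i. ennreal (norm (?r i)))"
    \<comment> \<open>Pointwise absolute convergence is not assumed. Where it fails, the right-hand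
      side is infinite and nothing is to be shown.\<close>
    proof (cases "(\<Sum>i. ennreal (norm (?r i))) = top")
      case False
      then have sr: "summable (\<lambda>i. norm (?r i))" by (intro summable_suminf_not_top) auto
      have "norm (f x - (\<Sum>i<n. g i x *\<^sub>R u i)) \<le> (\<Sum>i. norm (?r i))"
        using summable_norm[OF sr] sums_unique[OF r] by simp
      then have "ennreal (norm (f x - (\<Sum>i<n. g i x *\<^sub>R u i))) \<le> ennreal (\<Sum>i. norm (?r i))"
        by (rule ennreal_leI)
      also have "\<dots> = (\<Sum>i. ennreal (norm (?r i)))" using sr by (intro suminf_ennreal2[symmetric]) auto
      finally show ?thesis .
    qed simp
    have "norm ((\<Sum>i<n. g i x *\<^sub>R u i) - S n x) \<le> (\<Sum>i<n. \<bar>g i x - s i n x\<bar> * norm (u i))"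
      unfolding S_def by (simp flip: sum_subtractf scaleR_left_diff_distrib add: sum_norm_le)
    then have 2: "ennreal (norm ((\<Sum>i<n. g i x *\<^sub>R u i) - S n x)) \<le> (\<Sum>i<n. ennreal (\<bar>g i x - s i n x\<bar> * norm (u i)))"
      by (subst sum_ennreal) (auto intro: ennreal_leI)
    have "ennreal (norm (f x - S n x)) \<le> ennreal (norm (f x - (\<Sum>i<n. g i x *\<^sub>R u i)) + norm ((\<Sum>i<n. g i x *\<^sub>R u i) - S n x))"
      by (intro ennreal_leI) (metis diff_add_cancel add_diff_eq norm_triangle_ineq)
    also have "\<dots> = ennreal (norm (f x - (\<Sum>i<n. g i x *\<^sub>R u i))) + ennreal (norm ((\<Sum>i<n. g i x *\<^sub>R u i) - S n x))"
      by simp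
    also have "\<dots> \<le> (\<Sum>i. ennreal (norm (?r i))) + (\<Sum>i<n. ennreal (\<bar>g i x - s i n x\<bar> * norm (u i)))"
      by (intro add_mono 1 2)
    finally show ?thesis by simp
  qed
  have bound: "(\<integral>\<^sup>+x. ennreal (norm (f x - S n x)) \<partial>M) \<le> ennreal ((\<Sum>i. a (i + n)) + 1 / real (Suc n))" for n
  proof -
    have "(\<integral>\<^sup>+x. ennreal (norm (f x - S n x)) \<partial>M) \<le>
        (\<integral>\<^sup>+x. (\<Sum>i. ennreal (\<bar>g (i + n) x\<bar> * norm (u (i + n)))) +
          (\<Sum>i<n. ennreal (\<bar>g i x - s i n x\<bar> * norm (u i))) \<partial>M)"
      by (intro nn_integral_mono norm_le)
    also have "\<dots> = (\<Sum>i. \<integral>\<^sup>+x. ennreal (\<bar>g (i + n) x\<bar> * norm (u (i + n))) \<partial>M) +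
        (\<Sum>i<n. \<integral>\<^sup>+x. ennreal (\<bar>g i x - s i n x\<bar> * norm (u i)) \<partial>M)"
      using g sm by (subst nn_integral_add nn_integral_suminf nn_integral_sum; (measurable | simp))+
    also have "(\<Sum>i. \<integral>\<^sup>+x. ennreal (\<bar>g (i + n) x\<bar> * norm (u (i + n))) \<partial>M) = ennreal (\<Sum>i. a (i + n))"
      unfolding a(2) using a(1) sua by (intro suminf_ennreal2) (auto simp: summable_iff_shift)
    also have "(\<Sum>i<n. \<integral>\<^sup>+x. ennreal (\<bar>g i x - s i n x\<bar> * norm (u i)) \<partial>M) \<le> (\<Sum>i<n. ennreal (1 / real (Suc n) ^ 2))"
    proof (intro sum_mono)
      fix i
      have "(\<integral>\<^sup>+x. ennreal (\<bar>g i x - s i n x\<bar> * norm (u i)) \<partial>M) =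
          (\<integral>\<^sup>+x. ennreal \<bar>g i x - s i n x\<bar> \<partial>M) * ennreal (norm (u i))"
        using g[of i] sm by (simp add: ennreal_mult nn_integral_multc)
      also have "\<dots> \<le> ennreal (e i n) * ennreal (norm (u i))"
        by (intro mult_right_mono s) auto
      also have "\<dots> \<le> ennreal (1 / real (Suc n) ^ 2)"
        using e(2)[of i n] e(1)[of i n] by (simp flip: ennreal_mult add: ennreal_leI)
      finally show "(\<integral>\<^sup>+x. ennreal (\<bar>g i x - s i n x\<bar> * norm (u i)) \<partial>M) \<le> ennreal (1 / real (Suc n) ^ 2)" .
    qed
    also have "(\<Sum>i<n. ennreal (1 / real (Suc n) ^ 2)) = ennreal (real n / real (Suc n) ^ 2)"
      by (subst sum_ennreal) auto
    also have "\<dots> \<le> ennreal (1 / real (Suc n))"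
      using divide_right_mono[of "real n" "real (Suc n)" "real (Suc n) ^ 2"]
      by (intro ennreal_leI) (simp add: power2_eq_square)
    also have "ennreal (\<Sum>i. a (i + n)) + ennreal (1 / real (Suc n)) = ennreal ((\<Sum>i. a (i + n)) + 1 / real (Suc n))"
      using a(1) sua by (intro ennreal_plus[symmetric] suminf_nonneg) (auto simp: summable_iff_shift)
    finally show ?thesis by (simp add: add_mono)
  qed
  have tail: "(\<lambda>n. (\<Sum>i. a (i + n)) + 1 / real (Suc n)) \<longlonglongrightarrow> 0"
    using tendsto_add[OF suminf_exist_split2[OF sua] lim_inverse_n'[THEN LIMSEQ_Suc]] by simp
  have "(\<lambda>n. \<integral>\<^sup>+x. ennreal (norm (f x - S n x)) \<partial>M) \<longlonglongrightarrow> 0"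
  proof (rule tendsto_sandwich[OF _ _ tendsto_const])
    show "(\<lambda>n. ennreal ((\<Sum>i. a (i + n)) + 1 / real (Suc n))) \<longlonglongrightarrow> 0"
      using tendsto_ennrealI[OF tail] by simp
  qed (use bound in auto)
  moreover have "(\<lambda>n. step_integral M (S n)) \<longlonglongrightarrow> (\<Sum>i. integral\<^sup>L M (g i) *\<^sub>R u i)"
  proof -
    have "summable (\<lambda>i. integral\<^sup>L M (g i) *\<^sub>R u i)"
      by (rule summable_comparison_test'[OF sua, of 0])
        (auto simp: a_def intro!: mult_right_mono integral_abs_bound)
    then have 1: "(\<lambda>n. \<Sum>i<n. integral\<^sup>L M (g i) *\<^sub>R u i) \<longlonglongrightarrow> (\<Sum>i. integral\<^sup>L M (g i) *\<^sub>R u i)"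
      by (rule summable_LIMSEQ)
    have "(\<lambda>n. step_integral M (S n) - (\<Sum>i<n. integral\<^sup>L M (g i) *\<^sub>R u i)) \<longlonglongrightarrow> 0"
    proof (rule Lim_null_comparison)
      have "norm (step_integral M (S n) - (\<Sum>i<n. integral\<^sup>L M (g i) *\<^sub>R u i)) \<le> 1 / real (Suc n)" for n
      proof -
        have "norm (step_integral M (S n) - (\<Sum>i<n. integral\<^sup>L M (g i) *\<^sub>R u i)) \<le>
            (\<Sum>i<n. 1 / real (Suc n) ^ 2)"
          unfolding S(2) sum_subtractf[symmetric] scaleR_left_diff_distrib[symmetric]
        proof (intro sum_norm_le)
          fix i
          have "norm ((step_integral M (s i n) - integral\<^sup>L M (g i)) *\<^sub>R u i) \<le> e i n * norm (u i)"
            using s(3)[of i n] by (simp add: abs_minus_commute mult_right_mono)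
          then show "norm ((step_integral M (s i n) - integral\<^sup>L M (g i)) *\<^sub>R u i) \<le> 1 / real (Suc n) ^ 2"
            using e(2)[of i n] by linarith
        qed
        also have "\<dots> \<le> 1 / real (Suc n)"
          using divide_right_mono[of "real n" "real (Suc n)" "real (Suc n) ^ 2"]
          by (simp add: power2_eq_square)
        finally show ?thesis .
      qed
      then show "\<forall>\<^sub>F n in sequentially. norm (step_integral M (S n) -
        (\<Sum>i<n. integral\<^sup>L M (g i) *\<^sub>R u i)) \<le> 1 / real (Suc n)" by simp
      show "(\<lambda>n. 1 / real (Suc n)) \<longlonglongrightarrow> 0" by (rule lim_inverse_n'[THEN LIMSEQ_Suc])
    qed
    from tendsto_add[OF this 1] show ?thesis by simp
  qed
  ultimately show ?thesis unfolding has_bochner_int_def using f S(1) by blast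
qed

text \<open>Measurability of the difference is a hypothesis of its own, as it does not follow from
  that of the two functions in a nonseparable space.\<close>

lemma has_bochner_int_diff:
  fixes f g :: "'b \<Rightarrow> 'a::real_normed_vector"
  assumes "has_bochner_int M f x" "has_bochner_int M g y"
    and m: "(\<lambda>t. f t - g t) \<in> borel_measurable M"
  shows "has_bochner_int M (\<lambda>t. f t - g t) (x - y)"
proof -
  obtain s where f: "f \<in> borel_measurable M" and s: "\<And>i. step_integrable M (s i)"
    "(\<lambda>i::nat. \<integral>\<^sup>+t. ennreal (norm (f t - s i t)) \<partial>M) \<longlonglongrightarrow> 0"
    "(\<lambda>i. step_integral M (s i)) \<longlonglongrightarrow> x"
    using assms(1) by (auto simp: has_bochner_int_def)
  obtain r where g: "g \<in> borel_measurable M" and r: "\<And>i. step_integrable M (r i)"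
    "(\<lambda>i::nat. \<integral>\<^sup>+t. ennreal (norm (g t - r i t)) \<partial>M) \<longlonglongrightarrow> 0"
    "(\<lambda>i. step_integral M (r i)) \<longlonglongrightarrow> y"
    using assms(2) by (auto simp: has_bochner_int_def)
  have sf: "simple_function M (s i)" "simple_function M (r i)" for i
    using s(1)[of i] r(1)[of i] by (auto elim: Bochner_Integration.simple_bochner_integrable.cases)
  have "(\<lambda>i. \<integral>\<^sup>+t. ennreal (norm ((f t - g t) - (s i t - r i t))) \<partial>M) \<longlonglongrightarrow> 0"
  proof (rule tendsto_sandwich[OF _ _ tendsto_const])
    show "(\<lambda>i. (\<integral>\<^sup>+t. ennreal (norm (f t - s i t)) \<partial>M) + (\<integral>\<^sup>+t. ennreal (norm (g t - r i t)) \<partial>M)) \<longlonglongrightarrow> 0"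
      using tendsto_add[OF s(2) r(2)] by simp
    have "(\<integral>\<^sup>+t. ennreal (norm ((f t - g t) - (s i t - r i t))) \<partial>M) \<le>
        (\<integral>\<^sup>+t. ennreal (norm (f t - s i t)) \<partial>M) + (\<integral>\<^sup>+t. ennreal (norm (g t - r i t)) \<partial>M)" for i
    proof -
      have "(\<integral>\<^sup>+t. ennreal (norm ((f t - g t) - (s i t - r i t))) \<partial>M) \<le>
          (\<integral>\<^sup>+t. ennreal (norm (f t - s i t)) + ennreal (norm (g t - r i t)) \<partial>M)"
      proof (intro nn_integral_mono)
        fix t
        have "norm ((f t - g t) - (s i t - r i t)) \<le> norm (f t - s i t) + norm (g t - r i t)"
          using norm_triangle_ineq4[of "f t - s i t" "g t - r i t"] by (simp add: algebra_simps)
        then show "ennreal (norm ((f t - g t) - (s i t - r i t))) \<le>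
            ennreal (norm (f t - s i t)) + ennreal (norm (g t - r i t))"
          by (simp flip: ennreal_plus add: ennreal_leI)
      qed
      also have "\<dots> = (\<integral>\<^sup>+t. ennreal (norm (f t - s i t)) \<partial>M) + (\<integral>\<^sup>+t. ennreal (norm (g t - r i t)) \<partial>M)"
        using borel_measurable_norm_diff_simple f g sf
        by (intro nn_integral_add) (auto intro!: borel_measurable_norm_diff_simple)
      finally show ?thesis .
    qed
    then show "\<forall>\<^sub>F i in sequentially. (\<integral>\<^sup>+t. ennreal (norm ((f t - g t) - (s i t - r i t))) \<partial>M) \<le>
        (\<integral>\<^sup>+t. ennreal (norm (f t - s i t)) \<partial>M) + (\<integral>\<^sup>+t. ennreal (norm (g t - r i t)) \<partial>M)" by simp
  qed simp
  moreover have "(\<lambda>i. step_integral M (\<lambda>t. s i t - r i t)) \<longlonglongrightarrow> x - y"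
    using tendsto_diff[OF s(3) r(3)] by (simp add: Bochner_Integration.simple_bochner_integral_diff s r)
  moreover have "step_integrable M (\<lambda>t. s i t - r i t)" for i
    using s(1) r(1) by (auto intro: Bochner_Integration.simple_bochner_integrable_compose2[where p="(-)"])
  ultimately show ?thesis unfolding has_bochner_int_def using m
    by (intro conjI exI[of _ "\<lambda>i t. s i t - r i t"]) auto
qed

section \<open>The trace of a nuclear operator\<close>

text \<open>The constant is the distance of y from the closed span, and scaling by k gives the
  inequality. It says that the y-coordinate of a vector is bounded by its norm.\<close>

lemma complex_span_coordinate_bound:
  fixes S :: "'a::complex_banach set"
  assumes "closed (complex_vector.span S)" "y \<notin> complex_vector.span S"
  obtains d where "d > 0" "\<And>v k. v \<in> complex_vector.span S \<Longrightarrow> cmod k * d \<le> norm (v + k *\<^sub>C y)"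
proof (rule that[of "infdist y (complex_vector.span S)"])
  let ?V = "complex_vector.span S"
  have ne: "?V \<noteq> {}" using complex_vector.span_zero by blast
  show "infdist y ?V > 0" using assms ne by (simp add: infdist_pos_not_in_closed)
  fix v k assume v: "v \<in> ?V"
  show "cmod k * infdist y ?V \<le> norm (v + k *\<^sub>C y)"
  proof (cases "k = 0")
    case False
    have "- (1 / k) *\<^sub>C v \<in> ?V" using v by (rule complex_vector.span_scale)
    then have "infdist y ?V \<le> norm (y - (- (1 / k) *\<^sub>C v))" using infdist_le by (fastforce simp: dist_norm)
    then have "cmod k * infdist y ?V \<le> norm (k *\<^sub>C (y - (- (1 / k) *\<^sub>C v)))"
      by (simp add: norm_scaleC mult_left_mono)
    also have "k *\<^sub>C (y - (- (1 / k) *\<^sub>C v)) = v + k *\<^sub>C y"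
      using False by (simp add: complex_vector.scale_right_diff_distrib scaleC_add_right)
    finally show ?thesis .
  qed simp
qed

text \<open>By the coordinate bound the y-coordinates of a convergent sequence form a Cauchy
  sequence; subtracting them leaves a convergent sequence in the closed span of
  \<open>S\<close>.\<close>

lemma closed_complex_span_insert:
  fixes S :: "'a::complex_banach set"
  assumes cl: "closed (complex_vector.span S)"
  shows "closed (complex_vector.span (insert y S))"
proof (cases "y \<in> complex_vector.span S")
  case True
  then show ?thesis using cl by (simp add: complex_vector.span_redundant)
next
  case False
  let ?V = "complex_vector.span S"
  obtain d where d: "d > 0" "\<And>v k. v \<in> ?V \<Longrightarrow> cmod k * d \<le> norm (v + k *\<^sub>C y)"
    using complex_span_coordinate_bound[OF cl False] by blast
  show ?thesis
    unfolding closed_sequential_limits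
  proof safe
    fix z l assume z: "\<forall>n. z n \<in> complex_vector.span (insert y S)" "z \<longlonglongrightarrow> l"
    then have "\<forall>n. \<exists>k. z n - k *\<^sub>C y \<in> ?V" by (simp add: complex_vector.span_insert)
    then obtain k where k: "\<And>n. z n - k n *\<^sub>C y \<in> ?V" by metis
    have bd: "cmod (k m - k n) * d \<le> norm (z m - z n)" for m n
    proof -
      have "(z m - k m *\<^sub>C y) - (z n - k n *\<^sub>C y) \<in> ?V" by (intro complex_vector.span_diff k)
      from d(2)[OF this, of "k m - k n"] show ?thesis
        by (simp add: complex_vector.scale_left_diff_distrib algebra_simps)
    qed
    have "Cauchy k"
    proof (rule CauchyI)
      fix e :: real assume "e > 0"
      then have "e * d > 0" using d by simp
      then obtain N where N: "\<And>m n. m \<ge> N \<Longrightarrow> n \<ge> N \<Longrightarrow> norm (z m - z n) < e * d"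
        using CauchyD[OF LIMSEQ_imp_Cauchy[OF z(2)]] by metis
      have "norm (k m - k n) < e" if "m \<ge> N" "n \<ge> N" for m n
      proof -
        have "cmod (k m - k n) * d < e * d" using bd[of m n] N[OF that] by linarith
        then show ?thesis using d(1) by simp
      qed
      then show "\<exists>N. \<forall>m\<ge>N. \<forall>n\<ge>N. norm (k m - k n) < e" by blast
    qed
    then obtain c where c: "k \<longlonglongrightarrow> c" using Cauchy_convergent convergent_def by blast
    have "(\<lambda>n. z n - k n *\<^sub>C y) \<longlonglongrightarrow> l - c *\<^sub>C y"
      by (intro tendsto_diff z tendsto_scaleC c tendsto_const)
    then have "l - c *\<^sub>C y \<in> ?V" by (rule closed_sequentially[OF cl _, rotated]) (rule k)
    then show "l \<in> complex_vector.span (insert y S)" by (auto simp: complex_vector.span_insert)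
  qed
qed

lemma closed_complex_span_finite:
  "finite S \<Longrightarrow> closed (complex_vector.span (S :: 'a::complex_banach set))"
  by (induction S rule: finite_induct) (simp_all add: closed_complex_span_insert)

text \<open>Gives finite rank operators the form that a trace computation needs. The induction
  splits off one spanning vector, whose coordinate functional is continuous by
  \<open>complex_span_coordinate_bound\<close>.\<close>

lemma bounded_clinear_into_span:
  fixes F :: "'b::complex_normed_vector \<Rightarrow> 'a::complex_banach"
  assumes "finite S" "bounded_clinear F" "range F \<subseteq> complex_vector.span S"
  shows "\<exists>(m::nat) g y. (\<forall>i. bounded_clinear (g i)) \<and> (\<forall>v. F v = (\<Sum>i<m. g i v *\<^sub>C y i))"
  using assms
proof (induction S arbitrary: F rule: finite_induct)
  case empty
  then have "F v = (\<Sum>i<0::nat. (0::complex) *\<^sub>C 0)" for v by auto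
  then show ?case using bounded_clinear_0 by (intro exI[of _ "0::nat"] exI[of _ "\<lambda>i v. 0"]) auto
next
  case (insert y S)
  let ?V = "complex_vector.span S"
  have cl: "closed ?V" using insert closed_complex_span_finite by blast
  show ?case
  proof (cases "y \<in> ?V")
    case True
    then show ?thesis using insert by (simp add: complex_vector.span_redundant)
  next
    case False
    obtain d where d: "d > 0" "\<And>v k. v \<in> ?V \<Longrightarrow> cmod k * d \<le> norm (v + k *\<^sub>C y)"
      using complex_span_coordinate_bound[OF cl False] by blast
    have "\<forall>v. \<exists>k. F v - k *\<^sub>C y \<in> ?V" using insert.prems by (auto simp: complex_vector.span_insert)
    then obtain k where k: "\<And>v. F v - k v *\<^sub>C y \<in> ?V" by metis
    \<comment> \<open>Uniqueness of the coordinate, from which the linearity of the chosen function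
      \<open>k\<close> is read off.\<close>
    have eq: "c = c'" if "x - c *\<^sub>C y \<in> ?V" "x - c' *\<^sub>C y \<in> ?V" for c c' x
    proof -
      have "(x - c *\<^sub>C y) - (x - c' *\<^sub>C y) \<in> ?V" using that by (rule complex_vector.span_diff)
      from d(2)[OF this, of "c - c'"] d(1) show ?thesis
        by (simp add: complex_vector.scale_left_diff_distrib algebra_simps mult_le_0_iff)
    qed
    have kb: "cmod (k v) * d \<le> norm (F v)" for v using d(2)[OF k, of "k v" v] by simp
    have bk: "bounded_clinear k"
    proof (rule bounded_clinearI[where K="onorm F / d"])
      show "k (v + w) = k v + k w" for v w
      proof (rule eq[OF k])
        have "(F v - k v *\<^sub>C y) + (F w - k w *\<^sub>C y) \<in> ?V" by (intro complex_vector.span_add k)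
        then show "F (v + w) - (k v + k w) *\<^sub>C y \<in> ?V"
          by (simp add: bounded_clinear_add[OF insert.prems(1)] scaleC_add_left algebra_simps)
      qed
      show "k (c *\<^sub>C v) = c *\<^sub>C k v" for c v
      proof (rule eq[OF k])
        have "c *\<^sub>C (F v - k v *\<^sub>C y) \<in> ?V" by (intro complex_vector.span_scale k)
        then show "F (c *\<^sub>C v) - (c *\<^sub>C k v) *\<^sub>C y \<in> ?V"
          by (simp add: bounded_clinear_scaleC[OF insert.prems(1)] complex_vector.scale_right_diff_distrib
              scaleC_complex_def)
      qed
      show "norm (k v) \<le> norm v * (onorm F / d)" for v
        using order_trans[OF kb bounded_clinear_onorm[OF insert.prems(1)], of v] d(1)
        by (simp add: field_simps)
    qed
    have "bounded_clinear (\<lambda>v. F v + - (k v *\<^sub>C y))"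
      by (intro bounded_clinear_plus bounded_clinear_uminus bounded_clinear_scaleC_const bk insert.prems)
    then have "bounded_clinear (\<lambda>v. F v - k v *\<^sub>C y)" by simp
    from insert.IH[OF this] k obtain m :: nat and g z
      where g: "\<And>i. bounded_clinear (g i)" "\<And>v. F v - k v *\<^sub>C y = (\<Sum>i<m. g i v *\<^sub>C z i)"
      by blast
    have "F v = (\<Sum>i<Suc m. (if i = m then k else g i) v *\<^sub>C (if i = m then y else z i))" for v
    proof -
      have "F v = (\<Sum>i<m. g i v *\<^sub>C z i) + k v *\<^sub>C y" using g(2)[of v] by (simp add: algebra_simps)
      then show ?thesis by simp
    qed
    moreover have "bounded_clinear (if i = m then k else g i)" for i using g bk by simp
    ultimately show ?thesis
      by (intro exI[of _ "Suc m"] exI[of _ "\<lambda>i. if i = m then k else g i"]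
          exI[of _ "\<lambda>i. if i = m then y else z i"]) simp
  qed
qed

text \<open>The classical weights: with the tails \<open>r n\<close> of the series, \<open>a n / sqrt (r n) \<le> 2 (sqrt (r n) - sqrt (r (n + 1)))\<close>.\<close>

lemma summable_weight_at_top:
  fixes a :: "nat \<Rightarrow> real"
  assumes a: "\<And>n. 0 \<le> a n" "summable a"
  obtains b where "\<And>n. 0 < b n" "filterlim b at_top sequentially" "summable (\<lambda>n. a n * b n)"
proof -
  \<comment> \<open>The added geometric term keeps all tails positive, even if \<open>a\<close> is
    eventually 0, so that their square roots can be inverted.\<close>
  define c where "c n = a n + (1 / 2) ^ n" for n
  have "summable c" unfolding c_def by (intro summable_add a complete_algebra_summable_geometric) auto
  then have c: "c n > 0" "summable c" for n
    using a by (auto simp: c_def add_nonneg_pos)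
  define r where "r n = (\<Sum>k. c (k + n))" for n
  have sc: "summable (\<lambda>k. c (k + n))" for n using c by (simp add: summable_iff_shift)
  have r: "r n > 0" for n unfolding r_def using c sc by (intro suminf_pos) auto
  have rS: "c n = r n - r (Suc n)" for n
    using suminf_split_head[OF sc[of n]] by (simp add: r_def)
  have r0: "r \<longlonglongrightarrow> 0" unfolding r_def by (rule suminf_exist_split2[OF c(2)])
  show thesis
  proof (rule that[of "\<lambda>n. 1 / sqrt (r n)"])
    show "0 < 1 / sqrt (r n)" for n using r by simp
    have "(\<lambda>n. sqrt (r n)) \<longlonglongrightarrow> 0" using tendsto_real_sqrt[OF r0] by simp
    then show "filterlim (\<lambda>n. 1 / sqrt (r n)) at_top sequentially"
      unfolding inverse_eq_divide[symmetric]
      by (intro filterlim_inverse_at_top) (auto simp: r)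
    have tele: "summable (\<lambda>n. 2 * (sqrt (r n) - sqrt (r (Suc n))))"
      by (intro summable_mult telescope_summable'[OF \<open>(\<lambda>n. sqrt (r n)) \<longlonglongrightarrow> 0\<close>])
    show "summable (\<lambda>n. a n * (1 / sqrt (r n)))"
    proof (rule summable_comparison_test'[OF tele, of 0])
      fix n
      have mono: "sqrt (r (Suc n)) \<le> sqrt (r n)" using rS[of n] c(1)[of n] by simp
      have "r n - r (Suc n) = (sqrt (r n) - sqrt (r (Suc n))) * (sqrt (r n) + sqrt (r (Suc n)))"
        using r[of n] r[of "Suc n"] by (simp add: algebra_simps less_imp_le flip: power2_eq_square)
      also have "\<dots> \<le> (sqrt (r n) - sqrt (r (Suc n))) * (2 * sqrt (r n))"
        using mono by (intro mult_left_mono) auto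
      moreover have "a n \<le> r n - r (Suc n)" unfolding rS[of n, symmetric] by (simp add: c_def)
      ultimately have "a n \<le> 2 * (sqrt (r n) - sqrt (r (Suc n))) * sqrt (r n)"
        by (simp add: algebra_simps)
      then have "a n / sqrt (r n) \<le> 2 * (sqrt (r n) - sqrt (r (Suc n)))"
        using r[of n] by (simp add: pos_divide_le_eq)
      then show "norm (a n * (1 / sqrt (r n))) \<le> 2 * (sqrt (r n) - sqrt (r (Suc n)))"
        using a r[of n] by simp
    qed
  qed
qed

text \<open>The n-th partial sum consists of partial sums of \<open>f\<close> and \<open>g\<close>
  of lengths (n+1) div 2 and n div 2, which both tend to infinity.\<close>

lemma sums_interleave:
  fixes f g :: "nat \<Rightarrow> 'a::real_normed_vector"
  assumes "f sums x" "g sums y"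
  shows "(\<lambda>n. if even n then f (n div 2) else g (n div 2)) sums (x + y)"
proof -
  have "(\<Sum>k<n. if even k then f (k div 2) else g (k div 2)) = (\<Sum>k<(n + 1) div 2. f k) + (\<Sum>k<n div 2. g k)" for n
    by (induction n) (auto elim!: evenE oddE)
  moreover have "filterlim (\<lambda>n::nat. n div 2) at_top sequentially"
    unfolding filterlim_at_top by (intro allI, rule_tac c="2 * Z" in eventually_sequentiallyI) linarith
  moreover have "filterlim (\<lambda>n::nat. (n + 1) div 2) at_top sequentially"
    unfolding filterlim_at_top by (intro allI, rule_tac c="2 * Z" in eventually_sequentiallyI) linarith
  ultimately show ?thesis
    using assms unfolding sums_def by (auto intro!: tendsto_add intro: filterlim_compose)
qed

text \<open>After rescaling, the vectors \<open>x n\<close> tend to \<open>0\<close> and the functionals \<open>f n\<close> are summable. A finite rank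
  operator close to the identity on the compact set \<open>{0, x 0, x 1, \<dots>}\<close> changes the sum by little,
  and makes it the trace of a finite rank operator, which vanishes.\<close>

lemma nuclear_trace_zero_aux:
  fixes x :: "nat \<Rightarrow> 'a::complex_banach"
  assumes ap: "approximation_property TYPE('a)" and f: "\<And>n. bounded_clinear (f n :: 'a \<Rightarrow> complex)"
    and su: "summable (\<lambda>n. onorm (f n))" and x: "x \<longlonglongrightarrow> 0"
    and sums: "\<And>v. (\<lambda>n. f n v *\<^sub>C x n) sums 0"
  shows "(\<Sum>n. f n (x n)) = 0"
proof -
  have nn: "0 \<le> onorm (f n)" for n by (rule bounded_clinear_onorm_nonneg[OF f])
  have "norm (\<Sum>n. f n (x n)) \<le> 0 + e" if e: "e > 0" for e
  proof -
    define s where "s = (\<Sum>n. onorm (f n))"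
    have s: "s \<ge> 0" unfolding s_def using su nn by (rule suminf_nonneg)
    define d where "d = e / (s + 1)"
    have d: "d > 0" using e s by (simp add: d_def)
    have "compact (insert 0 (range x))"
      using compactin_sequence_with_limit[of euclidean x 0] x by (simp add: limitin_canonical_iff)
    then obtain F where F: "finite_rank F" "\<And>v. v \<in> insert 0 (range x) \<Longrightarrow> norm (F v - v) < d"
      using ap d unfolding approximation_property_def by meson
    then obtain S where S: "finite S" "bounded_clinear F" "range F \<subseteq> complex_vector.span S"
      by (auto simp: finite_rank_def)
    from bounded_clinear_into_span[OF this] obtain m :: nat and g and y :: "nat \<Rightarrow> 'a"
      where g: "\<And>i. bounded_clinear (g i)" "\<And>v. F v = (\<Sum>i<m. g i v *\<^sub>C y i)" by blast
    \<comment> \<open>With \<open>F\<close> in its finite form the sum over n can be taken first: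
      the sum of f n (y i) x n is the represented operator at y i, which is 0.\<close>
    have "f n (F (x n)) = (\<Sum>i<m. g i (f n (y i) *\<^sub>C x n))" for n
    proof -
      interpret bounded_linear "f n" using f by (rule bounded_clinear_imp_bounded_linear)
      show ?thesis
        by (simp add: g(2) sum bounded_clinear_scaleC[OF f] bounded_clinear_scaleC[OF g(1)] scaleC_complex_def mult.commute)
    qed
    moreover have "(\<lambda>n. \<Sum>i<m. g i (f n (y i) *\<^sub>C x n)) sums (\<Sum>i<m. g i 0)"
      by (intro sums_sum bounded_clinear_sums[OF g(1)] sums)
    ultimately have F0: "(\<lambda>n. f n (F (x n))) sums 0" by (simp add: bounded_clinear_zero[OF g(1)])
    have le: "norm (f n (x n - F (x n))) \<le> onorm (f n) * d" for n
    proof -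
      have "norm (f n (x n - F (x n))) \<le> onorm (f n) * norm (x n - F (x n))"
        by (rule bounded_clinear_onorm[OF f])
      also have "\<dots> \<le> onorm (f n) * d"
        using F(2)[of "x n"] nn by (intro mult_left_mono) (auto simp: norm_minus_commute)
      finally show ?thesis .
    qed
    have sd: "summable (\<lambda>n. onorm (f n) * d)" using su by (rule summable_mult2)
    have sn: "summable (\<lambda>n. norm (f n (x n - F (x n))))"
      by (rule summable_comparison_test'[OF sd, of 0]) (use le in auto)
    have "(\<lambda>n. f n (x n - F (x n)) + f n (F (x n))) sums ((\<Sum>n. f n (x n - F (x n))) + 0)"
      by (intro sums_add F0 summable_sums summable_norm_cancel[OF sn])
    then have "(\<Sum>n. f n (x n)) = (\<Sum>n. f n (x n - F (x n)))"
      by (simp add: bounded_clinear_diff[OF f] sums_iff)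
    also have "norm \<dots> \<le> (\<Sum>n. norm (f n (x n - F (x n))))" by (rule summable_norm[OF sn])
    also have "\<dots> \<le> (\<Sum>n. onorm (f n) * d)" by (rule suminf_le[OF le sn sd])
    also have "\<dots> = s * d" unfolding s_def by (rule suminf_mult2[OF su, symmetric])
    also have "\<dots> \<le> e" using s e by (simp add: d_def field_simps)
    finally show ?thesis by simp
  qed
  then have "norm (\<Sum>n. f n (x n)) \<le> 0" by (rule field_le_epsilon)
  then show ?thesis by simp
qed

text \<open>Reduction to the auxiliary lemma: a nonzero x n is rescaled to norm 1/b n with b tending
  to infinity, and f n takes the factor norm (x n) * b n, which the weight keeps summable. The rank
  one terms and their traces do not change; for x n = 0 this holds because 1/0 = 0.\<close>

lemma nuclear_trace_zero:
  fixes x :: "nat \<Rightarrow> 'a::complex_banach"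
  assumes ap: "approximation_property TYPE('a)" and "nuclear_rep (\<lambda>v. 0) f x"
  shows "(\<Sum>n. f n (x n)) = 0"
proof -
  have f: "\<And>n. bounded_clinear (f n)" and su: "summable (\<lambda>n. onorm (f n) * norm (x n))"
    and sums: "\<And>v. (\<lambda>n. f n v *\<^sub>C x n) sums 0"
    using assms(2) by (auto simp: nuclear_rep_def)
  obtain b where b: "\<And>n. 0 < b n" "filterlim b at_top sequentially"
    "summable (\<lambda>n. onorm (f n) * norm (x n) * b n)"
    by (rule summable_weight_at_top[OF _ su]) (auto simp: bounded_clinear_onorm_nonneg[OF f])
  define c where "c n = norm (x n) * b n" for n
  have c: "c n \<ge> 0" "c n = 0 \<longleftrightarrow> x n = 0" for n using b(1)[of n] by (auto simp: c_def)
  define f' where "f' n v = c n *\<^sub>C f n v" for n v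
  define x' where "x' n = (1 / c n) *\<^sub>R x n" for n
  have f': "bounded_clinear (f' n)" for n unfolding f'_def by (intro bounded_clinear_const_scaleC f)
  have eq: "f' n v *\<^sub>C x' n = f n v *\<^sub>C x n" for n v
    using c[of n] by (cases "x n = 0") (simp_all add: f'_def x'_def scaleR_scaleC scaleC_complex_def)
  have eq2: "f' n (x' n) = f n (x n)" for n
    using c[of n] by (cases "x n = 0")
      (simp_all add: f'_def x'_def bounded_clinear_scaleR[OF f] bounded_clinear_zero[OF f] scaleC_complex_def scaleR_conv_of_real)
  have "(\<Sum>n. f' n (x' n)) = 0"
  proof (rule nuclear_trace_zero_aux[OF ap f'])
    show "summable (\<lambda>n. onorm (f' n))"
    proof (rule summable_comparison_test'[OF b(3), of 0])
      fix n
      have "onorm (f' n) \<le> onorm (f n) * norm (x n) * b n"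
      proof (rule onorm_bound)
        show "norm (f' n v) \<le> onorm (f n) * norm (x n) * b n * norm v" for v
        proof -
          have "norm (f' n v) = c n * norm (f n v)" using c(1)[of n] by (simp add: f'_def norm_scaleC)
          also have "\<dots> \<le> c n * (onorm (f n) * norm v)"
            by (intro mult_left_mono bounded_clinear_onorm f c)
          finally show ?thesis by (simp add: c_def ac_simps)
        qed
      qed (use b(1)[of n] bounded_clinear_onorm_nonneg[OF f] in auto)
      then show "norm (onorm (f' n)) \<le> onorm (f n) * norm (x n) * b n"
        using bounded_clinear_onorm_nonneg[OF f'] by simp
    qed
    show "x' \<longlonglongrightarrow> 0"
    proof (rule Lim_null_comparison)
      have "norm (x' n) \<le> inverse (b n)" for n
        using b(1)[of n] by (cases "x n = 0") (auto simp: x'_def c_def field_simps)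
      then show "\<forall>\<^sub>F n in sequentially. norm (x' n) \<le> inverse (b n)" by simp
      show "(\<lambda>n. inverse (b n)) \<longlonglongrightarrow> 0" using b(2) by (rule tendsto_inverse_0_at_top)
    qed
    show "(\<lambda>n. f' n v *\<^sub>C x' n) sums 0" for v unfolding eq by (rule sums)
  qed
  then show ?thesis by (simp add: eq2)
qed

section \<open>Independence of the trace from the representation\<close>

lemma nuclear_rep_summable_trace:
  assumes "nuclear_rep T f x" shows "summable (\<lambda>n. f n (x n))"
proof (rule summable_comparison_test'[of "\<lambda>n. onorm (f n) * norm (x n)" 0])
  show "norm (f n (x n)) \<le> onorm (f n) * norm (x n)" for n
    using assms by (auto simp: nuclear_rep_def intro: bounded_clinear_onorm)
qed (use assms in \<open>auto simp: nuclear_rep_def\<close>)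

text \<open>Interleaving one representation with the negative of another represents 0, so both have
  the same trace. This gives the definite description in \<open>nuclear_trace\<close> its value, and
  it is the place through which the approximation property enters the later sections.\<close>

lemma nuclear_trace_eq:
  fixes T :: "'a::complex_banach \<Rightarrow> 'a"
  assumes ap: "approximation_property TYPE('a)" and rep: "nuclear_rep T f x"
  shows "nuclear_trace T = (\<Sum>n. f n (x n))"
  unfolding nuclear_trace_def
proof (rule the_equality)
  fix c assume "\<exists>g y. nuclear_rep T g y \<and> c = (\<Sum>n. g n (y n))"
  then obtain g y where g: "nuclear_rep T g y" "c = (\<Sum>n. g n (y n))" by blast
  define h where "h n = (if even n then f (n div 2) else g (n div 2))" for n
  define z where "z n = (if even n then x (n div 2) else - y (n div 2))" for n
  have "nuclear_rep (\<lambda>v. 0) h z"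
    unfolding nuclear_rep_def
  proof (intro conjI allI)
    show "bounded_clinear (h n)" for n using rep g by (auto simp: nuclear_rep_def h_def)
    have "(\<lambda>n. if even n then onorm (f (n div 2)) * norm (x (n div 2))
        else onorm (g (n div 2)) * norm (y (n div 2))) sums
        ((\<Sum>n. onorm (f n) * norm (x n)) + (\<Sum>n. onorm (g n) * norm (y n)))"
      by (rule sums_interleave; rule summable_sums) (use rep g in \<open>auto simp: nuclear_rep_def\<close>)
    moreover have "(\<lambda>n. if even n then onorm (f (n div 2)) * norm (x (n div 2))
        else onorm (g (n div 2)) * norm (y (n div 2))) = (\<lambda>n. onorm (h n) * norm (z n))"
      by (auto simp: h_def z_def fun_eq_iff)
    ultimately show "summable (\<lambda>n. onorm (h n) * norm (z n))" by (simp add: sums_iff)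
    fix v
    have "(\<lambda>n. if even n then f (n div 2) v *\<^sub>C x (n div 2)
        else - (g (n div 2) v *\<^sub>C y (n div 2))) sums (T v + - T v)"
      by (intro sums_interleave sums_minus) (use rep g in \<open>auto simp: nuclear_rep_def\<close>)
    moreover have "(\<lambda>n. if even n then f (n div 2) v *\<^sub>C x (n div 2)
        else - (g (n div 2) v *\<^sub>C y (n div 2))) = (\<lambda>n. h n v *\<^sub>C z n)"
      by (auto simp: h_def z_def fun_eq_iff)
    ultimately show "(\<lambda>n. h n v *\<^sub>C z n) sums 0" by simp
  qed
  then have 0: "(\<Sum>n. h n (z n)) = 0" by (rule nuclear_trace_zero[OF ap])
  have "(\<lambda>n. if even n then f (n div 2) (x (n div 2))
      else - g (n div 2) (y (n div 2))) sums ((\<Sum>n. f n (x n)) + - c)"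
    unfolding g(2) by (intro sums_interleave sums_minus summable_sums nuclear_rep_summable_trace) (rule rep g)+
  moreover have "(\<lambda>n. if even n then f (n div 2) (x (n div 2))
      else - g (n div 2) (y (n div 2))) = (\<lambda>n. h n (z n))"
    using g(1) by (auto simp: h_def z_def fun_eq_iff nuclear_rep_def bounded_clinear_minus)
  ultimately show "c = (\<Sum>n. f n (x n))" using 0 by (simp add: sums_iff)
qed (use rep in blast)

lemma nuclear_rep_uminus:
  "nuclear_rep T f x \<Longrightarrow> nuclear_rep (\<lambda>v. - T v) f (\<lambda>n. - x n)"
  by (auto simp: nuclear_rep_def intro: sums_minus)

text \<open>Replaces operator norms by any upper bounds \<open>a n\<close>, so that no norm has to
  be computed.\<close>

lemma nuclear_repI:
  assumes "\<And>n. bounded_clinear (f n)" "\<And>n v. cmod (f n v) \<le> a n * norm v" "\<And>n. 0 \<le> a n"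
    and su: "summable (\<lambda>n. a n * norm (x n))" and "\<And>v. (\<lambda>n. f n v *\<^sub>C x n) sums T v"
  shows "nuclear_rep T f x"
  unfolding nuclear_rep_def
proof (intro conjI allI summable_comparison_test'[OF su, of 0])
  show "norm (onorm (f n) * norm (x n)) \<le> a n * norm (x n)" for n
    using bounded_clinear_onorm_nonneg[OF assms(1)] onorm_bound[OF assms(3,2)]
    by (simp add: mult_right_mono)
qed fact+

lemma nuclear_rep_bounded_clinear:
  assumes "nuclear_rep T f x" shows "bounded_clinear T"
proof (rule bounded_clinearI[where K="\<Sum>n. onorm (f n) * norm (x n)"])
  have f: "\<And>n. bounded_clinear (f n)" and su: "summable (\<lambda>n. onorm (f n) * norm (x n))"
    and T: "\<And>v. (\<lambda>n. f n v *\<^sub>C x n) sums T v"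
    using assms by (auto simp: nuclear_rep_def)
  show "T (u + v) = T u + T v" for u v
    using sums_unique2[OF T[of "u + v"]] sums_add[OF T T]
    by (simp add: bounded_clinear_add[OF f] scaleC_add_left)
  show "T (c *\<^sub>C v) = c *\<^sub>C T v" for c v
    using sums_unique2[OF T[of "c *\<^sub>C v"]]
      bounded_clinear_sums[OF bounded_clinear_const_scaleC[OF bounded_clinear_ident] T]
    by (simp add: bounded_clinear_scaleC[OF f] scaleC_complex_def)
  fix v
  have "norm (\<Sum>n. f n v *\<^sub>C x n) \<le> (\<Sum>n. onorm (f n) * norm (x n) * norm v)"
  proof (rule norm_suminf_le)
    show "norm (f n v *\<^sub>C x n) \<le> onorm (f n) * norm (x n) * norm v" for n
      using mult_right_mono[OF bounded_clinear_onorm[OF f, of n v] norm_ge_zero[of "x n"]]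
      by (simp add: norm_scaleC ac_simps)
  qed (rule summable_mult2[OF su])
  then show "norm (T v) \<le> norm v * (\<Sum>n. onorm (f n) * norm (x n))"
    using suminf_mult2[OF su, of "norm v"] sums_unique[OF T, of v] by (simp add: mult.commute)
qed

lemma nuclear_trace_uminus:
  fixes T :: "'a::complex_banach \<Rightarrow> 'a"
  assumes ap: "approximation_property TYPE('a)" and "nuclear T"
  shows "nuclear_trace (\<lambda>v. - T v) = - nuclear_trace T"
proof -
  obtain f x where rep: "nuclear_rep T f x" using assms by (auto simp: nuclear_def)
  have f: "\<And>n. bounded_clinear (f n)" using rep by (simp add: nuclear_rep_def)
  show ?thesis
    using nuclear_trace_eq[OF ap rep] nuclear_trace_eq[OF ap nuclear_rep_uminus[OF rep]]
      suminf_minus[OF nuclear_rep_summable_trace[OF rep]]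
    by (simp add: bounded_clinear_minus[OF f])
qed

section \<open>The representing measure\<close>

lemma om_represents_space:
  assumes "om_represents \<mu> \<phi>"
  shows "sets \<mu> = sets (restrict_space borel {0<..})" "space \<mu> = {0<..}"
proof -
  show s: "sets \<mu> = sets (restrict_space borel {0<..})" using assms by (simp add: om_represents_def)
  show "space \<mu> = {0<..}" using sets_eq_imp_space_eq[OF s] by (simp add: space_restrict_space)
qed

lemma om_represents_measurable:
  assumes "om_represents \<mu> \<phi>" "f \<in> borel_measurable borel"
  shows "f \<in> borel_measurable \<mu>"
  using measurable_restrict_space1[OF assms(2), of "{0<..}"]
    measurable_cong_sets[OF om_represents_space(1)[OF assms(1)] refl] by blast

lemma om_represents_integrable:
  assumes "om_represents \<mu> \<phi>"
  shows "integrable \<mu> (\<lambda>t. 1 / (1 + t))"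
proof (rule integrableI_bounded)
  show "(\<lambda>t. 1 / (1 + t)) \<in> borel_measurable \<mu>"
    by (rule om_represents_measurable[OF assms]) measurable
  have "(\<integral>\<^sup>+t. ennreal (norm (1 / (1 + t))) \<partial>\<mu>) = (\<integral>\<^sup>+t. ennreal (1 / (1 + t)) \<partial>\<mu>)"
    by (intro nn_integral_cong) (auto simp: om_represents_space[OF assms])
  then show "(\<integral>\<^sup>+t. ennreal (norm (1 / (1 + t))) \<partial>\<mu>) < \<infinity>" using assms by (simp add: om_represents_def)
qed

lemma om_represents_integrable_bounded:
  fixes f :: "real \<Rightarrow> 'b::{banach, second_countable_topology}"
  assumes om: "om_represents \<mu> \<phi>" and f: "f \<in> borel_measurable borel"
    and bd: "\<And>t. t > 0 \<Longrightarrow> norm (f t) \<le> C / (1 + t)"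
  shows "integrable \<mu> f"
proof (rule Bochner_Integration.integrable_bound[of _ "\<lambda>t. C * (1 / (1 + t))"])
  show "integrable \<mu> (\<lambda>t. C * (1 / (1 + t)))"
    by (rule integrable_mult_right[OF om_represents_integrable[OF om]])
  show "AE t in \<mu>. norm (f t) \<le> norm (C * (1 / (1 + t)))"
  proof (rule AE_I2)
    fix t assume "t \<in> space \<mu>"
    then have t: "t > 0" by (simp add: om_represents_space[OF om])
    have "norm (f t) \<le> C / (1 + t)" by (rule bd[OF t])
    also have "\<dots> \<le> norm (C * (1 / (1 + t)))" using t by (simp add: divide_right_mono)
    finally show "norm (f t) \<le> norm (C * (1 / (1 + t)))" .
  qed
qed (rule om_represents_measurable[OF om f])

text \<open>The substitution \<open>u = 1 / (1 + t)\<close> turns \<open>\<mu>\<close> into a finite measure on \<open>(0,1)\<close>, and the expansion of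
  \<open>\<phi>\<close> at \<open>-1\<close> gives its moments.\<close>

lemma om_moment_sums:
  fixes a :: "nat \<Rightarrow> complex"
  assumes om: "om_represents \<mu> \<phi>" and a: "summable (\<lambda>n. norm (a n))"
  shows "(\<lambda>n. a n * (\<integral>t. complex_of_real (1 / (1 + t)) ^ Suc n \<partial>\<mu>)) sums
    (\<integral>t. (\<Sum>n. a n * complex_of_real (1 / (1 + t)) ^ n) * complex_of_real (1 / (1 + t)) \<partial>\<mu>)"
proof -
  let ?u = "\<lambda>t::real. complex_of_real (1 / (1 + t))"
  define m where "m = (\<integral>t. 1 / (1 + t) \<partial>\<mu>)"
  have u: "norm (?u t) \<le> 1" "norm (?u t) = 1 / (1 + t)" if "t > 0" for t
    using that by (simp_all add: norm_divide del: of_real_divide of_real_add)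
  have bd: "norm (a n * ?u t ^ Suc n) \<le> norm (a n) * (1 / (1 + t))" if "t > 0" for t n
  proof -
    have "norm (a n * ?u t ^ Suc n) = norm (a n) * (norm (?u t) ^ n * norm (?u t))"
      by (simp only: norm_mult norm_power power_Suc mult.commute)
    also have "\<dots> \<le> norm (a n) * (1 * norm (?u t))"
      by (intro mult_left_mono mult_right_mono power_le_one u that norm_ge_zero)
    also have "\<dots> = norm (a n) * (1 / (1 + t))" by (simp only: u(2)[OF that] mult_1)
    finally show ?thesis .
  qed
  have int: "integrable \<mu> (\<lambda>t. a n * ?u t ^ Suc n)" for n
    by (rule om_represents_integrable_bounded[OF om, of _ "norm (a n)"]) (use bd in \<open>auto simp del: power_Suc\<close>)
  have su: "summable (\<lambda>n. norm (a n * ?u t ^ Suc n))" if "t > 0" for t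
    by (rule summable_comparison_test'[OF summable_mult2[OF a, of "1 / (1 + t)"], of 0])
      (use bd[OF that] in \<open>simp del: power_Suc\<close>)
  have "(\<lambda>n. \<integral>t. a n * ?u t ^ Suc n \<partial>\<mu>) sums (\<integral>t. (\<Sum>n. a n * ?u t ^ Suc n) \<partial>\<mu>)"
  proof (rule sums_integral[OF int])
    show "AE t in \<mu>. summable (\<lambda>n. norm (a n * ?u t ^ Suc n))"
      using su by (intro AE_I2) (simp add: om_represents_space[OF om])
    show "summable (\<lambda>n. \<integral>t. norm (a n * ?u t ^ Suc n) \<partial>\<mu>)"
    proof (rule summable_comparison_test'[OF summable_mult2[OF a, of m], of 0])
      fix n
      have "(\<integral>t. norm (a n * ?u t ^ Suc n) \<partial>\<mu>) \<le> (\<integral>t. norm (a n) * (1 / (1 + t)) \<partial>\<mu>)"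
        by (intro integral_mono integrable_norm int integrable_mult_right om_represents_integrable[OF om] bd)
          (simp add: om_represents_space[OF om])
      also have "\<dots> = norm (a n) * m" unfolding m_def by (rule integral_mult_right_zero)
      finally show "norm (\<integral>t. norm (a n * ?u t ^ Suc n) \<partial>\<mu>) \<le> norm (a n) * m"
        by (subst real_norm_def, subst abs_of_nonneg) (auto intro: integral_nonneg_AE)
    qed
  qed
  also have "(\<integral>t. (\<Sum>n. a n * ?u t ^ Suc n) \<partial>\<mu>) = (\<integral>t. (\<Sum>n. a n * ?u t ^ n) * ?u t \<partial>\<mu>)"
  proof (rule Bochner_Integration.integral_cong[OF refl])
    fix t assume "t \<in> space \<mu>"
    then have t: "t > 0" by (simp add: om_represents_space[OF om])
    have "summable (\<lambda>n. a n * ?u t ^ n)"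
      by (rule summable_comparison_test'[OF a, of 0])
        (use power_le_one[OF norm_ge_zero u(1)[OF t]] in \<open>simp add: norm_mult norm_power mult_left_le\<close>)
    from suminf_mult2[OF this, of "?u t"]
    show "(\<Sum>n. a n * ?u t ^ Suc n) = (\<Sum>n. a n * ?u t ^ n) * ?u t" by (simp add: ac_simps)
  qed
  finally show ?thesis using int by (simp add: Bochner_Integration.integral_mult_right_zero del: power_Suc of_real_divide)
qed

text \<open>For |z| < 1 the quotient \<phi>(z-1)/(z-1) is the integral of 1/(1+t-z), hence the power
  series in z with these moments as coefficients. Two measures for the same \<phi> give the same
  function and so the same coefficients.\<close>

lemma om_moments_unique:
  assumes om: "om_represents \<mu> \<phi>" "om_represents \<nu> \<phi>"
  shows "(\<integral>t. complex_of_real (1 / (1 + t)) ^ Suc n \<partial>\<mu>) = (\<integral>t. complex_of_real (1 / (1 + t)) ^ Suc n \<partial>\<nu>)"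
proof -
  define m where "m \<mu> n = (\<integral>t. complex_of_real (1 / (1 + t)) ^ Suc n \<partial>\<mu>)" for \<mu> :: "real measure" and n
  have sums: "(\<lambda>n. m \<mu> n * z ^ n) sums (\<phi> (z - 1) / (z - 1))"
    if om: "om_represents \<mu> \<phi>" and z: "norm z < 1" for \<mu> z
  proof -
    have z1: "z \<noteq> 1" using z by auto
    have nz: "z - 1 \<notin> complex_of_real ` {0<..}"
    proof
      assume "z - 1 \<in> complex_of_real ` {0<..}"
      then have "Re z > 1" by (auto simp: complex_eq_iff)
      then show False using z complex_Re_le_cmod[of z] by simp
    qed
    have "summable (\<lambda>n. norm (z ^ n))" using z by (simp add: norm_power)
    from om_moment_sums[OF om this]
    have "(\<lambda>n. m \<mu> n * z ^ n) sums
        (\<integral>t. (\<Sum>n. z ^ n * complex_of_real (1 / (1 + t)) ^ n) * complex_of_real (1 / (1 + t)) \<partial>\<mu>)"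
      by (simp add: m_def mult.commute)
    also have "(\<integral>t. (\<Sum>n. z ^ n * complex_of_real (1 / (1 + t)) ^ n) * complex_of_real (1 / (1 + t)) \<partial>\<mu>) =
        (\<integral>t. 1 / (z - 1) * ((z - 1) / (complex_of_real t - (z - 1))) \<partial>\<mu>)"
    proof (rule Bochner_Integration.integral_cong[OF refl])
      fix t assume "t \<in> space \<mu>"
      then have t: "t > 0" by (simp add: om_represents_space[OF om])
      let ?u = "complex_of_real (1 / (1 + t))"
      have "norm ?u < 1" using t by (simp add: norm_divide del: of_real_divide of_real_add)
      then have "norm z * norm ?u < 1 * 1" using z by (intro mult_strict_mono') auto
      then have "norm (z * ?u) < 1" by (simp only: norm_mult mult_1)
      then have "(\<Sum>n. (z * ?u) ^ n) = 1 / (1 - z * ?u)" by (rule suminf_geometric)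
      then have "(\<Sum>n. z ^ n * ?u ^ n) * ?u = 1 / (1 - z * ?u) * ?u"
        by (simp only: power_mult_distrib)
      also have "\<dots> = 1 / (complex_of_real t - (z - 1))"
      proof -
        have "1 + complex_of_real t \<noteq> 0" using t by (metis add_pos_pos less_numeral_extra(1,3) of_real_1 of_real_add of_real_eq_0_iff)
        moreover have "1 + complex_of_real t - z \<noteq> 0"
        proof
          assume "1 + complex_of_real t - z = 0"
          then have "Re z = 1 + t" by (auto simp: complex_eq_iff)
          then show False using z t complex_Re_le_cmod[of z] by simp
        qed
        ultimately show ?thesis by (simp add: field_simps)
      qed
      also have "\<dots> = 1 / (z - 1) * ((z - 1) / (complex_of_real t - (z - 1)))" using z1 by simp
      finally show "(\<Sum>n. z ^ n * ?u ^ n) * ?u = 1 / (z - 1) * ((z - 1) / (complex_of_real t - (z - 1)))" .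
    qed
    also have "\<dots> = 1 / (z - 1) * \<phi> (z - 1)"
    proof -
      have "\<phi> (z - 1) = (\<integral>t. (z - 1) / (complex_of_real t - (z - 1)) \<partial>\<mu>)"
        using om nz unfolding om_represents_def by blast
      then show ?thesis by (simp only: integral_mult_right_zero)
    qed
    finally show ?thesis by simp
  qed
  define F where "F \<mu> = Abs_fps (m \<mu>)" for \<mu>
  have cr: "fps_conv_radius (F \<mu>) > 0" if "om_represents \<mu> \<phi>" for \<mu>
  proof -
    have "summable (\<lambda>n. m \<mu> n * (1 / 2) ^ n)" by (rule sums_summable[OF sums[OF that]]) simp
    then have "conv_radius (m \<mu>) \<ge> norm (1 / 2 :: complex)" by (rule conv_radius_geI)
    then have "conv_radius (m \<mu>) \<ge> ereal (1 / 2)" by simp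
    then show ?thesis by (auto simp: fps_conv_radius_def F_def intro: less_le_trans[of 0 "ereal (1/2)"])
  qed
  have "F \<mu> = F \<nu>"
  proof (rule eval_fps_eqD[OF cr[OF om(1)] cr[OF om(2)]])
    have "\<forall>\<^sub>F z in nhds 0. z \<in> ball (0::complex) 1" by (intro eventually_nhds_in_open) auto
    then show "\<forall>\<^sub>F z in nhds 0. eval_fps (F \<mu>) z = eval_fps (F \<nu>) z"
    proof eventually_elim
      case (elim z)
      then have "norm z < 1" by simp
      from sums[OF om(1) this] sums[OF om(2) this] show ?case by (simp add: eval_fps_def F_def sums_iff)
    qed
  qed
  then have "fps_nth (F \<mu>) n = fps_nth (F \<nu>) n" by simp
  then show ?thesis by (simp add: F_def m_def)
qed

text \<open>Needed because \<open>om_measure\<close> is a definite description. With u = 1/(1+t),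
  the measure u d\<mu> is finite and is carried to the line by u; its characteristic function is a
  power series in the moments. Levy's uniqueness theorem identifies the images, and undoing the
  substitution and the weight recovers \<mu>.\<close>

lemma om_represents_unique:
  assumes om: "om_represents \<mu> \<phi>" "om_represents \<nu> \<phi>"
  shows "\<mu> = \<nu>"
proof -
  define m where "m \<mu> = (\<integral>t. 1 / (1 + t) \<partial>\<mu>)" for \<mu> :: "real measure"
  have sets: "sets \<mu> = sets \<nu>" using om_represents_space[OF om(1)] om_represents_space[OF om(2)] by simp
  have cm: "complex_of_real (m \<mu>) = (\<integral>t. complex_of_real (1 / (1 + t)) ^ Suc 0 \<partial>\<mu>)" for \<mu>
    unfolding m_def by (simp flip: integral_of_real del: of_real_divide)
  have m: "m \<mu> = m \<nu>" using om_moments_unique[OF om, of 0] cm[of \<mu>] cm[of \<nu>] of_real_eq_iff by metis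
  have m0: "m \<mu> \<ge> 0" if "om_represents \<mu> \<phi>" for \<mu>
    unfolding m_def by (intro integral_nonneg_AE AE_I2) (simp add: om_represents_space[OF that])
  have meas: "(\<lambda>t. 1 / (1 + t)) \<in> borel_measurable \<mu>" if "om_represents \<mu> \<phi>" for \<mu>
    by (rule om_represents_measurable[OF that]) measurable
  show ?thesis
  \<comment> \<open>Normalizing to a probability measure divides by \<open>m \<mu>\<close>. If this
    is 0, both measures vanish.\<close>
  proof (cases "m \<mu> = 0")
    case True
    have "emeasure \<mu> (space \<mu>) = 0" if "om_represents \<mu> \<phi>" "m \<mu> = 0" for \<mu>
    proof -
      have "AE t in \<mu>. 0 \<le> 1 / (1 + t)" by (intro AE_I2) (simp add: om_represents_space[OF that(1)])
      from integral_nonneg_eq_0_iff_AE[OF om_represents_integrable[OF that(1)] this]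
      have "AE t in \<mu>. 1 / (1 + t) = 0" using that(2) unfolding m_def by blast
      then have "AE t in \<mu>. False"
      proof (rule AE_mp, intro AE_I2 impI)
        fix t assume "t \<in> space \<mu>" "1 / (1 + t) = 0"
        then show False by (simp add: om_represents_space[OF that(1)])
      qed
      then show ?thesis using AE_iff_measurable[of "space \<mu>" \<mu> "\<lambda>_. False"] by simp
    qed
    note z = this
    show ?thesis
    proof (rule measure_eqI[OF sets])
      fix X assume X: "X \<in> sets \<mu>"
      then have "emeasure \<mu> X \<le> emeasure \<mu> (space \<mu>)" "emeasure \<nu> X \<le> emeasure \<nu> (space \<nu>)"
        using sets by (auto intro: emeasure_space)
      then show "emeasure \<mu> X = emeasure \<nu> X"
        using z[OF om(1) True] z[OF om(2)] True m by simp
    qed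
  next
    case False
    define w where "w t = ennreal (1 / (1 + t) / m \<mu>)" for t
    define g where "g t = 1 / (1 + t)" for t :: real
    have mpos: "m \<mu> > 0" using False m0[OF om(1)] by simp
    have wm: "w \<in> borel_measurable \<rho>" if "om_represents \<rho> \<phi>" for \<rho>
      unfolding w_def by (rule om_represents_measurable[OF that]) measurable
    have gm: "g \<in> borel_measurable (density \<rho> w)" if "om_represents \<rho> \<phi>" for \<rho>
    proof -
      have "g \<in> borel_measurable borel" unfolding g_def by measurable
      from om_represents_measurable[OF that this] show ?thesis by (simp only: measurable_density_eq1)
    qed
    have prob: "prob_space (density \<rho> w)" if "om_represents \<rho> \<phi>" "m \<rho> = m \<mu>" for \<rho>
    proof (rule prob_spaceI)
      have "emeasure (density \<rho> w) (space (density \<rho> w)) = (\<integral>\<^sup>+t. w t \<partial>\<rho>)"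
        using wm[OF that(1)] by (subst emeasure_density) (auto simp: space_density intro!: nn_integral_cong)
      also have "\<dots> = ennreal (\<integral>t. 1 / (1 + t) / m \<mu> \<partial>\<rho>)"
        unfolding w_def using mpos
        by (intro nn_integral_eq_integral AE_I2 integrable_divide om_represents_integrable[OF that(1)])
          (simp add: om_represents_space[OF that(1)])
      also have "(\<integral>t. 1 / (1 + t) / m \<mu> \<partial>\<rho>) = 1"
        unfolding integral_divide_zero m_def[symmetric] using that(2) mpos by simp
      finally show "emeasure (density \<rho> w) (space (density \<rho> w)) = 1" by simp
    qed
    define D where "D \<rho> = distr (density \<rho> w) borel g" for \<rho>
    have rd: "real_distribution (D \<rho>)" if "om_represents \<rho> \<phi>" "m \<rho> = m \<mu>" for \<rho>
      unfolding D_def by (rule prob_space.real_distribution_distr[OF prob[OF that] gm[OF that(1)]])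
    \<comment> \<open>The exponential series is integrated termwise by
      \<open>om_moment_sums\<close>. The exponent is \<open>Suc n\<close> because the density
      \<open>w\<close> contributes one factor u.\<close>
    have char: "(\<lambda>n. (\<i> * s) ^ n /\<^sub>R fact n / m \<mu> * (\<integral>t. complex_of_real (1 / (1 + t)) ^ Suc n \<partial>\<rho>)) sums char (D \<rho>) s"
      if "om_represents \<rho> \<phi>" for \<rho> s
    proof -
      have a: "summable (\<lambda>n. norm ((\<i> * complex_of_real s) ^ n /\<^sub>R fact n / m \<mu>))"
        using summable_divide[OF summable_norm_exp[of "\<i> * complex_of_real s"], of "m \<mu>"]
        by (simp only: norm_divide norm_of_real abs_of_pos[OF mpos])
      have "char (D \<rho>) s = (\<integral>t. iexp (s * g t) \<partial>density \<rho> w)"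
        unfolding char_def D_def using gm[OF that] by (subst integral_distr) auto
      also have "\<dots> = (\<integral>t. (1 / (1 + t) / m \<mu>) *\<^sub>R iexp (s * g t) \<partial>\<rho>)"
        unfolding w_def
      proof (rule integral_density)
        show "(\<lambda>t. iexp (s * g t)) \<in> borel_measurable \<rho>"
          unfolding g_def by (rule om_represents_measurable[OF that]) measurable
        show "(\<lambda>t. 1 / (1 + t) / m \<mu>) \<in> borel_measurable \<rho>"
          by (rule om_represents_measurable[OF that]) measurable
        show "AE t in \<rho>. 0 \<le> 1 / (1 + t) / m \<mu>"
          using mpos by (intro AE_I2) (simp add: om_represents_space[OF that])
      qed
      also have "\<dots> = (\<integral>t. (\<Sum>n. (\<i> * s) ^ n /\<^sub>R fact n / m \<mu> * complex_of_real (1 / (1 + t)) ^ n) *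
          complex_of_real (1 / (1 + t)) \<partial>\<rho>)"
      proof (rule Bochner_Integration.integral_cong[OF refl])
        fix t
        have "(\<lambda>n. (\<i> * (s * g t)) ^ n /\<^sub>R fact n) sums iexp (s * g t)" by (rule exp_converges)
        from sums_divide[OF this, of "m \<mu>"]
        have "(\<lambda>n. (\<i> * s) ^ n /\<^sub>R fact n / m \<mu> * complex_of_real (1 / (1 + t)) ^ n) sums (iexp (s * g t) / m \<mu>)"
          by (simp only: g_def[symmetric] of_real_mult mult.assoc[symmetric] power_mult_distrib
              times_divide_eq_left mult_scaleR_left)
        then show "(1 / (1 + t) / m \<mu>) *\<^sub>R iexp (s * g t) =
          (\<Sum>n. (\<i> * s) ^ n /\<^sub>R fact n / m \<mu> * complex_of_real (1 / (1 + t)) ^ n) * complex_of_real (1 / (1 + t))"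
          unfolding sums_iff by (simp add: scaleR_conv_of_real)
      qed
      finally show ?thesis using om_moment_sums[OF that a] by simp
    qed
    have "char (D \<mu>) s = char (D \<nu>) s" for s
      using char[OF om(1), of s] char[OF om(2), of s] om_moments_unique[OF om] by (simp add: sums_iff)
    then have DD: "D \<mu> = D \<nu>"
      by (intro Levy_uniqueness rd om ext) (simp_all add: m)
    define S where "S = restrict_space (borel :: real measure) {0<..}"
    \<comment> \<open>Inverse of t \<mapsto> 1/(1+t); the default value 1 elsewhere makes it a map
      into (0,\<infinity>) on the whole line.\<close>
    define h where "h x = (if 1 / x - 1 > 0 then 1 / x - 1 else (1::real))" for x
    have hm: "h \<in> measurable borel S"
      unfolding S_def h_def by (rule measurable_restrict_space2) auto
    have pull: "distr (D \<rho>) S h = density \<rho> w" if "om_represents \<rho> \<phi>" for \<rho>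
    proof -
      have ss: "sets (density \<rho> w) = sets S" using om_represents_space(1)[OF that] by (simp add: S_def)
      have "distr (D \<rho>) S h = distr (density \<rho> w) S (h \<circ> g)"
        unfolding D_def by (rule distr_distr[OF hm gm[OF that]])
      also have "\<dots> = distr (density \<rho> w) S (\<lambda>x. x)"
        by (intro distr_cong) (auto simp: om_represents_space[OF that] h_def g_def field_simps)
      also have "\<dots> = density \<rho> w" using ss by (intro distr_id2) simp
      finally show ?thesis .
    qed
    have dd: "density \<mu> w = density \<nu> w" using pull[OF om(1)] pull[OF om(2)] DD by simp
    \<comment> \<open>The weight \<open>w\<close> is positive and finite on (0,\<infinity>), so its
      reciprocal as a density restores the measure.\<close>
    have inv: "density (density \<rho> w) (\<lambda>t. ennreal ((1 + t) * m \<mu>)) = \<rho>" if "om_represents \<rho> \<phi>" for \<rho>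
    proof -
      have "density (density \<rho> w) (\<lambda>t. ennreal ((1 + t) * m \<mu>)) = density \<rho> (\<lambda>t. w t * ennreal ((1 + t) * m \<mu>))"
        by (rule density_density_eq[OF wm[OF that]], rule om_represents_measurable[OF that]) measurable
      also have "\<dots> = density \<rho> (\<lambda>_. 1)"
      proof (rule density_cong)
        show "(\<lambda>t. w t * ennreal ((1 + t) * m \<mu>)) \<in> borel_measurable \<rho>"
          unfolding w_def by (rule om_represents_measurable[OF that]) measurable
        show "AE t in \<rho>. w t * ennreal ((1 + t) * m \<mu>) = 1"
        proof (rule AE_I2)
          fix t assume "t \<in> space \<rho>"
          then have "t > 0" by (simp add: om_represents_space[OF that])
          then show "w t * ennreal ((1 + t) * m \<mu>) = 1"
            using mpos by (simp add: w_def flip: ennreal_mult)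
        qed
      qed auto
      finally show ?thesis by (simp add: density_1)
    qed
    show ?thesis using inv[OF om(1)] inv[OF om(2)] unfolding dd by (rule trans[OF sym])
  qed
qed

lemma om_measure_eq: "om_represents \<mu> \<phi> \<Longrightarrow> om_measure \<phi> = \<mu>"
  unfolding om_measure_def by (rule the_equality) (auto intro: om_represents_unique)

section \<open>Values and derivative of the represented function\<close>

lemma om_neg:
  assumes om: "om_represents \<mu> \<phi>" and r: "0 < r"
  shows "\<phi> (- complex_of_real r) = (\<integral>t. - complex_of_real r / (complex_of_real t - - complex_of_real r) \<partial>\<mu>)"
proof -
  have "- complex_of_real r \<notin> complex_of_real ` {0<..}"
  proof
    assume "- complex_of_real r \<in> complex_of_real ` {0<..}"
    then obtain t where "0 < t" "complex_of_real (- r) = complex_of_real t" by auto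
    then show False using r by (simp only: of_real_eq_iff)
  qed
  then show ?thesis using om unfolding om_represents_def by blast
qed

text \<open>Differentiation under the integral by dominated convergence. The number d compares |t -
  z| with 1 + t; as 1 + t exceeds 1, half of it survives on the ball of radius d/2, and the
  difference quotients are dominated by a multiple of 1/(1+t).\<close>

lemma om_deriv:
  assumes om: "om_represents \<mu> \<phi>" and d: "d > 0" "\<And>t. t > 0 \<Longrightarrow> d * (1 + t) \<le> cmod (complex_of_real t - z)"
  shows "(\<phi> has_field_derivative (\<integral>t. complex_of_real t / (complex_of_real t - z)\<^sup>2 \<partial>\<mu>)) (at z)"
proof -
  let ?S = "ball z (d / 2)"
  have lw: "d / 2 * (1 + t) \<le> cmod (complex_of_real t - w)" if "w \<in> ?S" "t > 0" for w t
  proof -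
    have "cmod (w - z) \<le> d / 2" using that by (simp add: dist_norm norm_minus_commute)
    also have "\<dots> \<le> d / 2 * (1 + t)" using that d by simp
    finally have "cmod (w - z) \<le> d / 2 * (1 + t)" .
    moreover have "cmod (complex_of_real t - z) \<le> cmod (complex_of_real t - w) + cmod (w - z)"
      using norm_triangle_ineq[of "complex_of_real t - w" "w - z"] by simp
    ultimately show ?thesis using d(2)[OF that(2)] by (simp add: field_simps)
  qed
  have nz: "complex_of_real t - w \<noteq> 0" if "w \<in> ?S" "t > 0" for w t
  proof -
    have "0 < d / 2 * (1 + t)" using d(1) that(2) by (intro mult_pos_pos) auto
    from less_le_trans[OF this lw[OF that]] show ?thesis by auto
  qed
  have int: "integrable \<mu> (\<lambda>t. w / (complex_of_real t - w))" if w: "w \<in> ?S" for w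
  proof (rule om_represents_integrable_bounded[OF om, of _ "cmod w / (d / 2)"])
    show "(\<lambda>t. w / (complex_of_real t - w)) \<in> borel_measurable borel" by measurable
    fix t :: real assume t: "t > 0"
    have "norm (w / (complex_of_real t - w)) \<le> cmod w / (d / 2 * (1 + t))"
      unfolding norm_divide
    proof (rule divide_left_mono[OF lw[OF w t] norm_ge_zero])
      have "0 < d / 2 * (1 + t)" using d(1) t by (intro mult_pos_pos) auto
      from mult_pos_pos[OF less_le_trans[OF this lw[OF w t]] this]
      show "0 < cmod (complex_of_real t - w) * (d / 2 * (1 + t))" .
    qed
    then show "norm (w / (complex_of_real t - w)) \<le> cmod w / (d / 2) / (1 + t)" by simp
  qed
  have phi: "\<phi> w = (\<integral>t. w / (complex_of_real t - w) \<partial>\<mu>)" if w: "w \<in> ?S" for w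
  proof -
    have "w \<notin> complex_of_real ` {0<..}" using nz[OF w] by auto
    then show ?thesis using om unfolding om_represents_def by blast
  qed
  have zS: "z \<in> ?S" using d by simp
  \<comment> \<open>The difference quotient of the kernel simplifies exactly, so that passing to the
    limit requires no remainder term.\<close>
  have quot: "(\<phi> w - \<phi> z) / (w - z) = (\<integral>t. complex_of_real t / ((complex_of_real t - w) * (complex_of_real t - z)) \<partial>\<mu>)"
    if w: "w \<in> ?S" "w \<noteq> z" for w
  proof -
    have "(\<phi> w - \<phi> z) / (w - z) =
        (\<integral>t. (w / (complex_of_real t - w) - z / (complex_of_real t - z)) / (w - z) \<partial>\<mu>)"
      using int[OF w(1)] int[OF zS] by (simp add: phi[OF w(1)] phi[OF zS])
    also have "\<dots> = (\<integral>t. complex_of_real t / ((complex_of_real t - w) * (complex_of_real t - z)) \<partial>\<mu>)"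
    proof (rule Bochner_Integration.integral_cong[OF refl])
      fix t assume "t \<in> space \<mu>"
      then have t: "t > 0" by (simp add: om_represents_space[OF om])
      show "(w / (complex_of_real t - w) - z / (complex_of_real t - z)) / (w - z) =
        complex_of_real t / ((complex_of_real t - w) * (complex_of_real t - z))"
        using nz[OF w(1) t] nz[OF zS t] w(2) by (simp add: divide_simps) (simp add: algebra_simps)
    qed
    finally show ?thesis .
  qed
  have "((\<lambda>w. (\<phi> w - \<phi> z) / (w - z)) \<longlongrightarrow> (\<integral>t. complex_of_real t / (complex_of_real t - z)\<^sup>2 \<partial>\<mu>)) (at z within ?S)"
    unfolding tendsto_at_iff_sequentially o_def
  proof safe
    fix X assume X: "\<forall>i. X i \<in> ?S - {z}" "X \<longlonglongrightarrow> z"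
    have "(\<lambda>i. \<integral>t. complex_of_real t / ((complex_of_real t - X i) * (complex_of_real t - z)) \<partial>\<mu>) \<longlonglongrightarrow>
        (\<integral>t. complex_of_real t / (complex_of_real t - z)\<^sup>2 \<partial>\<mu>)"
    proof (rule integral_dominated_convergence[where w="\<lambda>t. 2 / d\<^sup>2 * (1 / (1 + t))"])
      show "(\<lambda>t. complex_of_real t / (complex_of_real t - z)\<^sup>2) \<in> borel_measurable \<mu>"
        by (rule om_represents_measurable[OF om]) measurable
      show "(\<lambda>t. complex_of_real t / ((complex_of_real t - X i) * (complex_of_real t - z))) \<in> borel_measurable \<mu>" for i
        by (rule om_represents_measurable[OF om]) measurable
      show "integrable \<mu> (\<lambda>t. 2 / d\<^sup>2 * (1 / (1 + t)))"
        by (rule integrable_mult_right[OF om_represents_integrable[OF om]])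
      show "AE t in \<mu>. (\<lambda>i. complex_of_real t / ((complex_of_real t - X i) * (complex_of_real t - z))) \<longlonglongrightarrow>
          complex_of_real t / (complex_of_real t - z)\<^sup>2"
      proof (rule AE_I2)
        fix t assume "t \<in> space \<mu>"
        then have t: "t > 0" by (simp add: om_represents_space[OF om])
        show "(\<lambda>i. complex_of_real t / ((complex_of_real t - X i) * (complex_of_real t - z))) \<longlonglongrightarrow>
            complex_of_real t / (complex_of_real t - z)\<^sup>2"
          unfolding power2_eq_square using nz[OF zS t] by (intro tendsto_intros X) auto
      qed
      show "AE t in \<mu>. norm (complex_of_real t / ((complex_of_real t - X i) * (complex_of_real t - z)))
          \<le> 2 / d\<^sup>2 * (1 / (1 + t))" for i
      proof (rule AE_I2)
        fix t assume "t \<in> space \<mu>"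
        then have t: "t > 0" by (simp add: om_represents_space[OF om])
        have "norm (complex_of_real t / ((complex_of_real t - X i) * (complex_of_real t - z))) \<le>
            (1 + t) / ((d / 2 * (1 + t)) * (d * (1 + t)))"
          unfolding norm_divide norm_mult
        proof (intro frac_le mult_mono)
          show "d / 2 * (1 + t) \<le> cmod (complex_of_real t - X i)" using X(1) t by (intro lw) auto
        qed (use t d in auto)
        also have "\<dots> = 2 / d\<^sup>2 * (1 / (1 + t))"
        proof -
          have *: "u / ((d / 2 * u) * (d * u)) = 2 / d\<^sup>2 * (1 / u)" if "u > 0" for u :: real
            using that d(1) by (simp add: power2_eq_square)
          show ?thesis by (rule *) (use t in simp)
        qed
        finally show "norm (complex_of_real t / ((complex_of_real t - X i) * (complex_of_real t - z)))
          \<le> 2 / d\<^sup>2 * (1 / (1 + t))" .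
      qed
    qed
    then show "(\<lambda>i. (\<phi> (X i) - \<phi> z) / (X i - z)) \<longlonglongrightarrow> (\<integral>t. complex_of_real t / (complex_of_real t - z)\<^sup>2 \<partial>\<mu>)"
      using X(1) quot by simp
  qed
  then show ?thesis unfolding has_field_derivative_iff using at_within_open[of z ?S] d by simp
qed

lemma om_deriv_neg:
  assumes om: "om_represents \<mu> \<phi>" and s: "s < 0"
  shows "Re (deriv \<phi> (complex_of_real s)) = (\<integral>t. t / (t - s)\<^sup>2 \<partial>\<mu>)"
    and "integrable \<mu> (\<lambda>t. t / (t - s)\<^sup>2)"
proof -
  have le: "min 1 (- s) * (1 + t) \<le> t - s" if "t > 0" for t
  proof -
    have "min 1 (- s) * (1 + t) = min 1 (- s) + min 1 (- s) * t" by (simp add: algebra_simps)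
    also have "\<dots> \<le> - s + 1 * t" using that s by (intro add_mono mult_right_mono) auto
    finally show ?thesis by simp
  qed
  have m: "min 1 (- s) > 0" using s by simp
  show int: "integrable \<mu> (\<lambda>t. t / (t - s)\<^sup>2)"
  proof (rule om_represents_integrable_bounded[OF om, of _ "1 / (min 1 (- s))\<^sup>2"])
    show "(\<lambda>t. t / (t - s)\<^sup>2) \<in> borel_measurable borel" by measurable
    fix t :: real assume t: "t > 0"
    have "t / (t - s)\<^sup>2 \<le> (1 + t) / (min 1 (- s) * (1 + t))\<^sup>2"
      using t s le[OF t] m by (intro frac_le power_mono) auto
    also have "\<dots> = 1 / (min 1 (- s))\<^sup>2 / (1 + t)" using t by (simp add: power_mult_distrib power2_eq_square)
    finally show "norm (t / (t - s)\<^sup>2) \<le> 1 / (min 1 (- s))\<^sup>2 / (1 + t)" using t by simp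
  qed
  have "(\<phi> has_field_derivative (\<integral>t. complex_of_real t / (complex_of_real t - complex_of_real s)\<^sup>2 \<partial>\<mu>)) (at (complex_of_real s))"
  proof (rule om_deriv[OF om m])
    fix t :: real assume t: "t > 0"
    have "cmod (complex_of_real t - complex_of_real s) = \<bar>t - s\<bar>"
      by (metis norm_of_real of_real_diff)
    then show "min 1 (- s) * (1 + t) \<le> cmod (complex_of_real t - complex_of_real s)" using le[OF t] by simp
  qed
  then have "deriv \<phi> (complex_of_real s) = (\<integral>t. complex_of_real (t / (t - s)\<^sup>2) \<partial>\<mu>)"
    by (simp add: DERIV_imp_deriv)
  also have "\<dots> = complex_of_real (\<integral>t. t / (t - s)\<^sup>2 \<partial>\<mu>)"
    by (rule integral_complex_of_real)
  finally show "Re (deriv \<phi> (complex_of_real s)) = (\<integral>t. t / (t - s)\<^sup>2 \<partial>\<mu>)" by simp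
qed

text \<open>As s increases to 0, the integral of t/(t-s)^2, which is \<phi>'(s), increases to that
  of 1/t by monotone convergence along s = -1/(n+1). The proof is by contradiction because
  \<open>Lim\<close> can be evaluated only once convergence is known: an infinite integral of 1/t
  makes \<phi>' tend to \<infinity>.\<close>

lemma om_inverse_integrable:
  assumes om: "om_represents \<mu> \<phi>" and fin: "om_deriv_minus_zero \<phi> \<noteq> \<infinity>"
  shows "integrable \<mu> (\<lambda>t. 1 / t)"
proof (rule ccontr)
  assume ni: "\<not> integrable \<mu> (\<lambda>t. 1 / t)"
  have meas: "(\<lambda>t. 1 / t) \<in> borel_measurable \<mu>" by (rule om_represents_measurable[OF om]) measurable
  have inf: "(\<integral>\<^sup>+t. ennreal (1 / t) \<partial>\<mu>) = \<infinity>"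
  proof (rule ccontr)
    assume *: "(\<integral>\<^sup>+t. ennreal (1 / t) \<partial>\<mu>) \<noteq> \<infinity>"
    have "(\<integral>\<^sup>+t. ennreal (norm (1 / t)) \<partial>\<mu>) = (\<integral>\<^sup>+t. ennreal (1 / t) \<partial>\<mu>)"
      by (intro nn_integral_cong) (auto simp: om_represents_space[OF om])
    with * have "integrable \<mu> (\<lambda>t. 1 / t)"
      by (intro integrableI_bounded meas) (simp add: less_top)
    with ni show False by simp
  qed
  define G where "G s = (\<integral>t. t / (t - s)\<^sup>2 \<partial>\<mu>)" for s :: real
  have nnG: "(\<integral>\<^sup>+t. ennreal (t / (t - s)\<^sup>2) \<partial>\<mu>) = ennreal (G s)" if "s < 0" for s
    unfolding G_def using om_deriv_neg(2)[OF om that]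
    by (intro nn_integral_eq_integral AE_I2) (auto simp: om_represents_space[OF om])
  have mono: "t / (t - s)\<^sup>2 \<le> t / (t - s')\<^sup>2" if "t > 0" "s \<le> s'" "s' < 0" for t s s' :: real
    using that by (intro divide_left_mono power_mono mult_pos_pos zero_less_power) auto
  have A: "(\<integral>\<^sup>+t. (SUP n. ennreal (t / (t - (- (1 / real (Suc n))))\<^sup>2)) \<partial>\<mu>) =
      (SUP n. \<integral>\<^sup>+t. ennreal (t / (t - (- (1 / real (Suc n))))\<^sup>2) \<partial>\<mu>)"
  proof (rule nn_integral_monotone_convergence_SUP_AE)
    show "(\<lambda>t. ennreal (t / (t - (- (1 / real (Suc n))))\<^sup>2)) \<in> borel_measurable \<mu>" for n
      by (rule om_represents_measurable[OF om]) measurable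
    show "AE t in \<mu>. ennreal (t / (t - (- (1 / real (Suc n))))\<^sup>2) \<le> ennreal (t / (t - (- (1 / real (Suc (Suc n)))))\<^sup>2)" for n
      by (intro AE_I2 ennreal_leI mono) (auto simp: om_represents_space[OF om] divide_simps)
  qed
  have B: "(\<integral>\<^sup>+t. (SUP n. ennreal (t / (t - (- (1 / real (Suc n))))\<^sup>2)) \<partial>\<mu>) = (\<integral>\<^sup>+t. ennreal (1 / t) \<partial>\<mu>)"
  proof (rule nn_integral_cong)
    fix t assume "t \<in> space \<mu>"
    then have t: "t > 0" by (simp add: om_represents_space[OF om])
    have inc: "incseq (\<lambda>n. ennreal (t / (t - (- (1 / real (Suc n))))\<^sup>2))"
      by (intro incseq_SucI ennreal_leI mono t) (auto simp: divide_simps)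
    have "(\<lambda>n. t / (t - (- (1 / real (Suc n))))\<^sup>2) \<longlonglongrightarrow> t / (t - (- 0))\<^sup>2"
      using t by (intro tendsto_intros lim_inverse_n'[THEN LIMSEQ_Suc]) auto
    then have "(\<lambda>n. ennreal (t / (t - (- (1 / real (Suc n))))\<^sup>2)) \<longlonglongrightarrow> ennreal (1 / t)"
      using t by (intro tendsto_ennrealI) (simp add: power2_eq_square)
    then show "(SUP n. ennreal (t / (t - (- (1 / real (Suc n))))\<^sup>2)) = ennreal (1 / t)"
      by (rule LIMSEQ_unique[OF LIMSEQ_SUP[OF inc]])
  qed
  have C: "(\<integral>\<^sup>+t. ennreal (t / (t - (- (1 / real (Suc n))))\<^sup>2) \<partial>\<mu>) = ennreal (G (- (1 / real (Suc n))))" for n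
    by (rule nnG) simp
  have sup: "(SUP n. ennreal (G (- (1 / real (Suc n))))) = \<infinity>"
    unfolding C[symmetric] A[symmetric] B by (rule inf)
  have "((\<lambda>s::real. ereal (Re (deriv \<phi> (complex_of_real s)))) \<longlongrightarrow> \<infinity>) (at_left 0)"
    unfolding tendsto_PInfty
  proof
    fix r :: real
    have "ennreal r < (SUP n. ennreal (G (- (1 / real (Suc n)))))" unfolding sup by simp
    then obtain n where n: "ennreal r < ennreal (G (- (1 / real (Suc n))))" by (auto simp: less_SUP_iff)
    have "\<forall>\<^sub>F s in at_left 0. s \<in> {- (1 / real (Suc n))<..<0}"
      by (rule eventually_at_left_real) simp
    then show "\<forall>\<^sub>F s in at_left 0. ereal r < ereal (Re (deriv \<phi> (complex_of_real s)))"
    proof eventually_elim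
      case (elim s)
      have "ennreal (G (- (1 / real (Suc n)))) \<le> ennreal (G s)"
      proof -
        have "s < 0" using elim by simp
        show ?thesis unfolding C[symmetric] nnG[OF \<open>s < 0\<close>, symmetric]
          by (intro nn_integral_mono ennreal_leI mono) (use elim in \<open>auto simp: om_represents_space[OF om]\<close>)
      qed
      with n have "ennreal r < ennreal (G s)" by simp
      then have "r < G s" using ennreal_leI[of "G s" r] by (meson leD le_less_linear)
      then show ?case using om_deriv_neg(1)[OF om, of s] elim by (simp add: G_def)
    qed
  qed
  then have "om_deriv_minus_zero \<phi> = \<infinity>"
    unfolding om_deriv_minus_zero_def by (intro tendsto_Lim) auto
  with fin show False by simp
qed

section \<open>The logarithm\<close>

lemma LINT_FTC_at_top:
  fixes F f :: "real \<Rightarrow> complex"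
  assumes "\<And>x. x > l \<Longrightarrow> (F has_vector_derivative f x) (at x)" "\<And>x. x > l \<Longrightarrow> isCont f x"
    and "set_integrable lborel {l<..} f" "isCont F l" "(F \<longlongrightarrow> T) at_top"
  shows "(LINT x:{l<..}|lborel. f x) = T - F l"
proof -
  have e: "einterval (ereal l) \<infinity> = {l<..}" by (auto simp: einterval_def)
  have "(LBINT x=ereal l..\<infinity>. f x) = T - F l"
  proof (rule interval_integral_FTC_integrable)
    show "((F \<circ> real_of_ereal) \<longlongrightarrow> F l) (at_right (ereal l))"
      using assms(4) by (simp add: ereal_tendsto_simps isCont_def filterlim_at_split)
    show "((F \<circ> real_of_ereal) \<longlongrightarrow> T) (at_left \<infinity>)"
      using assms(5) by (simp add: ereal_tendsto_simps)
  qed (use assms e in auto)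
  then show ?thesis by (simp add: interval_lebesgue_integral_def e)
qed

lemma set_integrable_inverse_square:
  fixes l :: real
  assumes "l > 0" shows "set_integrable lborel {l<..} (\<lambda>t. C / t\<^sup>2)"
proof -
  have e: "einterval (ereal l) \<infinity> = {l<..}" by (auto simp: einterval_def)
  have "set_integrable lborel (einterval (ereal l) \<infinity>) (\<lambda>t::real. 1 / t\<^sup>2)"
  proof (rule interval_integral_FTC_nonneg(1))
    show "((\<lambda>t. - 1 / t) has_real_derivative 1 / x\<^sup>2) (at x)" if "ereal l < ereal x" for x :: real
      using that assms by (auto intro!: derivative_eq_intros simp: power2_eq_square)
    show "isCont (\<lambda>t::real. 1 / t\<^sup>2) x" if "ereal l < ereal x" for x
      using that assms by (intro continuous_intros) auto
    have "((\<lambda>t. - 1 / t) \<longlongrightarrow> - 1 / l) (at_right l)" using assms by (intro tendsto_intros) auto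
    then show "(((\<lambda>t. - 1 / t) \<circ> real_of_ereal) \<longlongrightarrow> - 1 / l) (at_right (ereal l))"
      by (simp add: ereal_tendsto_simps)
    have "((\<lambda>t::real. - 1 / t) \<longlongrightarrow> 0) at_top" by real_asymp
    then show "(((\<lambda>t. - 1 / t) \<circ> real_of_ereal) \<longlongrightarrow> 0) (at_left \<infinity>)"
      by (simp add: ereal_tendsto_simps)
  qed auto
  then have "set_integrable lborel {l<..} (\<lambda>t::real. C * (1 / t\<^sup>2))"
    unfolding e by (rule set_integrable_mult_right)
  then show ?thesis by simp
qed

text \<open>The density vanishes up to l, instead of the space being (l,\<infinity>), because
  \<open>om_represents\<close> requires a measure on (0,\<infinity>).\<close>

definition log_measure :: "real \<Rightarrow> real measure" where
  "log_measure l = density (restrict_space lborel {0<..}) (\<lambda>t. ennreal (if l < t then 1 / t else 0))"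

lemma integral_log_measure:
  fixes f :: "real \<Rightarrow> 'b::{banach, second_countable_topology}"
  assumes l: "l > 0" and f: "f \<in> borel_measurable borel"
  shows "integral\<^sup>L (log_measure l) f = (LINT t:{l<..}|lborel. (1 / t) *\<^sub>R f t)"
    and "integrable (log_measure l) f \<longleftrightarrow> set_integrable lborel {l<..} (\<lambda>t. (1 / t) *\<^sub>R f t)"
proof -
  have m: "f \<in> borel_measurable (restrict_space lborel {0<..})" "(\<lambda>t::real. if l < t then 1 / t else 0) \<in> borel_measurable (restrict_space lborel {0<..})"
    using f by (auto intro!: measurable_restrict_space1)
  have nn: "AE t in restrict_space lborel {0<..}. 0 \<le> (if l < t then 1 / t else 0)"
    using l by (intro AE_I2) auto
  have eq: "(\<lambda>t. indicator {0<..} t *\<^sub>R (if l < t then 1 / t else 0) *\<^sub>R f t) = (\<lambda>t. indicator {l<..} t *\<^sub>R (1 / t) *\<^sub>R f t)"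
    using l by (auto simp: fun_eq_iff indicator_def)
  show "integral\<^sup>L (log_measure l) f = (LINT t:{l<..}|lborel. (1 / t) *\<^sub>R f t)"
    unfolding log_measure_def using integral_density[OF m nn]
    by (simp add: integral_restrict_space eq set_lebesgue_integral_def del: scaleR_scaleR)
  show "integrable (log_measure l) f \<longleftrightarrow> set_integrable lborel {l<..} (\<lambda>t. (1 / t) *\<^sub>R f t)"
    unfolding log_measure_def using integrable_density[OF m nn]
    by (simp add: integrable_restrict_space eq set_integrable_def del: scaleR_scaleR)
qed

lemma integrable_inverse_log_measure:
  assumes l: "l > 0" shows "integrable (log_measure l) (\<lambda>t. 1 / t)"
  using integral_log_measure(2)[OF l, of "\<lambda>t. 1 / t"] set_integrable_inverse_square[OF l, of 1]
  by (simp add: power2_eq_square)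

lemma space_log_measure: "space (log_measure l) = {0<..}"
  by (simp add: log_measure_def space_restrict_space)

text \<open>Since z/(t (t - z)) = 1/(t - z) - 1/t, a primitive is Ln(t - z) - Ln t. It vanishes at
  infinity, and minus its value at l is \<open>log_fun l z\<close>.\<close>

lemma log_fun_represents:
  assumes l: "l > 0" shows "om_represents (log_measure l) (log_fun l)"
  unfolding om_represents_def
proof (intro conjI allI impI)
  show "sets (log_measure l) = sets (restrict_space borel {0<..})"
    by (simp add: log_measure_def sets_restrict_space)
  have "(\<integral>\<^sup>+t. ennreal (1 / (1 + t)) \<partial>log_measure l) \<le> (\<integral>\<^sup>+t. ennreal (norm (1 / t)) \<partial>log_measure l)"
    by (intro nn_integral_mono ennreal_leI) (auto simp: space_log_measure divide_simps)
  also have "\<dots> < \<infinity>" using integrable_inverse_log_measure[OF l] by (simp add: integrable_iff_bounded)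
  finally show "(\<integral>\<^sup>+t. ennreal (1 / (1 + t)) \<partial>log_measure l) < \<infinity>" .
  fix z assume z: "z \<notin> complex_of_real ` {0<..}"
  have slit: "complex_of_real t - z \<notin> \<real>\<^sub>\<le>\<^sub>0" if "t > 0" for t
  proof
    assume "complex_of_real t - z \<in> \<real>\<^sub>\<le>\<^sub>0"
    then have "Re z \<ge> t" "Im z = 0" by (auto simp: complex_nonpos_Reals_iff)
    then have "z = complex_of_real (Re z)" "Re z > 0" using that by (auto simp: complex_eq_iff)
    then show False using z by blast
  qed
  \<comment> \<open>A lower bound of |t - z| relative to t, for the integrability. In the right
    half-plane it comes from Im((t - z) cnj z) = - t Im z, so that d is the sine of the angle
    between z and the axis.\<close>
  obtain d where d: "d > 0" "\<And>t. t > 0 \<Longrightarrow> d * t \<le> cmod (complex_of_real t - z)"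
  proof (cases "Re z \<le> 0")
    case True
    have "t \<le> cmod (complex_of_real t - z)" for t
      using complex_Re_le_cmod[of "complex_of_real t - z"] True by simp
    then show thesis using that[of 1] by simp
  next
    case False
    then have im: "Im z \<noteq> 0" "z \<noteq> 0" using z by (auto simp: complex_eq_iff image_iff)
    have "\<bar>Im z\<bar> / cmod z * t \<le> cmod (complex_of_real t - z)" if "t > 0" for t
    proof -
      have "\<bar>Im ((complex_of_real t - z) * cnj z)\<bar> \<le> cmod ((complex_of_real t - z) * cnj z)"
        by (rule abs_Im_le_cmod)
      moreover have "Im ((complex_of_real t - z) * cnj z) = - t * Im z" by (simp add: algebra_simps)
      ultimately have "t * \<bar>Im z\<bar> \<le> cmod (complex_of_real t - z) * cmod z"
        using that by (simp add: norm_mult abs_mult)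
      then show ?thesis using im by (simp add: field_simps)
    qed
    then show thesis using that[of "\<bar>Im z\<bar> / cmod z"] im by simp
  qed
  define f where "f t = (1 / t) *\<^sub>R (z / (complex_of_real t - z))" for t
  define F where "F t = Ln (complex_of_real t - z) - Ln (complex_of_real t)" for t
  have "(LINT t:{l<..}|lborel. f t) = 0 - F l"
  proof (rule LINT_FTC_at_top)
    have F': "(F has_vector_derivative f t) (at t)" if t: "t > 0" for t
    proof -
      have nz: "complex_of_real t - z \<noteq> 0" "complex_of_real t \<noteq> 0" using slit[OF t] t by auto
      have "((\<lambda>w. Ln (w - z) - Ln w) has_field_derivative (1 / (complex_of_real t - z) - 1 / complex_of_real t)) (at (complex_of_real t))"
        using slit[OF t] t by (auto intro!: derivative_eq_intros simp: complex_nonpos_Reals_iff divide_inverse)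
      moreover have "1 / (complex_of_real t - z) - 1 / complex_of_real t = f t"
        using nz by (simp add: f_def scaleR_conv_of_real field_simps)
      ultimately show ?thesis unfolding F_def using has_vector_derivative_real_field by fastforce
    qed
    then show "\<And>t. t > l \<Longrightarrow> (F has_vector_derivative f t) (at t)" using l by simp
    show "isCont F l" using F'[OF l] by (rule has_vector_derivative_continuous)
    show ct: "isCont f t" if "t > l" for t
      using that l slit[of t] unfolding f_def by (intro continuous_intros) auto
    show "set_integrable lborel {l<..} f"
    proof (rule set_integrable_bound[OF set_integrable_inverse_square[OF l, of "cmod z / d"]])
      show "set_borel_measurable lborel {l<..} f"
        unfolding set_borel_measurable_def f_def by measurable
      show "AE t in lborel. t \<in> {l<..} \<longrightarrow> norm (f t) \<le> norm (cmod z / d / t\<^sup>2)"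
      proof (intro AE_I2 impI)
        fix t assume "t \<in> {l<..}"
        then have t: "t > 0" using l by simp
        have "norm (f t) \<le> 1 / t * (cmod z / (d * t))"
          unfolding f_def norm_scaleR norm_divide using d t
          by (intro mult_mono divide_left_mono) (auto intro: less_le_trans[OF mult_pos_pos])
        then show "norm (f t) \<le> norm (cmod z / d / t\<^sup>2)" using t d by (simp add: power2_eq_square field_simps)
      qed
    qed
    \<comment> \<open>Dividing by the positive number t is compatible with the branch of
      \<open>Ln\<close>, so F t = Ln(1 - z/t) for all positive t.\<close>
    have "((\<lambda>t. Ln (1 - z / complex_of_real t)) \<longlongrightarrow> Ln (1 - 0)) at_top"
    proof (intro tendsto_intros)
      have "((\<lambda>t. z * complex_of_real (1 / t)) \<longlongrightarrow> z * complex_of_real 0) at_top"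
        by (intro tendsto_intros) real_asymp
      then show "((\<lambda>t. z / complex_of_real t) \<longlongrightarrow> 0) at_top" by simp
    qed auto
    moreover have "\<forall>\<^sub>F t in at_top. Ln (1 - z / complex_of_real t) = F t"
      using eventually_gt_at_top[of 0]
    proof eventually_elim
      case (elim t)
      have "1 - z / complex_of_real t \<noteq> 0"
        using slit[OF elim] elim by (auto simp: field_simps)
      from Ln_times_of_real[OF elim this]
      have "Ln (complex_of_real t - z) = Ln (complex_of_real t) + Ln (1 - z / complex_of_real t)"
        using elim by (simp add: algebra_simps flip: Ln_of_real)
      then show ?case unfolding F_def by simp
    qed
    ultimately show "(F \<longlongrightarrow> 0) at_top" using tendsto_cong by fastforce
  qed
  moreover have "(\<integral>t. z / (complex_of_real t - z) \<partial>log_measure l) = (LINT t:{l<..}|lborel. f t)"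
    unfolding f_def by (rule integral_log_measure(1)[OF l]) measurable
  ultimately show "log_fun l z = (\<integral>t. z / (complex_of_real t - z) \<partial>log_measure l)"
    using l by (simp add: F_def log_fun_def Ln_of_real)
qed

section \<open>Integrals of separated series\<close>

text \<open>Fubini for a triple series with a product majorant. The inner sums are supplied by the
  caller as \<open>G\<close> and \<open>H\<close>, so that the total comes out in closed
  form.\<close>

lemma sums_triple:
  fixes f :: "nat \<times> nat \<times> nat \<Rightarrow> 'b::banach"
  assumes e: "bij (e :: nat \<Rightarrow> nat \<times> nat \<times> nat)"
    and bd: "\<And>n i j. norm (f (n, i, j)) \<le> c n * (a i * b j)"
    and nn: "\<And>n. 0 \<le> c n" "\<And>i. 0 \<le> a i" "\<And>j. 0 \<le> b j"
    and su: "summable c" "summable a" "summable b"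
    and G: "\<And>n i. (\<lambda>j. f (n, i, j)) sums G n i" and H: "\<And>n. G n sums H n" and S: "H sums S"
  shows "(\<lambda>m. f (e m)) sums S"
proof -
  have hs: "(g has_sum s) UNIV" if "g sums s" "summable h" "\<And>n. norm (g n) \<le> h n" for g :: "nat \<Rightarrow> 'c::banach" and h s
    by (rule norm_summable_imp_has_sum[OF summable_comparison_test'[OF that(2), of 0] that(1)]) (use that(3) in auto)
  have hsr: "(g has_sum suminf g) UNIV" if "summable g" "\<And>n. 0 \<le> g n" for g :: "nat \<Rightarrow> real"
    by (rule hs[OF summable_sums[OF that(1)] that(1)]) (use that(2) in simp)
  have ab: "((\<lambda>(i, j). a i * b j) has_sum suminf a * suminf b) (UNIV \<times> UNIV)"
  proof (rule has_sum_SigmaI)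
    show "((\<lambda>j. case (i, j) of (i, j) \<Rightarrow> a i * b j) has_sum a i * suminf b) UNIV" for i
      using has_sum_cmult_right[OF hsr[OF su(3) nn(3)], of "a i"] by simp
    show "((\<lambda>i. a i * suminf b) has_sum suminf a * suminf b) UNIV"
      by (rule has_sum_cmult_left[OF hsr[OF su(2) nn(2)]])
    show "(\<lambda>(i, j). a i * b j) summable_on UNIV \<times> UNIV"
    proof (rule summable_on_SigmaI)
      show "((\<lambda>j. case (i, j) of (i, j) \<Rightarrow> a i * b j) has_sum a i * suminf b) UNIV" for i
        using has_sum_cmult_right[OF hsr[OF su(3) nn(3)], of "a i"] by simp
      show "(\<lambda>i. a i * suminf b) summable_on UNIV"
        by (rule has_sum_imp_summable[OF has_sum_cmult_left[OF hsr[OF su(2) nn(2)]]])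
    qed (use nn in auto)
  qed
  have abc: "(\<lambda>(n, i, j). c n * (a i * b j)) summable_on UNIV \<times> (UNIV \<times> UNIV)"
  proof (rule summable_on_SigmaI)
    show "((\<lambda>ij. case (n, ij) of (n, i, j) \<Rightarrow> c n * (a i * b j)) has_sum c n * (suminf a * suminf b)) (UNIV \<times> UNIV)" for n
      using has_sum_cmult_right[OF ab, of "c n"] by (simp add: case_prod_beta)
    show "(\<lambda>n. c n * (suminf a * suminf b)) summable_on UNIV"
      by (rule has_sum_imp_summable[OF has_sum_cmult_left[OF hsr[OF su(1) nn(1)]]])
  qed (use nn in auto)
  have b0: "suminf b \<ge> 0" "suminf a \<ge> 0" using su nn by (auto intro: suminf_nonneg)
  have Gb: "norm (G n i) \<le> c n * suminf b * a i" for n i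
  proof -
    have "summable (\<lambda>j. c n * a i * b j)" by (intro summable_mult su)
    have "norm (f (n, i, j)) \<le> c n * a i * b j" for j using bd[of n i j] by (simp add: ac_simps)
    have "norm (\<Sum>j. f (n, i, j)) \<le> (\<Sum>j. c n * a i * b j)" by (rule norm_suminf_le) fact+
    also have "(\<Sum>j. c n * a i * b j) = c n * suminf b * a i"
      by (subst suminf_mult[OF su(3)]) (simp add: ac_simps)
    finally show ?thesis by (simp flip: sums_unique[OF G])
  qed
  have Hb: "norm (H n) \<le> suminf b * suminf a * c n" for n
  proof -
    have "summable (\<lambda>i. c n * suminf b * a i)" by (intro summable_mult su)
    have "norm (\<Sum>i. G n i) \<le> (\<Sum>i. c n * suminf b * a i)" by (rule norm_suminf_le) (fact | rule Gb)+
    also have "(\<Sum>i. c n * suminf b * a i) = suminf b * suminf a * c n"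
      by (subst suminf_mult[OF su(2)]) (simp add: ac_simps)
    finally show ?thesis by (simp flip: sums_unique[OF H])
  qed
  have fab: "(\<lambda>x. norm (f x)) summable_on UNIV \<times> (UNIV \<times> UNIV)"
  proof (rule Infinite_Sum.abs_summable_on_comparison_test)
    show "(\<lambda>x. norm (case x of (n, i, j) \<Rightarrow> c n * (a i * b j))) summable_on UNIV \<times> (UNIV \<times> UNIV)"
    proof -
      have "(\<lambda>x. norm (case x of (n, i, j) \<Rightarrow> c n * (a i * b j))) = (\<lambda>(n, i, j). c n * (a i * b j))"
        using nn by (auto simp: fun_eq_iff)
      then show ?thesis using abc by simp
    qed
    show "norm (f x) \<le> norm (case x of (n, i, j) \<Rightarrow> c n * (a i * b j))" for x
      using bd[of "fst x" "fst (snd x)" "snd (snd x)"] by (simp add: case_prod_beta)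
  qed
  have fn: "(\<lambda>ij. f (n, ij)) summable_on UNIV \<times> UNIV" for n
  proof (rule abs_summable_summable, rule Infinite_Sum.abs_summable_on_comparison_test)
    have "(\<lambda>ij. norm (c n * (case ij of (i, j) \<Rightarrow> a i * b j))) = (\<lambda>ij. c n * (case ij of (i, j) \<Rightarrow> a i * b j))"
      using nn by (auto simp: fun_eq_iff)
    then show "(\<lambda>ij. norm (c n * (case ij of (i, j) \<Rightarrow> a i * b j))) summable_on UNIV \<times> UNIV"
      using has_sum_imp_summable[OF has_sum_cmult_right[OF ab, of "c n"]] by simp
    show "norm (f (n, ij)) \<le> norm (c n * (case ij of (i, j) \<Rightarrow> a i * b j))" for ij
      using bd[of n "fst ij" "snd ij"] by (simp add: case_prod_beta)
  qed
  have "(f has_sum S) (UNIV \<times> (UNIV \<times> UNIV))"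
  proof (rule has_sum_SigmaI)
    show "((\<lambda>ij. f (n, ij)) has_sum H n) (UNIV \<times> UNIV)" for n
    proof (rule has_sum_SigmaI)
      show "((\<lambda>j. f (n, i, j)) has_sum G n i) UNIV" for i
      proof (rule hs[OF G])
        show "summable (\<lambda>j. c n * a i * b j)" by (intro summable_mult su)
        show "norm (f (n, i, j)) \<le> c n * a i * b j" for j using bd[of n i j] by (simp only: mult.assoc)
      qed
      show "(G n has_sum H n) UNIV"
        by (rule hs[OF H _ Gb]) (intro summable_mult su)
    qed (rule fn)
    show "(H has_sum S) UNIV"
      by (rule hs[OF S _ Hb]) (intro summable_mult su)
  qed (rule abs_summable_summable[OF fab])
  then have "(f has_sum S) UNIV" by simp
  then have "((\<lambda>m. f (e m)) has_sum S) UNIV" using has_sum_reindex_bij_betw[OF e, of f S] by simp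
  then show ?thesis by (rule has_sum_imp_sums)
qed

lemma om_represents_integrable_inverse_bound:
  fixes f :: "real \<Rightarrow> 'b::{banach, second_countable_topology}"
  assumes om: "om_represents \<mu> \<phi>" and i: "integrable \<mu> (\<lambda>t. 1 / t)"
    and f: "f \<in> borel_measurable \<mu>" and bd: "\<And>t. t > 0 \<Longrightarrow> norm (f t) \<le> C / t"
  shows "integrable \<mu> f"
proof (rule Bochner_Integration.integrable_bound[of _ "\<lambda>t. C * (1 / t)"])
  show "integrable \<mu> (\<lambda>t. C * (1 / t))" by (rule integrable_mult_right[OF i])
  show "AE t in \<mu>. norm (f t) \<le> norm (C * (1 / t))"
  proof (rule AE_I2)
    fix t assume "t \<in> space \<mu>"
    then have t: "t > 0" by (simp add: om_represents_space[OF om])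
    show "norm (f t) \<le> norm (C * (1 / t))"
      using t by (intro order_trans[OF bd[OF t]]) (simp add: divide_right_mono)
  qed
qed fact

text \<open>The pointwise bound C/t of a sum of nonnegative terms passes to the partial sums of the
  integrals, since 1/t is \<mu>-integrable. This provides the summability required by
  \<open>has_bochner_int_series\<close> and by nuclear representations.\<close>

lemma weighted_series_integrable:
  assumes om: "om_represents \<mu> \<phi>" and i: "integrable \<mu> (\<lambda>t. 1 / t)"
    and g: "\<And>m. g m \<in> borel_measurable borel"
    and gb: "\<And>m t. t > 0 \<Longrightarrow> \<bar>g m t\<bar> \<le> b m / t" and w: "\<And>m. 0 \<le> w m"
    and su: "\<And>t. t > 0 \<Longrightarrow> summable (\<lambda>m. \<bar>g m t\<bar> * w m)"
    and C: "\<And>t. t > 0 \<Longrightarrow> (\<Sum>m. \<bar>g m t\<bar> * w m) \<le> C / t"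
  shows "integrable \<mu> (g m)" "summable (\<lambda>m. (\<integral>t. \<bar>g m t\<bar> \<partial>\<mu>) * w m)"
proof -
  show int: "integrable \<mu> (g m)" for m
    by (rule om_represents_integrable_inverse_bound[OF om i om_represents_measurable[OF om g]])
      (use gb in simp)
  show "summable (\<lambda>m. (\<integral>t. \<bar>g m t\<bar> \<partial>\<mu>) * w m)"
  proof (rule summableI_nonneg_bounded)
    show "0 \<le> (\<integral>t. \<bar>g m t\<bar> \<partial>\<mu>) * w m" for m using w by (intro mult_nonneg_nonneg integral_nonneg_AE) auto
    fix n
    have "(\<Sum>m<n. (\<integral>t. \<bar>g m t\<bar> \<partial>\<mu>) * w m) = (\<integral>t. (\<Sum>m<n. \<bar>g m t\<bar> * w m) \<partial>\<mu>)"
      using int by simp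
    also have "\<dots> \<le> (\<integral>t. C * (1 / t) \<partial>\<mu>)"
    proof (rule integral_mono)
      show "integrable \<mu> (\<lambda>t. \<Sum>m<n. \<bar>g m t\<bar> * w m)" using int by simp
      show "integrable \<mu> (\<lambda>t. C * (1 / t))" by (rule integrable_mult_right[OF i])
      fix t assume "t \<in> space \<mu>"
      then have t: "t > 0" by (simp add: om_represents_space[OF om])
      have "(\<Sum>m<n. \<bar>g m t\<bar> * w m) \<le> (\<Sum>m. \<bar>g m t\<bar> * w m)"
        by (rule sum_le_suminf[OF su[OF t]]) (use w in auto)
      also have "\<dots> \<le> C * (1 / t)" using C[OF t] by simp
      finally show "(\<Sum>m<n. \<bar>g m t\<bar> * w m) \<le> C * (1 / t)" .
    qed
    finally show "(\<Sum>m<n. (\<integral>t. \<bar>g m t\<bar> \<partial>\<mu>) * w m) \<le> (\<integral>t. C * (1 / t) \<partial>\<mu>)" .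
  qed
qed

section \<open>The operator calculus\<close>

text \<open>Stated with a moving vector \<open>g z\<close>, so that it can be iterated for products
  of resolvents. Near w the norms are at most 2m by \<open>resolvent_perturb\<close>; the resolvent
  identity settles the rest.\<close>

lemma resolvent_tendsto:
  fixes A :: "'a::complex_banach operator"
  assumes A: "linear_operator A" and w: "w \<in> resolvent_set A" and g: "(g \<longlongrightarrow> l) (at w)"
  shows "((\<lambda>z. resolvent z A (g z)) \<longlongrightarrow> resolvent w A l) (at w)"
proof -
  define m where "m = onorm (resolvent w A) + 1"
  have m: "norm (resolvent w A x) \<le> m * norm x" "m > 0" for x
    using bounded_clinear_onorm[OF bounded_clinear_resolvent[OF w], of x]
      bounded_clinear_onorm_nonneg[OF bounded_clinear_resolvent[OF w]]
    by (auto simp: m_def algebra_simps intro: add_increasing)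
  have near: "\<forall>\<^sub>F z in at w. cmod (z - w) * m \<le> 1 / 2"
  proof -
    have "((\<lambda>z. cmod (z - w) * m) \<longlongrightarrow> cmod (w - w) * m) (at w)" by (intro tendsto_intros)
    then have "\<forall>\<^sub>F z in at w. cmod (z - w) * m < 1 / 2" by (rule order_tendstoD) simp
    then show ?thesis by eventually_elim simp
  qed
  show ?thesis
  proof (rule LIM_zero_cancel, rule Lim_null_comparison)
    show "((\<lambda>z. 2 * m * norm (g z - l) + cmod (w - z) * (2 * m * norm (resolvent w A l))) \<longlongrightarrow> 0) (at w)"
    proof -
      have "((\<lambda>z. 2 * m * norm (g z - l) + cmod (w - z) * (2 * m * norm (resolvent w A l))) \<longlongrightarrow>
          2 * m * norm (l - l) + cmod (w - w) * (2 * m * norm (resolvent w A l))) (at w)"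
        by (intro tendsto_intros g)
      then show ?thesis by simp
    qed
    show "\<forall>\<^sub>F z in at w. norm (resolvent z A (g z) - resolvent w A l) \<le>
        2 * m * norm (g z - l) + cmod (w - z) * (2 * m * norm (resolvent w A l))"
      using near
    proof eventually_elim
      case (elim z)
      note z = resolvent_perturb[OF A w m(1) elim]
      have "resolvent z A (g z) - resolvent w A l = resolvent z A (g z - l) + (resolvent z A l - resolvent w A l)"
        by (simp add: bounded_clinear_diff[OF bounded_clinear_resolvent[OF z(1)]])
      also have "resolvent z A l - resolvent w A l = (w - z) *\<^sub>C resolvent z A (resolvent w A l)"
        using resolvent_identity[OF A z(1) w, of l] by (metis add_diff_cancel_left')
      also have "norm (resolvent z A (g z - l) + (w - z) *\<^sub>C resolvent z A (resolvent w A l)) \<le>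
          norm (resolvent z A (g z - l)) + norm ((w - z) *\<^sub>C resolvent z A (resolvent w A l))"
        by (rule norm_triangle_ineq)
      also have "\<dots> \<le> 2 * m * norm (g z - l) + cmod (w - z) * (2 * m * norm (resolvent w A l))"
        unfolding norm_scaleC by (intro add_mono mult_left_mono z) auto
      finally show ?case .
    qed
  qed
qed

lemma isCont_resolvent:
  fixes A :: "'a::complex_banach operator"
  assumes "linear_operator A" "z \<in> resolvent_set A" "isCont g z"
  shows "isCont (\<lambda>z. resolvent z A (g z)) z"
  using resolvent_tendsto[OF assms(1,2) assms(3)[unfolded isCont_def]] by (simp only: isCont_def)

text \<open>Continuity is the source of measurability in a nonseparable space; it is required only
  on the positive axis, where representing measures live.\<close>

lemma measurable_of_isCont:
  fixes g :: "complex \<Rightarrow> 'b::topological_space"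
  assumes om: "om_represents \<mu> \<phi>" and "\<And>t. t > 0 \<Longrightarrow> isCont g (complex_of_real t)"
  shows "(\<lambda>t. g (complex_of_real t)) \<in> borel_measurable \<mu>"
proof -
  have "continuous_on {0<..} (\<lambda>t. g (complex_of_real t))"
  proof (intro continuous_at_imp_continuous_on ballI)
    fix t :: real assume "t \<in> {0<..}"
    then show "isCont (\<lambda>t. g (complex_of_real t)) t"
      using isCont_o2[of t complex_of_real g] assms(2)[of t] by simp
  qed
  then have "(\<lambda>t. g (complex_of_real t)) \<in> borel_measurable (restrict_space borel {0<..})"
    by (rule borel_measurable_continuous_on_restrict)
  then show ?thesis using measurable_cong_sets[OF om_represents_space(1)[OF om] refl] by blast
qed

text \<open>On the domain A R(t,A) x = R(t,A) A x, so the integral is K A x with K the integral of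
  R(t,A), bounded because the norm of R(t,A) is at most a multiple of 1/t. Built as a series, K
  commutes with the resolvents termwise; \<open>om_calc_NP\<close> relies on this.\<close>

lemma has_bochner_int_app_resolvent:
  fixes A :: "'a::complex_banach operator"
  assumes A: "A \<in> NP" and om: "om_represents \<mu> \<phi>" and i: "integrable \<mu> (\<lambda>t. 1 / t)"
  obtains K where "bounded_clinear K" "\<And>s x. s \<in> resolvent_set A \<Longrightarrow> K (resolvent s A x) = resolvent s A (K x)"
    "\<And>x. x \<in> Domain A \<Longrightarrow>
      has_bochner_int \<mu> (\<lambda>t. app A (resolvent (complex_of_real t) A x)) (K (app A x))"
proof -
  note lin = NP_linear_operator[OF A] and rs = NP_resolvent_set[OF A]
  obtain E :: "nat \<Rightarrow> real \<Rightarrow> real" and P p and C :: real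
    where E: "\<And>i. E i \<in> borel_measurable borel" and P: "\<And>i. bounded_clinear (P i)" and C: "0 \<le> C"
      and p: "\<And>i. 0 < p i" and Pp: "\<And>i x. norm (P i x) \<le> p i * norm x"
      and comm: "\<And>i s x. s \<in> resolvent_set A \<Longrightarrow> P i (resolvent s A x) = resolvent s A (P i x)"
      and R: "\<And>t x. t > 0 \<Longrightarrow> (\<lambda>i. E i t *\<^sub>R P i x) sums resolvent (complex_of_real t) A x"
      and su: "\<And>t. t > 0 \<Longrightarrow> summable (\<lambda>i. \<bar>E i t\<bar> * p i)"
      and le: "\<And>t. t > 0 \<Longrightarrow> (\<Sum>i. \<bar>E i t\<bar> * p i) \<le> C / t"
      and Eb: "\<And>i t. t > 0 \<Longrightarrow> \<bar>E i t\<bar> \<le> C / p i / t"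
    by (rule resolvent_series[OF A]) (rule that)
  note int = weighted_series_integrable[OF om i E Eb less_imp_le[OF p] su le]
  define k where "k i = integral\<^sup>L \<mu> (E i)" for i
  have k: "\<bar>k i\<bar> \<le> (\<integral>t. \<bar>E i t\<bar> \<partial>\<mu>)" for i unfolding k_def by (rule integral_abs_bound)
  have suk: "summable (\<lambda>i. \<bar>k i\<bar> * p i)"
    by (rule summable_comparison_test'[OF int(2), of 0]) (use k p in \<open>auto simp: abs_mult less_imp_le intro: mult_right_mono\<close>)
  have nk: "norm (k i *\<^sub>R P i x) \<le> \<bar>k i\<bar> * p i * norm x" for i x
    using mult_left_mono[OF Pp[of i x], of "\<bar>k i\<bar>"] by (simp add: mult.assoc)
  have sun: "summable (\<lambda>i. k i *\<^sub>R P i x)" for x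
    by (rule summable_comparison_test'[OF summable_mult2[OF suk, of "norm x"], of 0]) (rule nk)
  define K where "K x = (\<Sum>i. k i *\<^sub>R P i x)" for x
  show thesis
  proof (rule that[of K])
    show "bounded_clinear K"
    proof (rule bounded_clinearI[where K="\<Sum>i. \<bar>k i\<bar> * p i"])
      show "K (x + y) = K x + K y" for x y
        using suminf_add[OF sun[of x] sun[of y]]
        by (simp add: K_def bounded_clinear_add[OF P] scaleR_add_right)
      show "K (c *\<^sub>C x) = c *\<^sub>C K x" for c x
        unfolding K_def using bounded_clinear_sums[OF bounded_clinear_const_scaleC[OF bounded_clinear_ident], OF summable_sums[OF sun[of x]], of c]
        by (simp add: sums_iff bounded_clinear_scaleC[OF P] scaleR_scaleC mult.commute)
      show "norm (K x) \<le> norm x * (\<Sum>i. \<bar>k i\<bar> * p i)" for x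
      proof -
        have "norm (K x) \<le> (\<Sum>i. \<bar>k i\<bar> * p i * norm x)"
          unfolding K_def by (rule norm_suminf_le[OF nk]) (rule summable_mult2[OF suk])
        then show ?thesis using suminf_mult2[OF suk, of "norm x"] by (simp add: mult.commute)
      qed
    qed
    show "K (resolvent s A x) = resolvent s A (K x)" if "s \<in> resolvent_set A" for s x
      unfolding K_def using bounded_clinear_sums[OF bounded_clinear_resolvent[OF that] summable_sums[OF sun[of x]]]
      by (simp add: sums_iff comm[OF that] bounded_clinear_scaleR[OF bounded_clinear_resolvent[OF that]])
    fix x assume x: "x \<in> Domain A"
    have eq: "app A (resolvent (complex_of_real t) A x) = resolvent (complex_of_real t) A (app A x)" if "t > 0" for t
      using app_resolvent[OF rs[OF that]] resolvent_app[OF rs[OF that] x] by simp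
    have "(\<lambda>t. resolvent (complex_of_real t) A (app A x)) \<in> borel_measurable \<mu>"
      by (rule measurable_of_isCont[OF om]) (intro isCont_resolvent lin rs continuous_const)
    then have m: "(\<lambda>t. app A (resolvent (complex_of_real t) A x)) \<in> borel_measurable \<mu>"
      by (rule measurable_cong[THEN iffD1, rotated]) (simp add: eq om_represents_space[OF om])
    show "has_bochner_int \<mu> (\<lambda>t. app A (resolvent (complex_of_real t) A x)) (K (app A x))"
      unfolding K_def k_def
    proof (rule has_bochner_int_series[OF m int(1)])
      show "(\<lambda>i. E i t *\<^sub>R P i (app A x)) sums app A (resolvent (complex_of_real t) A x)" if "t \<in> space \<mu>" for t
        using R[of t "app A x"] eq that by (simp add: om_represents_space[OF om])
      show "summable (\<lambda>i. (\<integral>t. \<bar>E i t\<bar> \<partial>\<mu>) * norm (P i (app A x)))"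
      proof (rule summable_comparison_test'[OF summable_mult2[OF int(2), of "norm (app A x)"], of 0])
        fix i
        have "(\<integral>t. \<bar>E i t\<bar> \<partial>\<mu>) * norm (P i (app A x)) \<le> (\<integral>t. \<bar>E i t\<bar> \<partial>\<mu>) * (p i * norm (app A x))"
          by (intro mult_left_mono Pp integral_nonneg_AE) auto
        then show "norm ((\<integral>t. \<bar>E i t\<bar> \<partial>\<mu>) * norm (P i (app A x))) \<le> (\<integral>t. \<bar>E i t\<bar> \<partial>\<mu>) * p i * norm (app A x)"
          by (simp add: abs_mult integral_nonneg_AE mult.assoc)
      qed
    qed
  qed
qed

text \<open>Applying \<open>R(1,A)\<close> turns the core of \<open>\<phi>(A)\<close> into a bounded operator, so that the closure is
  single valued.\<close>

lemma om_calc_NP: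
  fixes A :: "'a::complex_banach operator"
  assumes A: "A \<in> NP" and om: "om_represents \<mu> \<phi>" and i: "integrable \<mu> (\<lambda>t. 1 / t)"
  shows "single_valued (om_calc \<phi> A)"
    and "x \<in> Domain A \<Longrightarrow> x \<in> Domain (om_calc \<phi> A)"
    and "x \<in> Domain A \<Longrightarrow>
      has_bochner_int \<mu> (\<lambda>t. app A (resolvent (complex_of_real t) A x)) (app (om_calc \<phi> A) x)"
proof -
  obtain K where K: "bounded_clinear K" "\<And>s x. s \<in> resolvent_set A \<Longrightarrow> K (resolvent s A x) = resolvent s A (K x)"
    "\<And>x. x \<in> Domain A \<Longrightarrow>
      has_bochner_int \<mu> (\<lambda>t. app A (resolvent (complex_of_real t) A x)) (K (app A x))"
    using has_bochner_int_app_resolvent[OF A om i] by blast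
  have one: "1 \<in> resolvent_set A" using NP_resolvent_set[OF A, of 1] by simp
  note bR = bounded_clinear_resolvent[OF one]
  define core where "core = {(x, K (app A x)) | x. x \<in> Domain A}"
  have calc: "om_calc \<phi> A = closure core"
  proof -
    have "{(x, y). x \<in> Domain A \<and> has_bochner_int \<mu> (\<lambda>t. app A (resolvent (complex_of_real t) A x)) y} = core"
      unfolding core_def using K(3) has_bochner_int_unique by blast
    then show ?thesis unfolding om_calc_def om_measure_eq[OF om] by simp
  qed
  \<comment> \<open>On the core R(1,A) K A v = K R(1,A) A v = K (R(1,A) v - v). This relation
    between the two components is continuous and passes to the closure.\<close>
  have det: "resolvent 1 A y = K (resolvent 1 A x - x)" if xy: "(x, y) \<in> closure core" for x y
  proof -
    obtain z where z: "\<forall>n. z n \<in> core" "z \<longlonglongrightarrow> (x, y)"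
      using xy unfolding closure_sequential by blast
    have z2: "(\<lambda>n. fst (z n)) \<longlonglongrightarrow> x" "(\<lambda>n. snd (z n)) \<longlonglongrightarrow> y"
      using tendsto_fst[OF z(2)] tendsto_snd[OF z(2)] by auto
    have "resolvent 1 A (snd (z n)) = K (resolvent 1 A (fst (z n)) - fst (z n))" for n
    proof -
      obtain v where v: "z n = (v, K (app A v))" "v \<in> Domain A" using z(1) unfolding core_def by blast
      then show ?thesis
        using K(2)[OF one, of "app A v"] resolvent_app[OF one v(2)] by (simp add: scaleC_one)
    qed
    moreover have "(\<lambda>n. resolvent 1 A (snd (z n))) \<longlonglongrightarrow> resolvent 1 A y"
      by (intro bounded_clinear_tendsto[OF bR] z2)
    moreover have "(\<lambda>n. K (resolvent 1 A (fst (z n)) - fst (z n))) \<longlonglongrightarrow> K (resolvent 1 A x - x)"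
      by (intro bounded_clinear_tendsto[OF K(1)] tendsto_diff bounded_clinear_tendsto[OF bR] z2)
    ultimately show ?thesis using LIMSEQ_unique by simp
  qed
  have inj: "y = y'" if "resolvent 1 A y = resolvent 1 A y'" for y y'
    using resolvent_right[OF one, of y] resolvent_right[OF one, of y'] that by simp
  show sv: "single_valued (om_calc \<phi> A)"
    unfolding calc single_valued_def using det inj by metis
  show "x \<in> Domain (om_calc \<phi> A)" if "x \<in> Domain A"
    using that closure_subset[of core] unfolding calc core_def by blast
  assume x: "x \<in> Domain A"
  then have "(x, K (app A x)) \<in> om_calc \<phi> A"
    using closure_subset[of core] unfolding calc core_def by blast
  then have "app (om_calc \<phi> A) x = K (app A x)" by (rule app_eqI[OF sv])
  then show "has_bochner_int \<mu> (\<lambda>t. app A (resolvent (complex_of_real t) A x)) (app (om_calc \<phi> A) x)"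
    using K(3)[OF x] by simp
qed

lemma diff_ext_eq:
  assumes cl: "closure D = UNIV" and ext: "extends_diff D P Q T"
  shows "diff_ext D P Q = T"
  unfolding diff_ext_def
proof (rule the_equality[of "extends_diff D P Q", OF ext])
  fix S assume S: "extends_diff D P Q S"
  show "S = T"
  proof
    fix x
    have "x \<in> closure D" using cl by simp
    then obtain z where z: "\<forall>n. z n \<in> D" "z \<longlonglongrightarrow> x" unfolding closure_sequential by blast
    have "(\<lambda>n. S (z n)) \<longlonglongrightarrow> S x" "(\<lambda>n. T (z n)) \<longlonglongrightarrow> T x"
      using S ext z(2) by (auto simp: extends_diff_def intro: bounded_clinear_tendsto)
    moreover have "S (z n) = T (z n)" for n using S ext z(1) by (simp add: extends_diff_def)
    ultimately show "S x = T x" using LIMSEQ_unique by simp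
  qed
qed

section \<open>Nuclear perturbations\<close>

text \<open>\<open>T\<close> is the bounded extension of A - B together with a fixed nuclear
  representation, from which the trace function below is formed.\<close>

locale nuclear_perturbation =
  fixes A B :: "'a::complex_banach operator" and T :: "'a \<Rightarrow> 'a"
    and f :: "nat \<Rightarrow> 'a \<Rightarrow> complex" and x :: "nat \<Rightarrow> 'a"
  assumes ap: "approximation_property TYPE('a)" and A: "A \<in> NP" and B: "B \<in> NP"
    and dom: "Domain A \<subseteq> Domain B" and T: "\<And>v. v \<in> Domain A \<Longrightarrow> T v = app A v - app B v"
    and rep: "nuclear_rep T f x"
begin

text \<open>The trace of \<open>R(z,B) T R(z,A) = R(z,A) - R(z,B)\<close>.\<close>

definition tr_diff :: "complex \<Rightarrow> complex" where
  "tr_diff z = (\<Sum>n. f n (resolvent z A (resolvent z B (x n))))"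

lemma f: "bounded_clinear (f n)"
  and f_summable: "summable (\<lambda>n. onorm (f n) * norm (x n))"
  and T_sums: "(\<lambda>n. f n v *\<^sub>C x n) sums T v"
  using rep by (auto simp: nuclear_rep_def)

lemma tr_diff_summable:
  assumes "z \<in> resolvent_set A" "z \<in> resolvent_set B"
  shows "summable (\<lambda>n. f n (resolvent z A (resolvent z B (x n))))"
proof (rule summable_comparison_test'[OF summable_mult[OF f_summable, of "onorm (resolvent z A) * onorm (resolvent z B)"], of 0])
  fix n
  note RA = bounded_clinear_resolvent[OF assms(1)] and RB = bounded_clinear_resolvent[OF assms(2)]
  have "norm (f n (resolvent z A (resolvent z B (x n)))) \<le>
      onorm (f n) * (onorm (resolvent z A) * (onorm (resolvent z B) * norm (x n)))"
    by (intro order_trans[OF bounded_clinear_onorm[OF f]] mult_left_mono bounded_clinear_onorm_nonneg f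
        order_trans[OF bounded_clinear_onorm[OF RA]] RA bounded_clinear_onorm[OF RB])
  then show "norm (f n (resolvent z A (resolvent z B (x n)))) \<le>
      onorm (resolvent z A) * onorm (resolvent z B) * (onorm (f n) * norm (x n))"
    by (simp add: ac_simps)
qed

text \<open>An index m stands for the rank one operator v \<mapsto> f n (P i v) P' j (x n), whose
  coefficient is t E i t E' j t. Each resolvent contributes a bound 1/t and the factor t removes one
  of them, which leaves the \<mu>-integrable majorant 1/t. Integrated coefficients then give a
  nuclear representation of the difference.\<close>

lemma om_calc_diff_nuclear:
  assumes om: "om_represents \<mu> \<phi>" and i: "integrable \<mu> (\<lambda>t. 1 / t)"
  obtains D where "extends_diff (Domain A) (om_calc \<phi> A) (om_calc \<phi> B) D" "nuclear D"
    "nuclear_trace D = (\<integral>t. complex_of_real t * tr_diff (complex_of_real t) \<partial>\<mu>)"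
proof -
  note rsA = NP_resolvent_set[OF A] and rsB = NP_resolvent_set[OF B]
  obtain E :: "nat \<Rightarrow> real \<Rightarrow> real" and P p and C :: real
    where E: "\<And>i. E i \<in> borel_measurable borel" and P: "\<And>i. bounded_clinear (P i)" and C: "0 \<le> C"
      and p: "\<And>i. 0 < p i" and Pp: "\<And>i x. norm (P i x) \<le> p i * norm x"
      and R: "\<And>t x. t > 0 \<Longrightarrow> (\<lambda>i. E i t *\<^sub>R P i x) sums resolvent (complex_of_real t) A x"
      and su: "\<And>t. t > 0 \<Longrightarrow> summable (\<lambda>i. \<bar>E i t\<bar> * p i)"
      and le: "\<And>t. t > 0 \<Longrightarrow> (\<Sum>i. \<bar>E i t\<bar> * p i) \<le> C / t"
      and Eb: "\<And>i t. t > 0 \<Longrightarrow> \<bar>E i t\<bar> \<le> C / p i / t"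
    by (rule resolvent_series[OF A]) (rule that)
  obtain E' :: "nat \<Rightarrow> real \<Rightarrow> real" and P' p' and C' :: real
    where E': "\<And>i. E' i \<in> borel_measurable borel" and P': "\<And>i. bounded_clinear (P' i)" and C': "0 \<le> C'"
      and p': "\<And>i. 0 < p' i" and Pp': "\<And>i x. norm (P' i x) \<le> p' i * norm x"
      and R': "\<And>t x. t > 0 \<Longrightarrow> (\<lambda>i. E' i t *\<^sub>R P' i x) sums resolvent (complex_of_real t) B x"
      and su': "\<And>t. t > 0 \<Longrightarrow> summable (\<lambda>i. \<bar>E' i t\<bar> * p' i)"
      and le': "\<And>t. t > 0 \<Longrightarrow> (\<Sum>i. \<bar>E' i t\<bar> * p' i) \<le> C' / t"
      and Eb': "\<And>i t. t > 0 \<Longrightarrow> \<bar>E' i t\<bar> \<le> C' / p' i / t"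
    by (rule resolvent_series[OF B]) (rule that)
  define e where "e m = (fst (prod_decode m), prod_decode (snd (prod_decode m)))" for m
  have e: "bij e"
    by (rule bij_betw_byWitness[where f'="\<lambda>(n, ij). prod_encode (n, prod_encode ij)"]) (auto simp: e_def)
  define n' i' j' where "n' m = fst (e m)" and "i' m = fst (snd (e m))" and "j' m = snd (snd (e m))" for m
  have em: "e m = (n' m, i' m, j' m)" for m by (simp add: n'_def i'_def j'_def)
  define a where "a n = onorm (f n) * norm (x n)" for n
  have a: "0 \<le> a n" "summable a" for n
    using f_summable bounded_clinear_onorm_nonneg[OF f, of n] by (auto simp: a_def[abs_def])
  \<comment> \<open>The real function of t that multiplies the m-th rank one operator;
    \<open>w m\<close> below bounds the norm of that operator.\<close>
  define G where "G m t = t * E (i' m) t * E' (j' m) t" for m t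
  define w where "w m = a (n' m) * (p (i' m) * p' (j' m))" for m
  have w: "0 \<le> w m" for m using a p p' by (simp add: w_def less_imp_le)
  have Gm: "G m \<in> borel_measurable borel" for m
    using E[of "i' m"] E'[of "j' m"] unfolding G_def[abs_def] by measurable
  have Gb: "\<bar>G m t\<bar> \<le> (C / p (i' m) * (C' / p' (j' m))) / t" if t: "t > 0" for m t
  proof -
    have "\<bar>G m t\<bar> = t * (\<bar>E (i' m) t\<bar> * \<bar>E' (j' m) t\<bar>)" using t by (simp add: G_def abs_mult)
    also have "\<dots> \<le> t * (C / p (i' m) / t * (C' / p' (j' m) / t))"
      using t C p[of "i' m"] by (intro mult_left_mono mult_mono Eb Eb') auto
    also have "\<dots> = (C / p (i' m) * (C' / p' (j' m))) / t" using t by simp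
    finally show ?thesis .
  qed
  have Gw: "(\<lambda>m. \<bar>G m t\<bar> * w m) sums (t * suminf a * ((\<Sum>i. \<bar>E i t\<bar> * p i) * (\<Sum>j. \<bar>E' j t\<bar> * p' j)))"
    if t: "t > 0" for t
  proof -
    let ?F = "\<lambda>(n, i, j). t * a n * (\<bar>E i t\<bar> * p i * (\<bar>E' j t\<bar> * p' j))"
    have "(\<lambda>m. ?F (e m)) sums (t * suminf a * ((\<Sum>i. \<bar>E i t\<bar> * p i) * (\<Sum>j. \<bar>E' j t\<bar> * p' j)))"
    proof (rule sums_triple[OF e, where c="\<lambda>n. t * a n" and a="\<lambda>i. \<bar>E i t\<bar> * p i" and b="\<lambda>j. \<bar>E' j t\<bar> * p' j"
          and G="\<lambda>n i. t * a n * (\<bar>E i t\<bar> * p i * (\<Sum>j. \<bar>E' j t\<bar> * p' j))"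
          and H="\<lambda>n. t * a n * ((\<Sum>i. \<bar>E i t\<bar> * p i) * (\<Sum>j. \<bar>E' j t\<bar> * p' j))"])
      show "(\<lambda>n. t * a n * ((\<Sum>i. \<bar>E i t\<bar> * p i) * (\<Sum>j. \<bar>E' j t\<bar> * p' j))) sums
          (t * suminf a * ((\<Sum>i. \<bar>E i t\<bar> * p i) * (\<Sum>j. \<bar>E' j t\<bar> * p' j)))"
        by (intro sums_mult2 sums_mult summable_sums a)
      show "(\<lambda>i. t * a n * (\<bar>E i t\<bar> * p i * (\<Sum>j. \<bar>E' j t\<bar> * p' j))) sums
          (t * a n * ((\<Sum>i. \<bar>E i t\<bar> * p i) * (\<Sum>j. \<bar>E' j t\<bar> * p' j)))" for n
        by (intro sums_mult2 sums_mult summable_sums su t)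
      show "(\<lambda>j. case (n, i, j) of (n, i, j) \<Rightarrow> t * a n * (\<bar>E i t\<bar> * p i * (\<bar>E' j t\<bar> * p' j))) sums
          (t * a n * (\<bar>E i t\<bar> * p i * (\<Sum>j. \<bar>E' j t\<bar> * p' j)))" for n i
        unfolding prod.case by (intro sums_mult summable_sums su' t)
    qed (use a p p' t su[OF t] su'[OF t] in \<open>auto simp: abs_mult less_imp_le intro: summable_mult\<close>)
    moreover have "?F (e m) = \<bar>G m t\<bar> * w m" for m
      using t by (simp add: em G_def w_def abs_mult)
    ultimately show ?thesis by simp
  qed
  have Gle: "(\<Sum>m. \<bar>G m t\<bar> * w m) \<le> (suminf a * C * C') / t" if t: "t > 0" for t
  proof -
    have "(\<Sum>m. \<bar>G m t\<bar> * w m) = t * suminf a * ((\<Sum>i. \<bar>E i t\<bar> * p i) * (\<Sum>j. \<bar>E' j t\<bar> * p' j))"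
      using Gw[OF t] by (simp add: sums_iff)
    also have "\<dots> \<le> t * suminf a * (C / t * (C' / t))"
      using t C a p p' su[OF t] su'[OF t]
      by (intro mult_left_mono mult_mono le le' mult_nonneg_nonneg suminf_nonneg) (auto simp: less_imp_le)
    also have "\<dots> = (suminf a * C * C') / t" using t by simp
    finally show ?thesis .
  qed
  note int = weighted_series_integrable[OF om i Gm Gb w sums_summable[OF Gw] Gle]
  define k where "k m = integral\<^sup>L \<mu> (G m)" for m
  have k: "\<bar>k m\<bar> \<le> (\<integral>t. \<bar>G m t\<bar> \<partial>\<mu>)" for m unfolding k_def by (rule integral_abs_bound)
  have kw: "summable (\<lambda>m. \<bar>k m\<bar> * w m)"
    by (rule summable_comparison_test'[OF int(2), of 0]) (use k w in \<open>auto simp: abs_mult intro: mult_right_mono\<close>)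
  define h where "h m v = complex_of_real (k m) *\<^sub>C f (n' m) (P (i' m) v)" for m v
  define y where "y m = P' (j' m) (x (n' m))" for m
  have fP: "cmod (f n (P i v)) \<le> onorm (f n) * (p i * norm v)" for n i v
    by (intro order_trans[OF bounded_clinear_onorm[OF f]] mult_left_mono Pp bounded_clinear_onorm_nonneg f)
  have yw: "onorm (f (n' m)) * p (i' m) * norm (y m) \<le> w m" for m
  proof -
    have "onorm (f (n' m)) * p (i' m) * norm (y m) \<le> onorm (f (n' m)) * p (i' m) * (p' (j' m) * norm (x (n' m)))"
      unfolding y_def using p by (intro mult_left_mono Pp' mult_nonneg_nonneg bounded_clinear_onorm_nonneg f) (simp add: less_imp_le)
    then show ?thesis by (simp add: w_def a_def ac_simps)
  qed
  have hv: "summable (\<lambda>m. h m v *\<^sub>C y m)" for v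
  proof (rule summable_comparison_test'[OF summable_mult2[OF kw, of "norm v"], of 0])
    fix m
    have "norm (h m v *\<^sub>C y m) = \<bar>k m\<bar> * (cmod (f (n' m) (P (i' m) v)) * norm (y m))"
      by (simp add: h_def norm_scaleC)
    also have "\<dots> \<le> \<bar>k m\<bar> * (onorm (f (n' m)) * (p (i' m) * norm v) * norm (y m))"
      by (intro mult_left_mono mult_right_mono fP) auto
    also have "\<dots> = \<bar>k m\<bar> * (onorm (f (n' m)) * p (i' m) * norm (y m)) * norm v" by (simp add: ac_simps)
    also have "\<dots> \<le> \<bar>k m\<bar> * w m * norm v" by (intro mult_left_mono mult_right_mono yw) auto
    finally show "norm (h m v *\<^sub>C y m) \<le> \<bar>k m\<bar> * w m * norm v" .
  qed
  define D where "D v = (\<Sum>m. h m v *\<^sub>C y m)" for v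
  have Drep: "nuclear_rep D h y"
  proof (rule nuclear_repI)
    show "bounded_clinear (h m)" for m
      unfolding h_def[abs_def] by (intro bounded_clinear_const_scaleC bounded_clinear_compose[OF f P])
    show "cmod (h m v) \<le> \<bar>k m\<bar> * (onorm (f (n' m)) * p (i' m)) * norm v" for m v
      using mult_left_mono[OF fP[of "n' m" "i' m" v], of "\<bar>k m\<bar>"]
      by (simp add: h_def norm_scaleC ac_simps)
    show "0 \<le> \<bar>k m\<bar> * (onorm (f (n' m)) * p (i' m))" for m
      using p[of "i' m"] bounded_clinear_onorm_nonneg[OF f, of "n' m"] by simp
    show "summable (\<lambda>m. \<bar>k m\<bar> * (onorm (f (n' m)) * p (i' m)) * norm (y m))"
    proof (rule summable_comparison_test'[OF kw, of 0])
      fix m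
      show "norm (\<bar>k m\<bar> * (onorm (f (n' m)) * p (i' m)) * norm (y m)) \<le> \<bar>k m\<bar> * w m"
        using mult_left_mono[OF yw[of m], of "\<bar>k m\<bar>"] p[of "i' m"] bounded_clinear_onorm_nonneg[OF f, of "n' m"]
        by (simp add: abs_mult mult.assoc)
    qed
    show "(\<lambda>m. h m v *\<^sub>C y m) sums D v" for v unfolding D_def by (rule summable_sums[OF hv])
  qed
  have Dext: "D v = app (om_calc \<phi> A) v - app (om_calc \<phi> B) v" if v: "v \<in> Domain A" for v
  proof -
    let ?RA = "\<lambda>t. resolvent (complex_of_real t) A" and ?RB = "\<lambda>t. resolvent (complex_of_real t) B"
    let ?g = "\<lambda>t. app A (?RA t v) - app B (?RB t v)"
    have eq: "?g t = complex_of_real t *\<^sub>C ?RB t (T (?RA t v))" if "t > 0" for t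
      using resolvent_diff[OF rsA[OF that] rsB[OF that] NP_linear_operator[OF B] dom T, of v]
      by (simp add: app_resolvent[OF rsA[OF that]] app_resolvent[OF rsB[OF that]]
          flip: complex_vector.scale_right_diff_distrib)
    \<comment> \<open>This form is continuous in t and yields measurability; the form
      \<open>eq\<close> is the one that is expanded into the series.\<close>
    have eq2: "?g t = complex_of_real t *\<^sub>C (?RA t v - ?RB t v)" if "t > 0" for t
      by (simp add: app_resolvent[OF rsA[OF that]] app_resolvent[OF rsB[OF that]]
          complex_vector.scale_right_diff_distrib)
    have "(\<lambda>t. complex_of_real t *\<^sub>C (?RA t v - ?RB t v)) \<in> borel_measurable \<mu>"
    proof (rule measurable_of_isCont[OF om, of "\<lambda>z. z *\<^sub>C (resolvent z A v - resolvent z B v)"])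
      fix t :: real assume t: "t > 0"
      show "isCont (\<lambda>z. z *\<^sub>C (resolvent z A v - resolvent z B v)) (complex_of_real t)"
        by (intro bounded_bilinear.continuous[OF bounded_bilinear_scaleC] continuous_diff continuous_ident
            isCont_resolvent[OF NP_linear_operator[OF A] rsA[OF t]]
            isCont_resolvent[OF NP_linear_operator[OF B] rsB[OF t]] continuous_const)
    qed
    then have m: "?g \<in> borel_measurable \<mu>"
      by (rule measurable_cong[THEN iffD1, rotated]) (simp add: eq2 om_represents_space[OF om])
    have v': "v \<in> Domain B" using v dom by auto
    have 1: "has_bochner_int \<mu> ?g (app (om_calc \<phi> A) v - app (om_calc \<phi> B) v)"
      by (rule has_bochner_int_diff[OF om_calc_NP(3)[OF A om i v] om_calc_NP(3)[OF B om i v'] m])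
    \<comment> \<open>The same integral, evaluated a second time from the triple series; uniqueness
      of its value identifies \<open>D v\<close>.\<close>
    have 2: "has_bochner_int \<mu> ?g (\<Sum>m. integral\<^sup>L \<mu> (G m) *\<^sub>R (f (n' m) (P (i' m) v) *\<^sub>C y m))"
    proof (rule has_bochner_int_series[OF m int(1)])
      fix t assume "t \<in> space \<mu>"
      then have t: "t > 0" by (simp add: om_represents_space[OF om])
      let ?F = "\<lambda>(n, i, j). (t * E i t * E' j t) *\<^sub>R (f n (P i v) *\<^sub>C P' j (x n))"
      have "(\<lambda>m. ?F (e m)) sums (complex_of_real t *\<^sub>C ?RB t (T (?RA t v)))"
      proof (rule sums_triple[OF e, where c="\<lambda>n. t * norm v * a n" and a="\<lambda>i. \<bar>E i t\<bar> * p i" and b="\<lambda>j. \<bar>E' j t\<bar> * p' j"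
          and G="\<lambda>n i. complex_of_real t *\<^sub>C (f n (E i t *\<^sub>R P i v) *\<^sub>C ?RB t (x n))"
          and H="\<lambda>n. complex_of_real t *\<^sub>C (f n (?RA t v) *\<^sub>C ?RB t (x n))"])
        show "norm (?F (n, i, j)) \<le> t * norm v * a n * (\<bar>E i t\<bar> * p i * (\<bar>E' j t\<bar> * p' j))" for n i j
        proof -
          have "norm (?F (n, i, j)) = t * \<bar>E i t\<bar> * \<bar>E' j t\<bar> * (cmod (f n (P i v)) * norm (P' j (x n)))"
            using t by (simp add: norm_scaleC abs_mult)
          also have "\<dots> \<le> t * \<bar>E i t\<bar> * \<bar>E' j t\<bar> * (onorm (f n) * (p i * norm v) * (p' j * norm (x n)))"
            using t p[of i] bounded_clinear_onorm_nonneg[OF f, of n]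
            by (intro mult_left_mono mult_mono fP Pp') auto
          finally show ?thesis by (simp add: a_def ac_simps)
        qed
        show "(\<lambda>j. case (n, i, j) of (n, i, j) \<Rightarrow> (t * E i t * E' j t) *\<^sub>R (f n (P i v) *\<^sub>C P' j (x n))) sums
            (complex_of_real t *\<^sub>C (f n (E i t *\<^sub>R P i v) *\<^sub>C ?RB t (x n)))" for n i
        proof -
          have "(\<lambda>j. complex_of_real t *\<^sub>C (f n (E i t *\<^sub>R P i v) *\<^sub>C (E' j t *\<^sub>R P' j (x n)))) sums
            (complex_of_real t *\<^sub>C (f n (E i t *\<^sub>R P i v) *\<^sub>C ?RB t (x n)))"
            by (intro bounded_clinear_sums[OF bounded_clinear_const_scaleC[OF bounded_clinear_const_scaleC[OF bounded_clinear_ident]]] R' t)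
          moreover have "f n (E i t *\<^sub>R P i v) = complex_of_real (E i t) * f n (P i v)"
            by (simp only: bounded_clinear_scaleR[OF f] scaleR_conv_of_real)
          ultimately show ?thesis
            by (simp only: scaleR_scaleC[where 'a='a] complex_vector.scale_scale of_real_mult prod.case ac_simps)
        qed
        show "(\<lambda>i. complex_of_real t *\<^sub>C (f n (E i t *\<^sub>R P i v) *\<^sub>C ?RB t (x n))) sums
            (complex_of_real t *\<^sub>C (f n (?RA t v) *\<^sub>C ?RB t (x n)))" for n
          by (intro bounded_clinear_sums[OF bounded_clinear_const_scaleC[OF bounded_clinear_scaleC_const[OF f]]] R t)
        have "(\<lambda>n. complex_of_real t *\<^sub>C ?RB t (f n (?RA t v) *\<^sub>C x n)) sums (complex_of_real t *\<^sub>C ?RB t (T (?RA t v)))"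
          by (intro bounded_clinear_sums[OF bounded_clinear_const_scaleC[OF bounded_clinear_resolvent[OF rsB[OF t]]]] T_sums)
        then show "(\<lambda>n. complex_of_real t *\<^sub>C (f n (?RA t v) *\<^sub>C ?RB t (x n))) sums (complex_of_real t *\<^sub>C ?RB t (T (?RA t v)))"
          by (simp add: bounded_clinear_scaleC[OF bounded_clinear_resolvent[OF rsB[OF t]]])
      qed (use a p p' t su[OF t] su'[OF t] in \<open>auto simp: less_imp_le intro: summable_mult\<close>)
      then show "(\<lambda>m. G m t *\<^sub>R (f (n' m) (P (i' m) v) *\<^sub>C y m)) sums ?g t"
        by (simp add: em G_def y_def eq[OF t])
    next
      show "summable (\<lambda>m. (\<integral>t. \<bar>G m t\<bar> \<partial>\<mu>) * norm (f (n' m) (P (i' m) v) *\<^sub>C y m))"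
      proof (rule summable_comparison_test'[OF summable_mult2[OF int(2), of "norm v"], of 0])
        fix m
        have nn: "0 \<le> (\<integral>t. \<bar>G m t\<bar> \<partial>\<mu>)" by (rule integral_nonneg_AE) simp
        have "norm (f (n' m) (P (i' m) v) *\<^sub>C y m) \<le> onorm (f (n' m)) * (p (i' m) * norm v) * norm (y m)"
          unfolding norm_scaleC by (intro mult_right_mono fP) auto
        also have "\<dots> = onorm (f (n' m)) * p (i' m) * norm (y m) * norm v" by (simp add: ac_simps)
        also have "\<dots> \<le> w m * norm v" by (intro mult_right_mono yw) auto
        finally show "norm ((\<integral>t. \<bar>G m t\<bar> \<partial>\<mu>) * norm (f (n' m) (P (i' m) v) *\<^sub>C y m)) \<le>
            (\<integral>t. \<bar>G m t\<bar> \<partial>\<mu>) * w m * norm v"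
          using nn by (simp add: abs_mult mult.assoc mult_left_mono)
      qed
    qed
    have "(\<Sum>m. integral\<^sup>L \<mu> (G m) *\<^sub>R (f (n' m) (P (i' m) v) *\<^sub>C y m)) = D v"
      unfolding D_def h_def k_def by (simp add: scaleR_scaleC scaleC_complex_def)
    then show ?thesis using has_bochner_int_unique[OF 1 2] by simp
  qed
  \<comment> \<open>The trace of a rank one term is its functional at its vector. Exchanging sum and
    integral reduces the claim to a fixed t, where the separated series are summed back into the
    resolvents.\<close>
  have Dtr: "(\<Sum>m. h m (y m)) = (\<integral>t. complex_of_real t * tr_diff (complex_of_real t) \<partial>\<mu>)"
  proof -
    define W where "W m = f (n' m) (P (i' m) (y m))" for m
    have Ww: "norm (W m) \<le> w m" for m
      using fP[of "n' m" "i' m" "y m"] yw[of m] by (simp add: W_def mult.assoc)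
    have "(\<lambda>m. \<integral>t. G m t *\<^sub>R W m \<partial>\<mu>) sums (\<integral>t. (\<Sum>m. G m t *\<^sub>R W m) \<partial>\<mu>)"
    proof (rule sums_integral)
      show "integrable \<mu> (\<lambda>t. G m t *\<^sub>R W m)" for m by (intro integrable_scaleR_left int)
      show "AE t in \<mu>. summable (\<lambda>m. norm (G m t *\<^sub>R W m))"
      proof (rule AE_I2)
        fix t assume "t \<in> space \<mu>"
        then have t: "t > 0" by (simp add: om_represents_space[OF om])
        show "summable (\<lambda>m. norm (G m t *\<^sub>R W m))"
          by (rule summable_comparison_test'[OF sums_summable[OF Gw[OF t]], of 0]) (use Ww in \<open>simp add: mult_left_mono\<close>)
      qed
      show "summable (\<lambda>m. \<integral>t. norm (G m t *\<^sub>R W m) \<partial>\<mu>)"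
      proof (rule summable_comparison_test'[OF int(2), of 0])
        fix m
        have nn: "0 \<le> (\<integral>t. \<bar>G m t\<bar> \<partial>\<mu>)" by (rule integral_nonneg_AE) simp
        have "(\<integral>t. norm (G m t *\<^sub>R W m) \<partial>\<mu>) = (\<integral>t. \<bar>G m t\<bar> \<partial>\<mu>) * norm (W m)"
          by (simp only: norm_scaleR integral_mult_left_zero)
        then show "norm (\<integral>t. norm (G m t *\<^sub>R W m) \<partial>\<mu>) \<le> (\<integral>t. \<bar>G m t\<bar> \<partial>\<mu>) * w m"
          using nn Ww[of m] by (simp add: mult_left_mono abs_mult)
      qed
    qed
    also have "(\<integral>t. (\<Sum>m. G m t *\<^sub>R W m) \<partial>\<mu>) = (\<integral>t. complex_of_real t * tr_diff (complex_of_real t) \<partial>\<mu>)"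
    proof (rule Bochner_Integration.integral_cong[OF refl])
      fix t assume "t \<in> space \<mu>"
      then have t: "t > 0" by (simp add: om_represents_space[OF om])
      let ?RA = "resolvent (complex_of_real t) A" and ?RB = "resolvent (complex_of_real t) B"
      let ?F = "\<lambda>(n, i, j). (t * E i t * E' j t) *\<^sub>R f n (P i (P' j (x n)))"
      have "(\<lambda>m. ?F (e m)) sums (complex_of_real t * tr_diff (complex_of_real t))"
      proof (rule sums_triple[OF e, where c="\<lambda>n. t * a n" and a="\<lambda>i. \<bar>E i t\<bar> * p i" and b="\<lambda>j. \<bar>E' j t\<bar> * p' j"
          and G="\<lambda>n i. t *\<^sub>R f n (E i t *\<^sub>R P i (?RB (x n)))"
          and H="\<lambda>n. t *\<^sub>R f n (?RA (?RB (x n)))"])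
        show "norm (?F (n, i, j)) \<le> t * a n * (\<bar>E i t\<bar> * p i * (\<bar>E' j t\<bar> * p' j))" for n i j
        proof -
          have "norm (?F (n, i, j)) = t * \<bar>E i t\<bar> * \<bar>E' j t\<bar> * cmod (f n (P i (P' j (x n))))"
            using t by (simp add: abs_mult)
          also have "\<dots> \<le> t * \<bar>E i t\<bar> * \<bar>E' j t\<bar> * (onorm (f n) * (p i * (p' j * norm (x n))))"
            using t p[of i] bounded_clinear_onorm_nonneg[OF f, of n]
            by (intro mult_left_mono order_trans[OF fP] Pp') auto
          finally show ?thesis by (simp add: a_def ac_simps)
        qed
        show "(\<lambda>j. case (n, i, j) of (n, i, j) \<Rightarrow> (t * E i t * E' j t) *\<^sub>R f n (P i (P' j (x n)))) sums
            (t *\<^sub>R f n (E i t *\<^sub>R P i (?RB (x n))))" for n i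
        proof -
          have "(\<lambda>j. t *\<^sub>R f n (E i t *\<^sub>R P i (E' j t *\<^sub>R P' j (x n)))) sums (t *\<^sub>R f n (E i t *\<^sub>R P i (?RB (x n))))"
            by (intro sums_scaleR_right bounded_clinear_sums[OF f] bounded_clinear_sums[OF P] R' t)
          then show ?thesis
            by (simp add: bounded_clinear_scaleR[OF f] bounded_clinear_scaleR[OF P] ac_simps)
        qed
        show "(\<lambda>i. t *\<^sub>R f n (E i t *\<^sub>R P i (?RB (x n)))) sums (t *\<^sub>R f n (?RA (?RB (x n))))" for n
          by (intro sums_scaleR_right bounded_clinear_sums[OF f] R t)
        show "(\<lambda>n. t *\<^sub>R f n (?RA (?RB (x n)))) sums (complex_of_real t * tr_diff (complex_of_real t))"
          unfolding tr_diff_def scaleR_conv_of_real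
          by (intro sums_mult summable_sums tr_diff_summable rsA rsB t)
      qed (use a p p' t su[OF t] su'[OF t] in \<open>auto simp: less_imp_le intro: summable_mult\<close>)
      then show "(\<Sum>m. G m t *\<^sub>R W m) = complex_of_real t * tr_diff (complex_of_real t)"
        by (simp add: em G_def W_def y_def sums_iff)
    qed
    finally have "(\<lambda>m. \<integral>t. G m t *\<^sub>R W m \<partial>\<mu>) sums (\<integral>t. complex_of_real t * tr_diff (complex_of_real t) \<partial>\<mu>)" .
    moreover have "(\<integral>t. G m t *\<^sub>R W m \<partial>\<mu>) = h m (y m)" for m
      using int(1)[of m] by (simp add: h_def W_def k_def scaleC_complex_def scaleR_conv_of_real)
    ultimately show ?thesis by (simp add: sums_iff)
  qed
  show thesis
  proof (rule that[of D])
    have "bounded_clinear D" by (rule nuclear_rep_bounded_clinear[OF Drep])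
    then show "extends_diff (Domain A) (om_calc \<phi> A) (om_calc \<phi> B) D"
      unfolding extends_diff_def using Dext dom om_calc_NP(2)[OF A om i] om_calc_NP(2)[OF B om i] by blast
    show "nuclear D" using Drep by (auto simp: nuclear_def)
    show "nuclear_trace D = (\<integral>t. complex_of_real t * tr_diff (complex_of_real t) \<partial>\<mu>)"
      using nuclear_trace_eq[OF ap Drep] Dtr by simp
  qed
qed

end

section \<open>The spectral shift function on a cone\<close>

text \<open>For c > 0 this is the sector of half-angle arctan c, written without the argument
  function so that openness and convexity are evident.\<close>

definition acute_cone :: "real \<Rightarrow> complex set" where
  "acute_cone c = {z. \<bar>Im z\<bar> < c * Re z}"

lemma acute_cone_Re_pos: "z \<in> acute_cone c \<Longrightarrow> 0 < c \<Longrightarrow> 0 < Re z"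
  by (auto simp: acute_cone_def dest!: le_less_trans[OF abs_ge_zero] simp: zero_less_mult_iff)

lemma of_real_in_acute_cone: "0 < c \<Longrightarrow> 0 < t \<Longrightarrow> complex_of_real t \<in> acute_cone c"
  by (simp add: acute_cone_def)

lemma acute_cone_add_of_real: "z \<in> acute_cone c \<Longrightarrow> 0 < c \<Longrightarrow> 0 \<le> s \<Longrightarrow> z + complex_of_real s \<in> acute_cone c"
  by (auto simp: acute_cone_def algebra_simps intro: less_le_trans)

lemma open_acute_cone: "open (acute_cone c)"
  unfolding acute_cone_def by (intro open_Collect_less continuous_intros)

lemma convex_acute_cone: "convex (acute_cone c)"
proof (rule convexI)
  fix z w :: complex and u v :: real
  assume zw: "z \<in> acute_cone c" "w \<in> acute_cone c" and uv: "0 \<le> u" "0 \<le> v" "u + v = 1"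
  have "\<bar>Im (u *\<^sub>R z + v *\<^sub>R w)\<bar> \<le> u * \<bar>Im z\<bar> + v * \<bar>Im w\<bar>"
    using uv abs_triangle_ineq[of "u * Im z" "v * Im w"] by (simp add: abs_mult)
  also have "\<dots> < u * (c * Re z) + v * (c * Re w)"
  proof (cases "u = 0")
    case True
    then show ?thesis using uv zw by (simp add: acute_cone_def)
  next
    case False
    then show ?thesis using uv zw by (intro add_less_le_mono mult_strict_left_mono mult_left_mono) (auto simp: acute_cone_def)
  qed
  finally show "u *\<^sub>R z + v *\<^sub>R w \<in> acute_cone c" by (simp add: acute_cone_def algebra_simps)
qed

text \<open>A primitive exists because the cone is convex. As K/(Re z)^2 is integrable towards
  infinity, the primitive has a limit L along the axis, and g - L is the one that vanishes
  there.\<close>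

lemma cone_primitive:
  fixes \<tau> :: "complex \<Rightarrow> complex"
  assumes c: "0 < c" and hol: "\<tau> holomorphic_on acute_cone c"
    and bd: "\<And>z. z \<in> acute_cone c \<Longrightarrow> cmod (\<tau> z) \<le> K / (Re z)\<^sup>2"
  obtains \<xi> where "\<And>z. z \<in> acute_cone c \<Longrightarrow> (\<xi> has_field_derivative \<tau> z) (at z)"
    "\<And>z. z \<in> acute_cone c \<Longrightarrow> cmod (\<xi> z) \<le> K / Re z"
    "\<And>l. 0 < l \<Longrightarrow> \<xi> (complex_of_real l) = - (LINT t:{l<..}|lborel. \<tau> (complex_of_real t))"
proof -
  note pos = acute_cone_Re_pos[OF _ c]
  obtain g where "\<And>z. z \<in> acute_cone c \<Longrightarrow> (g has_field_derivative \<tau> z) (at z within acute_cone c)"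
    using holomorphic_convex_primitive'[OF convex_acute_cone open_acute_cone hol] by blast
  then have g: "(g has_field_derivative \<tau> z) (at z)" if "z \<in> acute_cone c" for z
    using that at_within_open[OF that open_acute_cone] by metis
  have K: "K \<ge> 0"
    using order_trans[OF norm_ge_zero bd[OF of_real_in_acute_cone[OF c zero_less_one]]] by simp
  \<comment> \<open>The bound of the derivative has the primitive -K/(Re z + r), whose increments
    from s onwards are at most K/(Re z + s).\<close>
  have horiz: "cmod (g (z + complex_of_real s') - g (z + complex_of_real s)) \<le> K / (Re z + s)"
    if z: "z \<in> acute_cone c" and s: "0 \<le> s" "s \<le> s'" for z s s'
  proof (cases "s = s'")
    case True
    then show ?thesis using K pos[OF z] s by simp
  next
    case False
    have inc: "z + complex_of_real r \<in> acute_cone c" if "0 \<le> r" for r by (rule acute_cone_add_of_real[OF z c that])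
    have gd: "((\<lambda>r. g (z + complex_of_real r)) has_vector_derivative \<tau> (z + complex_of_real r)) (at r)" if "0 \<le> r" for r
    proof -
      have "((\<lambda>w. g (z + w)) has_field_derivative \<tau> (z + complex_of_real r)) (at (complex_of_real r))"
      proof -
        have "((\<lambda>w. z + w) has_field_derivative 1) (at (complex_of_real r))"
          by (auto intro!: derivative_eq_intros)
        from DERIV_chain2[OF g[OF inc[OF that]] this] show ?thesis by simp
      qed
      then show ?thesis by (rule has_vector_derivative_real_field)
    qed
    have hd: "((\<lambda>r. - K / (Re z + r)) has_vector_derivative K / (Re z + r)\<^sup>2) (at r)" if "0 \<le> r" for r
      unfolding has_real_derivative_iff_has_vector_derivative[symmetric]
      using pos[OF z] that by (auto intro!: derivative_eq_intros simp: power2_eq_square)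
    have "cmod (g (z + complex_of_real s') - g (z + complex_of_real s)) \<le> - K / (Re z + s') - (- K / (Re z + s))"
    proof (rule differentiable_bound_general[where \<phi>'="\<lambda>r. K / (Re z + r)\<^sup>2" and f'="\<lambda>r. \<tau> (z + complex_of_real r)"])
      show "s < s'" using False s by simp
      show "continuous_on {s..s'} (\<lambda>r. g (z + complex_of_real r))"
        using has_vector_derivative_continuous[OF gd] s by (intro continuous_at_imp_continuous_on) auto
      show "continuous_on {s..s'} (\<lambda>r. - K / (Re z + r))"
        using has_vector_derivative_continuous[OF hd] s by (intro continuous_at_imp_continuous_on) auto
      show "cmod (\<tau> (z + complex_of_real r)) \<le> K / (Re z + r)\<^sup>2" if "s < r" "r < s'" for r
        using bd[OF inc[of r]] that s by simp
    qed (use gd hd s in auto)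
    also have "\<dots> \<le> K / (Re z + s)" using K pos[OF z] s by simp
    finally show ?thesis .
  qed
  have one: "1 \<in> acute_cone c" using of_real_in_acute_cone[OF c, of 1] by simp
  have "Cauchy (\<lambda>n. g (1 + complex_of_real (real n)))"
  proof (rule CauchyI')
    fix e :: real assume e: "e > 0"
    obtain N :: nat where N: "K / e < real N" using reals_Archimedean2 by blast
    have "dist (g (1 + complex_of_real (real m))) (g (1 + complex_of_real (real n))) < e" if "N \<le> m" "m < n" for m n
    proof -
      have "K / e < 1 + real m" using N that by linarith
      then have "K / (1 + real m) < e" using e by (simp add: field_simps)
      then show ?thesis using horiz[OF one, of "real m" "real n"] that by (simp add: dist_norm norm_minus_commute)
    qed
    then show "\<exists>M. \<forall>m\<ge>M. \<forall>n>m. dist (g (1 + complex_of_real (real m))) (g (1 + complex_of_real (real n))) < e"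
      by blast
  qed
  then obtain L where L: "(\<lambda>n. g (1 + complex_of_real (real n))) \<longlonglongrightarrow> L"
    using Cauchy_convergent convergent_def by blast
  have real_bd: "cmod (g (complex_of_real s) - L) \<le> K / s" if s: "0 < s" for s
  proof (rule Lim_norm_ubound[OF _ tendsto_diff[OF tendsto_const L]])
    show "\<forall>\<^sub>F n in sequentially. cmod (g (complex_of_real s) - g (1 + complex_of_real (real n))) \<le> K / s"
      using eventually_ge_at_top[of "nat \<lceil>s\<rceil>"]
    proof eventually_elim
      case (elim n)
      then have "s \<le> 1 + real n" by linarith
      then show ?case using horiz[OF of_real_in_acute_cone[OF c s], of 0 "1 + real n - s"]
        by (simp add: norm_minus_commute)
    qed
  qed simp
  have lim: "((\<lambda>t. g (complex_of_real t) - L) \<longlongrightarrow> 0) at_top"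
  proof (rule Lim_null_comparison)
    show "\<forall>\<^sub>F t in at_top. cmod (g (complex_of_real t) - L) \<le> K / t"
      using eventually_gt_at_top[of 0] by eventually_elim (rule real_bd)
    show "((\<lambda>t. K / t) \<longlongrightarrow> 0) at_top" by real_asymp
  qed
  show thesis
  proof (rule that[of "\<lambda>z. g z - L"])
    show "((\<lambda>z. g z - L) has_field_derivative \<tau> z) (at z)" if "z \<in> acute_cone c" for z
      using g[OF that] by (auto intro!: derivative_eq_intros)
    show "cmod (g z - L) \<le> K / Re z" if z: "z \<in> acute_cone c" for z
    \<comment> \<open>The way from z to infinity runs horizontally to z + s, vertically to the axis
      and then along the axis. The last two parts cost K |Im z|/(Re z + s)^2 and K/(Re z + s), which
      vanish as s grows.\<close>
    proof (rule tendsto_lowerbound)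
      have vert: "cmod (g (z + complex_of_real s) - g (complex_of_real (Re z + s))) \<le> K / (Re z + s)\<^sup>2 * \<bar>Im z\<bar>" if s: "0 \<le> s" for s
      proof -
        let ?S = "closed_segment (complex_of_real (Re z + s)) (z + complex_of_real s)"
        have S: "?S \<subseteq> acute_cone c"
          using pos[OF z] s by (intro closed_segment_subset convex_acute_cone of_real_in_acute_cone c acute_cone_add_of_real z) auto
        have "cmod (g (z + complex_of_real s) - g (complex_of_real (Re z + s))) \<le>
            K / (Re z + s)\<^sup>2 * cmod (z + complex_of_real s - complex_of_real (Re z + s))"
        proof (rule field_differentiable_bound[of ?S])
          fix w assume w: "w \<in> ?S"
          then have "w \<in> acute_cone c" using S by blast
          then show "(g has_field_derivative \<tau> w) (at w within ?S)" by (rule has_field_derivative_at_within[OF g])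
          obtain r where "w = (1 - r) *\<^sub>R complex_of_real (Re z + s) + r *\<^sub>R (z + complex_of_real s)"
            using w by (auto simp: in_segment)
          then have "Re w = (1 - r) * (Re z + s) + r * (Re z + s)" by simp
          then have "Re w = Re z + s" by (simp add: algebra_simps)
          then show "cmod (\<tau> w) \<le> K / (Re z + s)\<^sup>2" using bd[OF \<open>w \<in> acute_cone c\<close>] by simp
        qed auto
        also have "z + complex_of_real s - complex_of_real (Re z + s) = complex_of_real (Im z) * \<i>"
          by (simp add: complex_eq_iff)
        finally show ?thesis by (simp add: norm_mult)
      qed
      show "((\<lambda>s. K / Re z + K / (Re z + s)\<^sup>2 * \<bar>Im z\<bar> + K / (Re z + s)) \<longlongrightarrow> K / Re z) at_top"
      proof -
        have "((\<lambda>s. K / Re z + K / (Re z + s)\<^sup>2 * \<bar>Im z\<bar> + K / (Re z + s)) \<longlongrightarrow> K / Re z + 0 * \<bar>Im z\<bar> + 0) at_top"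
          by (intro tendsto_intros) real_asymp+
        then show ?thesis by simp
      qed
      show "\<forall>\<^sub>F s in at_top. cmod (g z - L) \<le> K / Re z + K / (Re z + s)\<^sup>2 * \<bar>Im z\<bar> + K / (Re z + s)"
        using eventually_ge_at_top[of 0]
      proof eventually_elim
        case (elim s)
        have "g z - L = (g z - g (z + complex_of_real s)) + (g (z + complex_of_real s) - g (complex_of_real (Re z + s)))
            + (g (complex_of_real (Re z + s)) - L)" by simp
        also have "cmod \<dots> \<le> cmod (g z - g (z + complex_of_real s)) +
            cmod (g (z + complex_of_real s) - g (complex_of_real (Re z + s))) + cmod (g (complex_of_real (Re z + s)) - L)"
          by (intro norm_triangle_le add_mono norm_triangle_ineq order_refl)
        also have "\<dots> \<le> K / Re z + K / (Re z + s)\<^sup>2 * \<bar>Im z\<bar> + K / (Re z + s)"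
          using horiz[OF z order_refl elim] vert[OF elim] real_bd[of "Re z + s"] pos[OF z] elim
          by (intro add_mono) (simp_all add: norm_minus_commute)
        finally show ?case .
      qed
    qed simp
    show "g (complex_of_real l) - L = - (LINT t:{l<..}|lborel. \<tau> (complex_of_real t))" if l: "0 < l" for l
    proof -
      have d: "((\<lambda>t. g (complex_of_real t) - L) has_vector_derivative \<tau> (complex_of_real t)) (at t)" if "0 < t" for t
      proof -
        have "((\<lambda>z. g z - L) has_field_derivative \<tau> (complex_of_real t)) (at (complex_of_real t))"
          using g[OF of_real_in_acute_cone[OF c that]] by (auto intro!: derivative_eq_intros)
        then show ?thesis by (rule has_vector_derivative_real_field)
      qed
      have ct: "isCont (\<lambda>t. \<tau> (complex_of_real t)) t" if "0 < t" for t
      proof -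
        have "isCont \<tau> (complex_of_real t)"
          using hol open_acute_cone of_real_in_acute_cone[OF c that]
          by (metis continuous_on_eq_continuous_at holomorphic_on_imp_continuous_on)
        then show ?thesis using isCont_o2[of t complex_of_real \<tau>] by simp
      qed
      have "(LINT t:{l<..}|lborel. \<tau> (complex_of_real t)) = 0 - (g (complex_of_real l) - L)"
      proof (rule LINT_FTC_at_top)
        show "isCont (\<lambda>t. g (complex_of_real t) - L) l" by (rule has_vector_derivative_continuous[OF d[OF l]])
        show "set_integrable lborel {l<..} (\<lambda>t. \<tau> (complex_of_real t))"
        proof (rule set_integrable_bound[OF set_integrable_inverse_square[OF l, of K]])
          have "continuous_on {l<..} (\<lambda>t. \<tau> (complex_of_real t))"
            using ct l by (intro continuous_at_imp_continuous_on) auto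
          then show "set_borel_measurable lborel {l<..} (\<lambda>t. \<tau> (complex_of_real t))"
            unfolding set_borel_measurable_def
            using borel_measurable_continuous_on_indicator[of "{l<..}" "\<lambda>t. \<tau> (complex_of_real t)"] by simp
          show "AE t in lborel. t \<in> {l<..} \<longrightarrow> norm (\<tau> (complex_of_real t)) \<le> norm (K / t\<^sup>2)"
            using bd[OF of_real_in_acute_cone[OF c]] l K by (intro AE_I2) auto
        qed
        show "\<And>t. l < t \<Longrightarrow> ((\<lambda>t. g (complex_of_real t) - L) has_vector_derivative \<tau> (complex_of_real t)) (at t)"
          using d l by simp
        show "\<And>t. l < t \<Longrightarrow> isCont (\<lambda>t. \<tau> (complex_of_real t)) t" using ct l by simp
      qed (rule lim)
      then show ?thesis by simp
    qed
  qed
qed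

lemma
  assumes "single_valued (om_calc (log_fun l) A)" and x: "x \<in> Domain (om_calc (log_fun l) A)"
  shows Domain_log_op: "x \<in> Domain (log_op l A)"
    and app_log_op: "app (log_op l A) x = complex_of_real (ln l) *\<^sub>C x - app (om_calc (log_fun l) A) x"
proof -
  have "(x, complex_of_real (ln l) *\<^sub>C x - app (om_calc (log_fun l) A) x) \<in> log_op l A"
    unfolding log_op_def using app_in[OF assms] by blast
  moreover have "single_valued (log_op l A)"
    using assms(1) unfolding single_valued_def log_op_def by blast
  ultimately show "x \<in> Domain (log_op l A)"
    "app (log_op l A) x = complex_of_real (ln l) *\<^sub>C x - app (om_calc (log_fun l) A) x"
    by (auto intro: app_eqI)
qed

context nuclear_perturbation
begin

lemma dense: "closure (Domain A) = UNIV"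
  using A by (simp add: NP_def)

text \<open>Both resolvents at z are perturbed from the real point Re z. With M the larger of the
  two resolvent bounds, |Im z| M/Re z is at most 1/2 on the cone with c = 1/(2M), so they exist
  there with norm at most 2M/Re z. The terms of the trace are holomorphic and converge locally
  uniformly.\<close>

lemma tr_diff_holomorphic:
  obtains c K where "0 < c" "tr_diff holomorphic_on acute_cone c" "\<And>z. z \<in> acute_cone c \<Longrightarrow> cmod (tr_diff z) \<le> K / (Re z)\<^sup>2"
proof -
  note linA = NP_linear_operator[OF A] and linB = NP_linear_operator[OF B]
  obtain M1 where M1: "M1 \<ge> 1" "\<And>t x. t > 0 \<Longrightarrow> norm (resolvent (complex_of_real t) A x) \<le> M1 / t * norm x"
    using NP_resolvent_bound[OF A] by blast
  obtain M2 where M2: "M2 \<ge> 1" "\<And>t x. t > 0 \<Longrightarrow> norm (resolvent (complex_of_real t) B x) \<le> M2 / t * norm x"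
    using NP_resolvent_bound[OF B] by blast
  define M where "M = max M1 M2"
  define c where "c = 1 / (2 * M)"
  have M: "M \<ge> 1" "M1 \<le> M" "M2 \<le> M" using M1 by (auto simp: M_def)
  have c: "0 < c" using M by (simp add: c_def)
  note pos = acute_cone_Re_pos[OF _ c]
  have near: "cmod (z - complex_of_real (Re z)) * (M / Re z) \<le> 1 / 2" if z: "z \<in> acute_cone c" for z
  proof -
    have "z - complex_of_real (Re z) = complex_of_real (Im z) * \<i>" by (simp add: complex_eq_iff)
    then have "cmod (z - complex_of_real (Re z)) * (M / Re z) = \<bar>Im z\<bar> * (M / Re z)" by (simp add: norm_mult)
    also have "\<dots> \<le> c * Re z * (M / Re z)" using z pos[OF z] M by (intro mult_right_mono) (auto simp: acute_cone_def)
    also have "\<dots> = 1 / 2" using pos[OF z] M by (simp add: c_def)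
    finally show ?thesis .
  qed
  have bA: "norm (resolvent (complex_of_real t) A x) \<le> M / t * norm x" if "t > 0" for t x
    by (rule order_trans[OF M1(2)[OF that]]) (use that M in \<open>intro mult_right_mono divide_right_mono; simp\<close>)
  have bB: "norm (resolvent (complex_of_real t) B x) \<le> M / t * norm x" if "t > 0" for t x
    by (rule order_trans[OF M2(2)[OF that]]) (use that M in \<open>intro mult_right_mono divide_right_mono; simp\<close>)
  have rA: "z \<in> resolvent_set A" "norm (resolvent z A x) \<le> 2 * (M / Re z) * norm x" if z: "z \<in> acute_cone c" for z x
    by (rule resolvent_perturb[OF linA NP_resolvent_set[OF A pos[OF z]] bA[OF pos[OF z]] near[OF z]])+
  have rB: "z \<in> resolvent_set B" "norm (resolvent z B x) \<le> 2 * (M / Re z) * norm x" if z: "z \<in> acute_cone c" for z x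
    by (rule resolvent_perturb[OF linB NP_resolvent_set[OF B pos[OF z]] bB[OF pos[OF z]] near[OF z]])+
  define a where "a n = onorm (f n) * norm (x n)" for n
  have a: "0 \<le> a n" "summable a" for n
    using f_summable bounded_clinear_onorm_nonneg[OF f, of n] by (auto simp: a_def[abs_def])
  define u where "u n z = f n (resolvent z A (resolvent z B (x n)))" for n z
  have ub: "cmod (u n z) \<le> a n * (4 * M\<^sup>2 / (Re z)\<^sup>2)" if z: "z \<in> acute_cone c" for n z
  proof -
    have "cmod (u n z) \<le> onorm (f n) * (2 * (M / Re z) * (2 * (M / Re z) * norm (x n)))"
      unfolding u_def using pos[OF z] M
      by (intro order_trans[OF bounded_clinear_onorm[OF f]] mult_left_mono bounded_clinear_onorm_nonneg f
          order_trans[OF rA(2)[OF z]] rB(2)[OF z]) auto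
    then show ?thesis by (simp add: a_def power2_eq_square ac_simps)
  qed
  have tr: "tr_diff z = (\<Sum>n. u n z)" for z by (simp add: tr_diff_def u_def)
  have hu: "(\<lambda>z. u n z) holomorphic_on acute_cone c" for n
    unfolding holomorphic_on_open[OF open_acute_cone]
  proof
    fix w assume w: "w \<in> acute_cone c"
    let ?y = "resolvent w B (x n)"
    \<comment> \<open>By the resolvent identity for both factors this expression is exactly the
      difference quotient of \<open>u n\<close> off w, and its limit at w follows from the
      continuity of resolvents.\<close>
    have "((\<lambda>z. - f n (resolvent z A (resolvent z B ?y)) - f n (resolvent z A (resolvent w A ?y))) \<longlongrightarrow>
        - f n (resolvent w A (resolvent w B ?y)) - f n (resolvent w A (resolvent w A ?y))) (at w)"
      by (intro tendsto_diff tendsto_minus bounded_clinear_tendsto[OF f] resolvent_tendsto[OF linA rA(1)[OF w]]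
          resolvent_tendsto[OF linB rB(1)[OF w]] tendsto_const)
    moreover have "\<forall>\<^sub>F z in at w. - f n (resolvent z A (resolvent z B ?y)) - f n (resolvent z A (resolvent w A ?y)) =
        (u n z - u n w) / (z - w)"
    proof -
      have "\<forall>\<^sub>F z in at w. z \<in> acute_cone c \<and> z \<noteq> w"
        using eventually_at_in_open[OF open_acute_cone w] by (simp add: eventually_conj_iff)
      then show ?thesis
      proof eventually_elim
        case (elim z)
        then have z: "z \<in> acute_cone c" "z \<noteq> w" by auto
        note RA = bounded_clinear_resolvent[OF rA(1)[OF z(1)]]
        have "resolvent z A (resolvent z B (x n)) = resolvent z A ?y + (w - z) *\<^sub>C resolvent z A (resolvent z B ?y)"
          using resolvent_identity[OF linB rB(1)[OF z(1)] rB(1)[OF w], of "x n"]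
          by (simp add: bounded_clinear_add[OF RA] bounded_clinear_scaleC[OF RA])
        also have "resolvent z A ?y = resolvent w A ?y + (w - z) *\<^sub>C resolvent z A (resolvent w A ?y)"
          by (rule resolvent_identity[OF linA rA(1)[OF z(1)] rA(1)[OF w]])
        finally have "u n z = u n w + (w - z) * f n (resolvent z A (resolvent w A ?y)) +
            (w - z) * f n (resolvent z A (resolvent z B ?y))"
          by (simp add: u_def bounded_clinear_add[OF f] bounded_clinear_scaleC[OF f] scaleC_complex_def)
        then show ?case using z(2) by (simp add: field_simps)
      qed
    qed
    ultimately have "((\<lambda>z. (u n z - u n w) / (z - w)) \<longlongrightarrow>
        - f n (resolvent w A (resolvent w B ?y)) - f n (resolvent w A (resolvent w A ?y))) (at w)"
      by (rule Lim_transform_eventually)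
    then show "\<exists>f'. (u n has_field_derivative f') (at w)" by (auto simp: has_field_derivative_iff)
  qed
  show thesis
  proof (rule that[of c "suminf a * (4 * M\<^sup>2)"])
    show "tr_diff holomorphic_on acute_cone c"
    proof (rule holomorphic_uniform_sequence[OF open_acute_cone])
      show "(\<lambda>z. \<Sum>n<N. u n z) holomorphic_on acute_cone c" for N by (intro holomorphic_on_sum hu)
      fix z assume z: "z \<in> acute_cone c"
      obtain d0 where d0: "0 < d0" "cball z d0 \<subseteq> acute_cone c" using open_contains_cball open_acute_cone z by blast
      \<comment> \<open>On the smaller disc the real part is at least Re z/2, which gives the terms
        a uniform majorant.\<close>
      define d where "d = min d0 (Re z / 2)"
      have d: "0 < d" "cball z d \<subseteq> acute_cone c" using d0 pos[OF z] by (auto simp: d_def)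
      have "uniform_limit (cball z d) (\<lambda>N z. \<Sum>n<N. u n z) (\<lambda>z. \<Sum>n. u n z) sequentially"
      proof (rule Weierstrass_m_test)
        show "cmod (u n w) \<le> a n * (4 * M\<^sup>2 / (Re z / 2)\<^sup>2)" if w: "w \<in> cball z d" for n w
        proof -
          have "\<bar>Re (z - w)\<bar> \<le> Re z / 2" using abs_Re_le_cmod[of "z - w"] w by (simp add: d_def dist_norm)
          then have "Re z / 2 \<le> Re w" unfolding minus_complex.sel by linarith
          then have "a n * (4 * M\<^sup>2 / (Re w)\<^sup>2) \<le> a n * (4 * M\<^sup>2 / (Re z / 2)\<^sup>2)"
            using a pos[OF z] by (intro mult_left_mono divide_left_mono power_mono mult_pos_pos) auto
          then show ?thesis using ub[of w n] w d by force
        qed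
        show "summable (\<lambda>n. a n * (4 * M\<^sup>2 / (Re z / 2)\<^sup>2))" by (intro summable_mult2 a)
      qed
      then show "\<exists>d>0. cball z d \<subseteq> acute_cone c \<and> uniform_limit (cball z d) (\<lambda>N z. \<Sum>n<N. u n z) tr_diff sequentially"
        using d unfolding tr[abs_def, symmetric] by blast
    qed
    fix z assume z: "z \<in> acute_cone c"
    have "cmod (tr_diff z) \<le> (\<Sum>n. a n * (4 * M\<^sup>2 / (Re z)\<^sup>2))"
      unfolding tr by (rule norm_suminf_le[OF ub[OF z]]) (intro summable_mult2 a)
    also have "\<dots> = suminf a * (4 * M\<^sup>2) / (Re z)\<^sup>2" using suminf_mult2[OF a(2), of "4 * M\<^sup>2 / (Re z)\<^sup>2"] by simp
    finally show "cmod (tr_diff z) \<le> suminf a * (4 * M\<^sup>2) / (Re z)\<^sup>2" .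
  qed (rule c)
qed

lemma continuous_on_tr_diff: "continuous_on {0<..} (\<lambda>t. tr_diff (complex_of_real t))"
proof -
  obtain c where c: "0 < c" "tr_diff holomorphic_on acute_cone c" using tr_diff_holomorphic by metis
  show ?thesis
    by (rule continuous_on_compose2[OF holomorphic_on_imp_continuous_on[OF c(2)]])
      (use of_real_in_acute_cone[OF c(1)] in \<open>auto intro: continuous_intros\<close>)
qed

text \<open>The density 1/t of the measure of \<open>log_fun l\<close> cancels the factor t of the
  general trace. The minus sign arises because log(l I - A) is a multiple of the identity minus
  \<psi>(A) with \<psi> = \<open>log_fun l\<close>.\<close>

lemma spectral_shift_eq:
  assumes l: "0 < l"
  shows "spectral_shift A B l = - (LINT t:{l<..}|lborel. tr_diff (complex_of_real t))"
proof -
  note om = log_fun_represents[OF l] and i = integrable_inverse_log_measure[OF l]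
  obtain D where D: "extends_diff (Domain A) (om_calc (log_fun l) A) (om_calc (log_fun l) B) D" "nuclear D"
    "nuclear_trace D = (\<integral>t. complex_of_real t * tr_diff (complex_of_real t) \<partial>log_measure l)"
    by (rule om_calc_diff_nuclear[OF om i])
  note calcA = om_calc_NP(1,2)[OF A om i] and calcB = om_calc_NP(1,2)[OF B om i]
  have "extends_diff (Domain A) (log_op l A) (log_op l B) (\<lambda>v. - D v)"
    unfolding extends_diff_def
  proof (intro conjI ballI subsetI)
    fix v assume v: "v \<in> Domain A"
    then have v': "v \<in> Domain B" using dom by auto
    show "v \<in> Domain (log_op l A)" by (rule Domain_log_op[OF calcA(1) calcA(2)[OF v]])
    show "v \<in> Domain (log_op l B)" by (rule Domain_log_op[OF calcB(1) calcB(2)[OF v']])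
    show "- D v = app (log_op l A) v - app (log_op l B) v"
      using D(1) v by (simp add: app_log_op[OF calcA(1) calcA(2)[OF v]] app_log_op[OF calcB(1) calcB(2)[OF v']] extends_diff_def)
  qed (use D(1) in \<open>auto simp: extends_diff_def intro: bounded_clinear_uminus\<close>)
  then have "spectral_shift A B l = nuclear_trace (\<lambda>v. - D v)"
    unfolding spectral_shift_def by (simp add: diff_ext_eq[OF dense])
  also have "\<dots> = - (\<integral>t. complex_of_real t * tr_diff (complex_of_real t) \<partial>log_measure l)"
    using nuclear_trace_uminus[OF ap D(2)] D(3) by simp
  \<comment> \<open>\<open>integral_log_measure\<close> requires a Borel function on the whole line,
    while \<open>tr_diff\<close> is controlled only on the positive axis; hence the cut-off by an
    indicator.\<close>
  also have "(\<integral>t. complex_of_real t * tr_diff (complex_of_real t) \<partial>log_measure l) =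
      (LINT t:{l<..}|lborel. (1 / t) *\<^sub>R (complex_of_real t * (indicator {0<..} t *\<^sub>R tr_diff (complex_of_real t))))"
  proof (subst integral_log_measure(1)[OF l, symmetric])
    show "(\<lambda>t. complex_of_real t * indicator {0<..} t *\<^sub>R tr_diff (complex_of_real t)) \<in> borel_measurable borel"
      by (rule borel_measurable_times[OF _ borel_measurable_continuous_on_indicator[OF _ continuous_on_tr_diff]]) auto
  qed (auto intro!: Bochner_Integration.integral_cong simp: space_log_measure)
  also have "\<dots> = (LINT t:{l<..}|lborel. tr_diff (complex_of_real t))"
    using l by (intro set_lebesgue_integral_cong) (auto simp: scaleR_conv_of_real)
  finally show ?thesis .
qed

end

section \<open>The contour integral\<close>

text \<open>On (0,n] the constant 1 is at most (1+n)/(1+t), so these sets have finite measure.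
  Product measures and Fubini's theorem depend on it.\<close>

lemma om_sigma_finite:
  assumes om: "om_represents \<mu> \<phi>" shows "sigma_finite_measure \<mu>"
proof
  let ?A = "\<lambda>n::nat. {0<..real n}"
  have sets: "?A n \<in> sets \<mu>" for n
    by (auto simp: om_represents_space[OF om] sets_restrict_space_iff)
  have fin: "emeasure \<mu> (?A n) \<noteq> \<infinity>" for n
  proof -
    have "emeasure \<mu> (?A n) = (\<integral>\<^sup>+t. indicator (?A n) t \<partial>\<mu>)" using sets by simp
    also have "\<dots> \<le> (\<integral>\<^sup>+t. ennreal (1 + real n) * ennreal (1 / (1 + t)) \<partial>\<mu>)"
    proof (rule nn_integral_mono)
      fix t assume "t \<in> space \<mu>"
      then have t: "t > 0" by (simp add: om_represents_space[OF om])
      show "indicator (?A n) t \<le> ennreal (1 + real n) * ennreal (1 / (1 + t))"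
      proof (cases "t \<le> real n")
        case True
        have "ennreal 1 \<le> ennreal ((1 + real n) * (1 / (1 + t)))"
          using True t by (intro ennreal_leI) simp
        also have "\<dots> = ennreal (1 + real n) * ennreal (1 / (1 + t))"
          using t by (intro ennreal_mult) auto
        finally show ?thesis using True t by simp
      qed simp
    qed
    also have "\<dots> = ennreal (1 + real n) * (\<integral>\<^sup>+t. ennreal (1 / (1 + t)) \<partial>\<mu>)"
      by (rule nn_integral_cmult, rule om_represents_measurable[OF om]) measurable
    also have "\<dots> < \<infinity>" using om by (simp add: om_represents_def ennreal_mult_less_top)
    finally show ?thesis by simp
  qed
  have "t \<in> (\<Union>n. ?A n)" if "t > 0" for t using that real_arch_simple[of t] by auto
  then have "(\<Union>n. ?A n) = space \<mu>" by (auto simp: om_represents_space[OF om])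
  then show "\<exists>A. countable A \<and> A \<subseteq> sets \<mu> \<and> \<Union> A = space \<mu> \<and> (\<forall>a\<in>A. emeasure \<mu> a \<noteq> \<infinity>)"
    using sets fin by (intro exI[of _ "range ?A"]) auto
qed

text \<open>Isolates the contour argument from the operators: what remains is a function with its
  derivative and their decay. The condition on tan \<theta> puts the two boundary rays, apart from
  the vertex, inside the cone.\<close>

locale cone_function =
  fixes c K \<theta> :: real and \<xi> \<tau> :: "complex \<Rightarrow> complex"
  assumes \<theta>: "0 < \<theta>" "\<theta> < pi / 2" "tan \<theta> < c"
    and \<xi>: "\<And>z. z \<in> acute_cone c \<Longrightarrow> (\<xi> has_field_derivative \<tau> z) (at z)"
    and \<xi>_le: "\<And>z. z \<in> acute_cone c \<Longrightarrow> cmod (\<xi> z) \<le> K / Re z"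
    and \<tau>_le: "\<And>z. z \<in> acute_cone c \<Longrightarrow> cmod (\<tau> z) \<le> K / (Re z)\<^sup>2"
begin

lemma sin_cos_pos: "0 < sin \<theta>" "0 < cos \<theta>"
  using \<theta> by (auto intro: sin_gt_zero cos_gt_zero)

lemma c_pos: "0 < c"
  using \<theta> tan_gt_zero[of \<theta>] by simp

section \<open>Estimates on the boundary rays\<close>

lemma K_nonneg: "0 \<le> K"
  using order_trans[OF norm_ge_zero \<xi>_le[OF of_real_in_acute_cone[OF c_pos zero_less_one]]] by simp

lemma ray_trig:
  assumes "\<bar>s\<bar> = \<theta>"
  shows "cos s = cos \<theta>" "\<bar>sin s\<bar> = sin \<theta>"
proof -
  have "s = \<theta> \<or> s = - \<theta>" using assms by linarith
  then show "cos s = cos \<theta>" "\<bar>sin s\<bar> = sin \<theta>" using sin_cos_pos by auto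
qed

lemma ray_in_cone:
  assumes s: "\<bar>s\<bar> = \<theta>" and r: "0 \<le> r" and e: "0 < \<epsilon>"
  shows "rcis r s + complex_of_real \<epsilon> \<in> acute_cone c"
proof -
  have "r * sin \<theta> = r * cos \<theta> * tan \<theta>" using sin_cos_pos by (simp add: tan_def)
  also have "\<dots> \<le> r * cos \<theta> * c" using r sin_cos_pos \<theta> by (intro mult_left_mono) auto
  also have "\<dots> < c * (r * cos \<theta> + \<epsilon>)" using c_pos e by (simp add: algebra_simps)
  finally show ?thesis using r by (simp add: acute_cone_def abs_mult ray_trig[OF s])
qed

text \<open>Both r sin \<theta> and t sin \<theta> are lower bounds, the first as an imaginary part
  and the second likewise after the ray has been rotated onto the real axis; their mean is
  taken.\<close>

lemma ray_dist:
  assumes s: "\<bar>s\<bar> = \<theta>" and r: "0 \<le> r" and t: "0 < t"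
  shows "sin \<theta> / 2 * (t + r) \<le> cmod (complex_of_real t - rcis r s)"
proof -
  have "r * sin \<theta> \<le> cmod (complex_of_real t - rcis r s)"
    using abs_Im_le_cmod[of "complex_of_real t - rcis r s"] r by (simp add: abs_mult ray_trig[OF s])
  moreover have "t * sin \<theta> \<le> cmod (complex_of_real t - rcis r s)"
  proof -
    have "\<bar>Im ((complex_of_real t - rcis r s) * cis (- s))\<bar> \<le> cmod ((complex_of_real t - rcis r s) * cis (- s))"
      by (rule abs_Im_le_cmod)
    moreover have "(complex_of_real t - rcis r s) * cis (- s) = complex_of_real t * cis (- s) - complex_of_real r"
      by (simp add: rcis_def algebra_simps cis_mult)
    moreover have "cmod ((complex_of_real t - rcis r s) * cis (- s)) = cmod (complex_of_real t - rcis r s)"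
      by (simp add: norm_mult)
    ultimately show ?thesis using t by (simp add: abs_mult ray_trig[OF s])
  qed
  ultimately show ?thesis by (simp add: algebra_simps)
qed

lemma ray_nonzero:
  assumes "\<bar>s\<bar> = \<theta>" "0 \<le> r" "0 < t"
  shows "complex_of_real t - rcis r s \<noteq> 0"
proof -
  have "0 < sin \<theta> / 2 * (t + r)" using sin_cos_pos assms by (intro mult_pos_pos) auto
  from less_le_trans[OF this ray_dist[OF assms]] show ?thesis unfolding zero_less_norm_iff .
qed

text \<open>As t/(t-z)^2 is the kernel of \<phi>', integration over t gives the integrand of the
  trace formula on the ray of angle s. Integration over r, combined over both rays, gives the Cauchy
  integral for the pole t.\<close>

definition ray_integrand :: "real \<Rightarrow> real \<Rightarrow> real \<Rightarrow> real \<Rightarrow> complex" where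
  "ray_integrand \<epsilon> s t r =
    \<xi> (rcis r s + complex_of_real \<epsilon>) * (complex_of_real t / (complex_of_real t - rcis r s)\<^sup>2) * cis s"

text \<open>The real part r cos \<theta> + \<epsilon> is at least min(cos \<theta>, \<epsilon>) (1 +
  r). So the shift controls \<xi> at the vertex, with a constant that may grow like
  1/\<epsilon>.\<close>

lemma ray_integrand_bound:
  assumes s: "\<bar>s\<bar> = \<theta>" and r: "0 \<le> r" and t: "0 < t" and e: "0 < \<epsilon>"
  shows "cmod (ray_integrand \<epsilon> s t r) \<le>
    K / min (cos \<theta>) \<epsilon> * (4 / (sin \<theta>)\<^sup>2) * (t / ((t + r)\<^sup>2 * (1 + r)))"
proof -
  let ?d = "min (cos \<theta>) \<epsilon>"
  have d: "0 < ?d" using sin_cos_pos e by simp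
  have "?d * (1 + r) = ?d + ?d * r" by (simp add: algebra_simps)
  also have "\<dots> \<le> \<epsilon> + cos \<theta> * r" using r by (intro add_mono mult_right_mono) auto
  finally have dr: "?d * (1 + r) \<le> r * cos \<theta> + \<epsilon>" by (simp add: algebra_simps)
  have "cmod (\<xi> (rcis r s + complex_of_real \<epsilon>)) \<le> K / (r * cos \<theta> + \<epsilon>)"
    using \<xi>_le[OF ray_in_cone[OF s r e]] by (simp add: ray_trig[OF s])
  also have "\<dots> \<le> K / (?d * (1 + r))"
    using dr d r K_nonneg by (intro divide_left_mono mult_pos_pos) (auto intro: add_nonneg_pos e sin_cos_pos less_imp_le)
  finally have 1: "cmod (\<xi> (rcis r s + complex_of_real \<epsilon>)) \<le> K / (?d * (1 + r))" .
  have pos: "0 < sin \<theta> / 2 * (t + r)" using sin_cos_pos r t by (intro mult_pos_pos) auto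
  have "cmod (complex_of_real t / (complex_of_real t - rcis r s)\<^sup>2) \<le> t / (sin \<theta> / 2 * (t + r))\<^sup>2"
    unfolding norm_divide norm_power using t ray_dist[OF s r t] pos
    by (intro frac_le power_mono) auto
  moreover have "cmod (ray_integrand \<epsilon> s t r) = cmod (\<xi> (rcis r s + complex_of_real \<epsilon>)) *
      cmod (complex_of_real t / (complex_of_real t - rcis r s)\<^sup>2)"
    unfolding ray_integrand_def by (simp only: norm_mult norm_cis mult_1_right)
  ultimately have "cmod (ray_integrand \<epsilon> s t r) \<le> K / (?d * (1 + r)) * (t / (sin \<theta> / 2 * (t + r))\<^sup>2)"
    using 1 d r K_nonneg by (simp only:) (intro mult_mono divide_nonneg_nonneg mult_nonneg_nonneg; simp)
  also have "\<dots> = K / ?d * (4 / (sin \<theta>)\<^sup>2) * (t / ((t + r)\<^sup>2 * (1 + r)))"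
    by (simp add: power_mult_distrib power_divide ac_simps)
  finally show ?thesis .
qed

lemma continuous_on_ray_shift:
  assumes s: "\<bar>s\<bar> = \<theta>" and e: "0 < \<epsilon>"
  shows "continuous_on {0..} (\<lambda>r. \<xi> (rcis r s + complex_of_real \<epsilon>))"
proof (rule continuous_on_compose2[of "acute_cone c" \<xi>])
  show "continuous_on (acute_cone c) \<xi>"
    using \<xi> by (intro continuous_at_imp_continuous_on ballI DERIV_isCont)
  show "continuous_on {0..} (\<lambda>r. rcis r s + complex_of_real \<epsilon>)"
    unfolding rcis_def by (intro continuous_intros)
qed (use ray_in_cone[OF s _ e] in auto)

lemma continuous_on_ray_integrand:
  assumes s: "\<bar>s\<bar> = \<theta>" and t: "0 < t" and e: "0 < \<epsilon>"
  shows "continuous_on {0..} (ray_integrand \<epsilon> s t)"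
  unfolding ray_integrand_def[abs_def]
  by (intro continuous_intros continuous_on_ray_shift[OF s e])
    (use ray_nonzero[OF s _ t] in \<open>auto simp: rcis_def intro!: continuous_intros\<close>)

lemma set_integrable_ray_integrand:
  assumes s: "\<bar>s\<bar> = \<theta>" and t: "0 < t" and e: "0 < \<epsilon>"
  shows "set_integrable lborel {0..} (ray_integrand \<epsilon> s t)"
proof -
  note cont = continuous_on_ray_integrand[OF s t e]
  define C where "C = K / min (cos \<theta>) \<epsilon> * (4 / (sin \<theta>)\<^sup>2)"
  have C: "0 \<le> C" using K_nonneg sin_cos_pos e by (simp add: C_def)
  have 1: "set_integrable lborel {0..1} (ray_integrand \<epsilon> s t)"
    unfolding set_integrable_def by (rule borel_integrable_compact) (use continuous_on_subset[OF cont] in auto)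
  have 2: "set_integrable lborel {1<..} (ray_integrand \<epsilon> s t)"
  proof (rule set_integrable_bound[OF set_integrable_inverse_square[of 1 "C * t"]])
    have "{1<..} \<subseteq> {0::real..}" by auto
    from borel_measurable_continuous_on_indicator[OF _ continuous_on_subset[OF cont this]]
    show "set_borel_measurable lborel {1<..} (ray_integrand \<epsilon> s t)"
      unfolding set_borel_measurable_def by simp
    show "AE r in lborel. r \<in> {1<..} \<longrightarrow> norm (ray_integrand \<epsilon> s t r) \<le> norm (C * t / r\<^sup>2)"
    proof (intro AE_I2 impI)
      fix r :: real assume "r \<in> {1<..}"
      then have r: "1 < r" by simp
      have "norm (ray_integrand \<epsilon> s t r) \<le> C * (t / ((t + r)\<^sup>2 * (1 + r)))"
        using ray_integrand_bound[OF s _ t e, of r] r by (simp add: C_def)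
      also have "\<dots> \<le> C * (t / (r\<^sup>2 * 1))"
        using C t r by (intro mult_left_mono divide_left_mono mult_mono power_mono mult_pos_pos) auto
      finally show "norm (ray_integrand \<epsilon> s t r) \<le> norm (C * t / r\<^sup>2)"
        using C t by (simp add: abs_mult)
    qed
  qed simp
  have "{0..} = {0..1::real} \<union> {1<..}" by auto
  then show ?thesis using set_integrable_Un[OF 1 2] by simp
qed

text \<open>Cauchy's formula for the derivative, on the triangle with the vertices \<open>0\<close>, \<open>R e^(-i\<theta>)\<close>,
  \<open>R e^(i\<theta>)\<close>. A triangle suits better than a circular sector, as its winding number is in the library.\<close>

lemma triangle_integral:
  fixes t R \<epsilon> :: real
  defines "a \<equiv> rcis R (- \<theta>)" and "b \<equiv> rcis R \<theta>"
    and "F \<equiv> \<lambda>z. \<xi> (z + complex_of_real \<epsilon>) * (complex_of_real t / (complex_of_real t - z)\<^sup>2)"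
  assumes t: "0 < t" and e: "0 < \<epsilon>" and R: "t < R * cos \<theta>"
  shows "F contour_integrable_on linepath 0 a" "F contour_integrable_on linepath a b"
    "F contour_integrable_on linepath 0 b"
    "contour_integral (linepath 0 a) F + contour_integral (linepath a b) F - contour_integral (linepath 0 b) F =
      2 * pi * \<i> * (complex_of_real t * \<tau> (complex_of_real (t + \<epsilon>)))"
proof -
  have "0 < R * cos \<theta>" using t R by linarith
  then have R0: "0 < R" using sin_cos_pos by (simp add: zero_less_mult_iff)
  define S where "S = {z. z + complex_of_real \<epsilon> \<in> acute_cone c}"
  have oS: "open S"
  proof -
    have "S = (\<lambda>z. z + complex_of_real \<epsilon>) -` acute_cone c" by (auto simp: S_def)
    then show ?thesis using open_vimage[OF open_acute_cone, of "\<lambda>z. z + complex_of_real \<epsilon>"] by (simp add: continuous_intros)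
  qed
  have cS: "convex S"
  proof (rule convexI)
    fix z w :: complex and u v :: real
    assume zw: "z \<in> S" "w \<in> S" and uv: "0 \<le> u" "0 \<le> v" "u + v = 1"
    have "u *\<^sub>R (z + complex_of_real \<epsilon>) + v *\<^sub>R (w + complex_of_real \<epsilon>) \<in> acute_cone c"
      using convexD[OF convex_acute_cone] zw uv by (auto simp: S_def)
    moreover have "u *\<^sub>R (z + complex_of_real \<epsilon>) + v *\<^sub>R (w + complex_of_real \<epsilon>) =
        u *\<^sub>R z + v *\<^sub>R w + (u + v) *\<^sub>R complex_of_real \<epsilon>"
      by (simp add: scaleR_add_right scaleR_add_left)
    ultimately show "u *\<^sub>R z + v *\<^sub>R w \<in> S" using uv by (simp add: S_def)
  qed
  have inS: "0 \<in> S" "a \<in> S" "b \<in> S" "complex_of_real t \<in> S"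
    using of_real_in_acute_cone[OF c_pos e] of_real_in_acute_cone[OF c_pos, of "t + \<epsilon>"] t e R0 \<theta>
      ray_in_cone[of "- \<theta>" R, OF _ _ e] ray_in_cone[of \<theta> R, OF _ _ e]
    by (auto simp: S_def a_def b_def)
  have ReIm: "Re a = R * cos \<theta>" "Re b = R * cos \<theta>" "Im a = - (R * sin \<theta>)" "Im b = R * sin \<theta>"
    by (simp_all add: a_def b_def)
  have Rs: "0 < R * sin \<theta>" using R0 sin_cos_pos by simp
  have nseg: "complex_of_real t \<notin> closed_segment 0 a" "complex_of_real t \<notin> closed_segment a b"
    "complex_of_real t \<notin> closed_segment b 0"
  proof -
    show "complex_of_real t \<notin> closed_segment 0 a"
    proof
      assume "complex_of_real t \<in> closed_segment 0 a"
      then obtain u where u: "complex_of_real t = u *\<^sub>R a" by (auto simp: in_segment)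
      then have "u * Im a = 0" by (metis Im_complex_of_real scaleR_complex.sel(2) real_scaleR_def)
      then show False using u t Rs ReIm by auto
    qed
    show "complex_of_real t \<notin> closed_segment b 0"
    proof
      assume "complex_of_real t \<in> closed_segment b 0"
      then obtain u where u: "complex_of_real t = u *\<^sub>R b" by (auto simp: in_segment)
      then have "u * Im b = 0" by (metis Im_complex_of_real scaleR_complex.sel(2) real_scaleR_def)
      then show False using u t Rs ReIm by auto
    qed
    show "complex_of_real t \<notin> closed_segment a b"
    proof
      assume "complex_of_real t \<in> closed_segment a b"
      then obtain u where u: "complex_of_real t = (1 - u) *\<^sub>R a + u *\<^sub>R b" by (auto simp: in_segment)
      then have "t = (1 - u) * Re a + u * Re b"
        by (metis Re_complex_of_real plus_complex.sel(1) scaleR_complex.sel(1) real_scaleR_def)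
      then have "t = R * cos \<theta>" unfolding ReIm by (simp add: algebra_simps)
      then show False using R by simp
    qed
  qed
  have seg: "closed_segment 0 a \<subseteq> S - {complex_of_real t}" "closed_segment a b \<subseteq> S - {complex_of_real t}"
    "closed_segment b 0 \<subseteq> S - {complex_of_real t}"
    using closed_segment_subset[OF inS(1,2) cS] closed_segment_subset[OF inS(2,3) cS]
      closed_segment_subset[OF inS(3,1) cS] nseg by auto
  define \<gamma> where "\<gamma> = linepath 0 a +++ linepath a b +++ linepath b 0"
  have \<gamma>: "valid_path \<gamma>" "pathfinish \<gamma> = pathstart \<gamma>" by (simp_all add: \<gamma>_def)
  have im: "path_image \<gamma> \<subseteq> S - {complex_of_real t}"
    using seg by (simp add: \<gamma>_def path_image_join)
  have "complex_of_real t \<in> convex hull {0, a, b}"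
  proof -
    \<comment> \<open>The side from \<open>a\<close> to \<open>b\<close> has the midpoint R cos
      \<theta>, and t is the fraction \<open>m\<close> of it.\<close>
    define m where "m = t / (R * cos \<theta>)"
    have m: "0 \<le> m" "m \<le> 1" "m * (R * cos \<theta>) = t" using t R \<open>0 < R * cos \<theta>\<close> by (auto simp: m_def)
    have "complex_of_real t = (1 - m) *\<^sub>R 0 + (m / 2) *\<^sub>R a + (m / 2) *\<^sub>R b"
      using m(3) by (simp add: complex_eq_iff ReIm)
    then show ?thesis unfolding convex_hull_3 using m by (intro CollectI exI[of _ "1 - m"] exI[of _ "m / 2"]) auto
  qed
  then have int: "complex_of_real t \<in> interior (convex hull {0, a, b})"
    using nseg by (simp add: interior_of_triangle)
  \<comment> \<open>The sign of this imaginary part decides the orientation: with \<open>a\<close>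
    below the axis and \<open>b\<close> above it, the vertices 0, \<open>a\<close>, \<open>b\<close>
    run counterclockwise.\<close>
  have wn: "winding_number \<gamma> (complex_of_real t) = 1"
  proof -
    have "Im ((a - 0) * cnj (a - complex_of_real t)) = t * (R * sin \<theta>)"
      by (simp add: ReIm algebra_simps)
    also have "\<dots> > 0" using t Rs by simp
    finally show ?thesis unfolding \<gamma>_def using winding_number_triangle[OF int] by simp
  qed
  have \<xi>': "((\<lambda>z. \<xi> (z + complex_of_real \<epsilon>)) has_field_derivative \<tau> (z + complex_of_real \<epsilon>)) (at z)" if "z \<in> S" for z
  proof -
    have "((\<lambda>z. z + complex_of_real \<epsilon>) has_field_derivative 1) (at z)" by (auto intro!: derivative_eq_intros)
    from DERIV_chain2[OF \<xi> this] that show ?thesis by (simp add: S_def)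
  qed
  have hol: "(\<lambda>z. \<tau> (z + complex_of_real \<epsilon>)) holomorphic_on S"
  proof -
    have "(\<lambda>z. \<xi> (z + complex_of_real \<epsilon>)) holomorphic_on S"
      using \<xi>' by (auto simp: holomorphic_on_open[OF oS])
    then have "deriv (\<lambda>z. \<xi> (z + complex_of_real \<epsilon>)) holomorphic_on S" by (rule holomorphic_deriv[OF _ oS])
    then show ?thesis
      by (rule holomorphic_cong[THEN iffD1, rotated -1]) (use DERIV_imp_deriv[OF \<xi>'] in auto)
  qed
  have I1: "((\<lambda>w. \<tau> (w + complex_of_real \<epsilon>) / (w - complex_of_real t)) has_contour_integral
      (2 * pi * \<i> * \<tau> (complex_of_real t + complex_of_real \<epsilon>))) \<gamma>"
    using Cauchy_integral_formula_convex_simple[OF cS hol _ \<gamma>(1) im \<gamma>(2)] inS(4) wn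
    by (simp add: interior_open[OF oS])
  \<comment> \<open>Integration by parts: the integrand is the derivative of
    \<xi>(w+\<epsilon>)/(w-t), so its integral over the closed path is 0, and Cauchy's formula for
    \<tau> becomes one for \<xi> with a double pole.\<close>
  have I2: "((\<lambda>w. \<tau> (w + complex_of_real \<epsilon>) / (w - complex_of_real t) -
      \<xi> (w + complex_of_real \<epsilon>) / (w - complex_of_real t)\<^sup>2) has_contour_integral 0) \<gamma>"
  proof -
    have "((\<lambda>w. \<xi> (w + complex_of_real \<epsilon>) / (w - complex_of_real t)) has_field_derivative
        (\<tau> (w + complex_of_real \<epsilon>) / (w - complex_of_real t) -
          \<xi> (w + complex_of_real \<epsilon>) / (w - complex_of_real t)\<^sup>2)) (at w within S - {complex_of_real t})"
      if w: "w \<in> S - {complex_of_real t}" for w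
    proof -
      have "((\<lambda>w. w - complex_of_real t) has_field_derivative 1) (at w)" by (auto intro!: derivative_eq_intros)
      from DERIV_divide[OF \<xi>' this] w
      have "((\<lambda>w. \<xi> (w + complex_of_real \<epsilon>) / (w - complex_of_real t)) has_field_derivative
        (\<tau> (w + complex_of_real \<epsilon>) / (w - complex_of_real t) -
          \<xi> (w + complex_of_real \<epsilon>) / (w - complex_of_real t)\<^sup>2)) (at w)"
        by (simp add: diff_divide_distrib power2_eq_square)
      then show ?thesis by (rule has_field_derivative_at_within)
    qed
    from contour_integral_primitive[OF this \<gamma>(1) im] \<gamma>(2) show ?thesis by simp
  qed
  have "((\<lambda>w. \<xi> (w + complex_of_real \<epsilon>) / (w - complex_of_real t)\<^sup>2) has_contour_integral
      (2 * pi * \<i> * \<tau> (complex_of_real t + complex_of_real \<epsilon>))) \<gamma>"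
    using has_contour_integral_diff[OF I1 I2] by simp
  from has_contour_integral_lmul[OF this, of "complex_of_real t"]
  have I: "(F has_contour_integral (2 * pi * \<i> * (complex_of_real t * \<tau> (complex_of_real (t + \<epsilon>))))) \<gamma>"
    by (simp add: F_def power2_commute[of "complex_of_real t"] ac_simps)
  have contF: "continuous_on (S - {complex_of_real t}) F"
    unfolding F_def
  proof (intro continuous_intros)
    show "continuous_on (S - {complex_of_real t}) (\<lambda>z. \<xi> (z + complex_of_real \<epsilon>))"
      using DERIV_isCont[OF \<xi>'] by (intro continuous_at_imp_continuous_on) auto
  qed auto
  show i1: "F contour_integrable_on linepath 0 a"
    by (rule contour_integrable_continuous_linepath[OF continuous_on_subset[OF contF seg(1)]])
  show i2: "F contour_integrable_on linepath a b"
    by (rule contour_integrable_continuous_linepath[OF continuous_on_subset[OF contF seg(2)]])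
  have i3: "F contour_integrable_on linepath b 0"
    by (rule contour_integrable_continuous_linepath[OF continuous_on_subset[OF contF seg(3)]])
  have seg3: "closed_segment 0 b \<subseteq> S - {complex_of_real t}" using seg(3) by (simp add: closed_segment_commute)
  show i4: "F contour_integrable_on linepath 0 b"
    by (rule contour_integrable_continuous_linepath[OF continuous_on_subset[OF contF seg3]])
  have rev: "contour_integral (linepath b 0) F = - contour_integral (linepath 0 b) F"
    by (rule contour_integral_reverse_linepath[OF continuous_on_subset[OF contF seg(3)]])
  have "contour_integral \<gamma> F = contour_integral (linepath 0 a) F + (contour_integral (linepath a b) F +
      contour_integral (linepath b 0) F)"
    unfolding \<gamma>_def using i1 i2 i3 by (simp add: contour_integrable_joinI)
  then show "contour_integral (linepath 0 a) F + contour_integral (linepath a b) F - contour_integral (linepath 0 b) F =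
      2 * pi * \<i> * (complex_of_real t * \<tau> (complex_of_real (t + \<epsilon>)))"
    using contour_integral_unique[OF I] rev by simp
qed

lemma contour_integral_ray:
  assumes s: "\<bar>s\<bar> = \<theta>" and t: "0 < t" and e: "0 < \<epsilon>" and R: "0 < R"
  shows "contour_integral (linepath 0 (rcis R s))
      (\<lambda>z. \<xi> (z + complex_of_real \<epsilon>) * (complex_of_real t / (complex_of_real t - z)\<^sup>2)) =
    (LINT r:{0..R}|lborel. ray_integrand \<epsilon> s t r)" (is "contour_integral _ ?F = ?I")
proof (rule contour_integral_unique)
  have "set_integrable lborel {0..R} (ray_integrand \<epsilon> s t)"
    by (rule set_integrable_subset[OF set_integrable_ray_integrand[OF s t e]]) auto
  from set_borel_integral_eq_integral[OF this]
  have hi: "(ray_integrand \<epsilon> s t has_integral ?I) {0..R}" by (simp add: has_integral_iff)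
  \<comment> \<open>The rotation by \<open>cis s\<close> turns the segment into a real one, on which
    a contour integral is an ordinary integral.\<close>
  define f where "f u = ?F (u * cis s) * cis s" for u
  have fr: "f (complex_of_real r) = ray_integrand \<epsilon> s t r" for r
    by (simp only: f_def ray_integrand_def rcis_def)
  have "((\<lambda>r. f (complex_of_real r)) has_integral ?I) {0..R}" unfolding fr by (rule hi)
  then have "(f has_contour_integral ?I) (linepath 0 (complex_of_real R))"
    using has_contour_integral_linepath_Reals_iff[of 0 "complex_of_real R" f ?I] R by simp
  then show "(?F has_contour_integral ?I) (linepath 0 (rcis R s))"
    unfolding has_contour_integral_linepath
    by (rule has_integral_eq[rotated]) (simp add: f_def linepath_def rcis_def scaleR_conv_of_real ac_simps)
qed

lemma LINT_ray_integrand_atLeast: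
  assumes s: "\<bar>s\<bar> = \<theta>" and t: "0 < t" and e: "0 < \<epsilon>"
  shows "(LINT r:{0..}|lborel. ray_integrand \<epsilon> s t r) = (LINT r:{0<..}|lborel. ray_integrand \<epsilon> s t r)"
  unfolding set_lebesgue_integral_def
proof (rule integral_cong_AE)
  have "{0<..} \<subseteq> {0::real..}" by auto
  from set_integrable_subset[OF set_integrable_ray_integrand[OF s t e] _ this]
  show "(\<lambda>r. indicator {0<..} r *\<^sub>R ray_integrand \<epsilon> s t r) \<in> borel_measurable lborel"
    unfolding set_integrable_def by (auto dest: borel_measurable_integrable)
  show "(\<lambda>r. indicator {0..} r *\<^sub>R ray_integrand \<epsilon> s t r) \<in> borel_measurable lborel"
    using set_integrable_ray_integrand[OF s t e] unfolding set_integrable_def by (rule borel_measurable_integrable)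
  show "AE r in lborel. indicator {0..} r *\<^sub>R ray_integrand \<epsilon> s t r = indicator {0<..} r *\<^sub>R ray_integrand \<epsilon> s t r"
    using AE_lborel_singleton[of "0::real"] by eventually_elim (auto simp: indicator_def)
qed

text \<open>The triangle identity in the limit of large R. The third side has length at most 2R,
  \<xi> is O(1/R) there and the kernel O(1/R^2), so it contributes O(1/R^2). The sign of the
  difference is that of the positively oriented boundary.\<close>

lemma LINT_ray_integrand_diff:
  assumes t: "0 < t" and e: "0 < \<epsilon>"
  shows "(LINT r:{0<..}|lborel. ray_integrand \<epsilon> (- \<theta>) t r) - (LINT r:{0<..}|lborel. ray_integrand \<epsilon> \<theta> t r) =
    2 * pi * \<i> * (complex_of_real t * \<tau> (complex_of_real (t + \<epsilon>)))" (is "?J1 - ?J2 = ?V")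
proof -
  have s: "\<bar>- \<theta>\<bar> = \<theta>" "\<bar>\<theta>\<bar> = \<theta>" using \<theta> by auto
  define F where "F z = \<xi> (z + complex_of_real \<epsilon>) * (complex_of_real t / (complex_of_real t - z)\<^sup>2)" for z
  define W where "W R = contour_integral (linepath (rcis R (- \<theta>)) (rcis R \<theta>)) F" for R
  \<comment> \<open>Beyond this radius R cos \<theta> exceeds 2t, so the third side keeps the
    distance R cos \<theta>/2 from the pole t.\<close>
  define R0 where "R0 = 2 * t / cos \<theta>"
  have R0: "0 < R0" using t sin_cos_pos by (simp add: R0_def)
  have big: "2 * t < R * cos \<theta>" "0 < R" if "R0 < R" for R
  proof -
    show "0 < R" using that R0 by linarith
    show "2 * t < R * cos \<theta>" using that sin_cos_pos by (simp add: R0_def pos_divide_less_eq)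
  qed
  have eq: "(LINT r:{0..R}|lborel. ray_integrand \<epsilon> (- \<theta>) t r) - (LINT r:{0..R}|lborel. ray_integrand \<epsilon> \<theta> t r) + W R = ?V"
    if R: "R0 < R" for R
  proof -
    have tR: "t < R * cos \<theta>" using big[OF R] t by linarith
    show ?thesis
      using triangle_integral(4)[OF t e tR] contour_integral_ray[OF s(1) t e big(2)[OF R]]
        contour_integral_ray[OF s(2) t e big(2)[OF R]]
      unfolding W_def F_def by (simp add: algebra_simps)
  qed
  have Wb: "cmod (W R) \<le> (8 * K * t / (cos \<theta>) ^ 3) / R\<^sup>2" if R: "R0 < R" for R
  proof -
    have tR: "t < R * cos \<theta>" "R * cos \<theta> / 2 \<le> R * cos \<theta> - t" using big[OF R] t by linarith+
    define B where "B = K / (R * cos \<theta>) * (t / (R * cos \<theta> / 2)\<^sup>2)"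
    have B: "0 \<le> B" using K_nonneg sin_cos_pos big[OF R] t by (simp add: B_def)
    have "cmod (W R) \<le> B * cmod (rcis R \<theta> - rcis R (- \<theta>))"
      unfolding W_def
    proof (rule contour_integral_bound_linepath)
      show "F contour_integrable_on linepath (rcis R (- \<theta>)) (rcis R \<theta>)"
        using triangle_integral(2)[OF t e tR(1)] unfolding F_def .
      fix z assume "z \<in> closed_segment (rcis R (- \<theta>)) (rcis R \<theta>)"
      then obtain u where u: "0 \<le> u" "u \<le> 1" "z = (1 - u) *\<^sub>R rcis R (- \<theta>) + u *\<^sub>R rcis R \<theta>"
        by (auto simp: in_segment)
      have "Re z = (1 - u) * (R * cos \<theta>) + u * (R * cos \<theta>)" using u(3) by simp
      then have Rez: "Re z = R * cos \<theta>" by (simp add: algebra_simps)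
      have "rcis R (- \<theta>) + complex_of_real \<epsilon> \<in> acute_cone c" "rcis R \<theta> + complex_of_real \<epsilon> \<in> acute_cone c"
        using ray_in_cone[OF s(1) _ e, of R] ray_in_cone[OF s(2) _ e, of R] big[OF R] by auto
      then have "(1 - u) *\<^sub>R (rcis R (- \<theta>) + complex_of_real \<epsilon>) + u *\<^sub>R (rcis R \<theta> + complex_of_real \<epsilon>) \<in> acute_cone c"
        using u by (intro convexD[OF convex_acute_cone]) auto
      also have "(1 - u) *\<^sub>R (rcis R (- \<theta>) + complex_of_real \<epsilon>) + u *\<^sub>R (rcis R \<theta> + complex_of_real \<epsilon>) =
          z + complex_of_real \<epsilon>"
        using u(3) by (simp add: algebra_simps)
      finally have "cmod (\<xi> (z + complex_of_real \<epsilon>)) \<le> K / (R * cos \<theta> + \<epsilon>)" using \<xi>_le Rez by fastforce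
      also have "\<dots> \<le> K / (R * cos \<theta>)"
        using K_nonneg e big[OF R] sin_cos_pos t by (intro divide_left_mono mult_pos_pos) auto
      finally have 1: "cmod (\<xi> (z + complex_of_real \<epsilon>)) \<le> K / (R * cos \<theta>)" .
      have "R * cos \<theta> / 2 \<le> cmod (complex_of_real t - z)"
        using abs_Re_le_cmod[of "complex_of_real t - z"] Rez tR by simp
      then have "cmod (complex_of_real t / (complex_of_real t - z)\<^sup>2) \<le> t / (R * cos \<theta> / 2)\<^sup>2"
        unfolding norm_divide norm_power using t big[OF R] sin_cos_pos by (intro frac_le power_mono) auto
      with 1 show "cmod (F z) \<le> B"
        unfolding F_def B_def norm_mult using K_nonneg sin_cos_pos big[OF R] by (intro mult_mono) auto
    qed (rule B)
    also have "\<dots> \<le> B * (2 * R)"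
    proof -
      have "cmod (rcis R \<theta> - rcis R (- \<theta>)) \<le> cmod (rcis R \<theta>) + cmod (rcis R (- \<theta>))" by (rule norm_triangle_ineq4)
      then show ?thesis using B big[OF R] by (intro mult_left_mono) auto
    qed
    also have "\<dots> = (8 * K * t / (cos \<theta>) ^ 3) / R\<^sup>2"
      using big[OF R] sin_cos_pos by (simp add: B_def field_simps power2_eq_square power3_eq_cube)
    finally show ?thesis .
  qed
  have W0: "(W \<longlongrightarrow> 0) at_top"
  proof (rule Lim_null_comparison)
    show "\<forall>\<^sub>F R in at_top. cmod (W R) \<le> (8 * K * t / (cos \<theta>) ^ 3) / R\<^sup>2"
      using eventually_gt_at_top[of R0] by eventually_elim (rule Wb)
    show "((\<lambda>R. (8 * K * t / (cos \<theta>) ^ 3) / R\<^sup>2) \<longlongrightarrow> 0) at_top" by real_asymp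
  qed
  have lim: "((\<lambda>R. LINT r:{0..R}|lborel. ray_integrand \<epsilon> s' t r) \<longlongrightarrow> (LINT r:{0<..}|lborel. ray_integrand \<epsilon> s' t r)) at_top"
    if "\<bar>s'\<bar> = \<theta>" for s'
    using tendsto_set_lebesgue_integral_at_top[OF _ set_integrable_ray_integrand[OF that t e]] LINT_ray_integrand_atLeast[OF that t e]
    by simp
  have "((\<lambda>R. (LINT r:{0..R}|lborel. ray_integrand \<epsilon> (- \<theta>) t r) - (LINT r:{0..R}|lborel. ray_integrand \<epsilon> \<theta> t r) + W R)
      \<longlongrightarrow> ?J1 - ?J2 + 0) at_top"
    by (intro tendsto_add tendsto_diff lim s W0)
  moreover have "\<forall>\<^sub>F R in at_top. (LINT r:{0..R}|lborel. ray_integrand \<epsilon> (- \<theta>) t r) - (LINT r:{0..R}|lborel. ray_integrand \<epsilon> \<theta> t r) + W R = ?V"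
    using eventually_gt_at_top[of R0] by eventually_elim (rule eq)
  ultimately have "((\<lambda>R. ?V) \<longlongrightarrow> ?J1 - ?J2 + 0) (at_top :: real filter)" by (rule Lim_transform_eventually)
  then show ?thesis using tendsto_unique[OF _ _ tendsto_const, of "at_top :: real filter"] by fastforce
qed

section \<open>Exchange of the contour integral with the integral over the representing
  measure\<close>

lemma om_deriv_ray:
  assumes om: "om_represents \<mu> \<phi>" and s: "\<bar>s\<bar> = \<theta>" and r: "0 < r"
  shows "deriv \<phi> (rcis r s) = (\<integral>t. complex_of_real t / (complex_of_real t - rcis r s)\<^sup>2 \<partial>\<mu>)"
proof (rule DERIV_imp_deriv[OF om_deriv[OF om]])
  show "0 < sin \<theta> / 2 * min 1 r" using sin_cos_pos r by simp
  fix t :: real assume t: "0 < t"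
  have "min 1 r * (1 + t) = min 1 r + min 1 r * t" by (simp add: algebra_simps)
  also have "\<dots> \<le> r + 1 * t" using t r by (intro add_mono mult_right_mono) auto
  finally have "sin \<theta> / 2 * (min 1 r * (1 + t)) \<le> sin \<theta> / 2 * (t + r)"
    using sin_cos_pos by (intro mult_left_mono) auto
  also have "\<dots> \<le> cmod (complex_of_real t - rcis r s)" using ray_dist[OF s _ t] r by simp
  finally show "sin \<theta> / 2 * min 1 r * (1 + t) \<le> cmod (complex_of_real t - rcis r s)" by (simp add: mult.assoc)
qed

text \<open>\<phi>(-r) is minus the integral of the nonnegative function r/(t+r), so nothing cancels
  in its modulus. Hence the growth condition, which speaks of |\<phi>(-r)|, controls an integral
  with a positive kernel.\<close>

lemma om_abs_neg:
  assumes om: "om_represents \<mu> \<phi>" and r: "1 \<le> r"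
  shows "(\<integral>\<^sup>+t. ennreal (r / ((t + r) * (1 + r\<^sup>2))) \<partial>\<mu>) = ennreal (cmod (\<phi> (- complex_of_real r)) / (1 + r\<^sup>2))"
proof -
  have int: "integrable \<mu> (\<lambda>t. r / (t + r))"
  proof (rule om_represents_integrable_bounded[OF om, of _ r])
    show "(\<lambda>t. r / (t + r)) \<in> borel_measurable borel" by measurable
    show "norm (r / (t + r)) \<le> r / (1 + t)" if "0 < t" for t
      using that r by (simp add: divide_left_mono)
  qed
  have "\<phi> (- complex_of_real r) = (\<integral>t. - complex_of_real r / (complex_of_real t - - complex_of_real r) \<partial>\<mu>)"
    using om_neg[OF om] r by simp
  also have "\<dots> = (\<integral>t. complex_of_real (- (r / (t + r))) \<partial>\<mu>)"
    by (rule Bochner_Integration.integral_cong) simp_all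
  also have "\<dots> = complex_of_real (- (\<integral>t. r / (t + r) \<partial>\<mu>))"
    unfolding integral_complex_of_real by simp
  finally have "cmod (\<phi> (- complex_of_real r)) = \<bar>\<integral>t. r / (t + r) \<partial>\<mu>\<bar>" by (simp only: norm_of_real abs_minus_cancel)
  also have "\<dots> = (\<integral>t. r / (t + r) \<partial>\<mu>)"
    using r by (intro abs_of_nonneg integral_nonneg_AE AE_I2) (simp add: om_represents_space[OF om])
  finally have "cmod (\<phi> (- complex_of_real r)) / (1 + r\<^sup>2) = (\<integral>t. r / (t + r) / (1 + r\<^sup>2) \<partial>\<mu>)"
    by (simp only: integral_divide_zero)
  also have "ennreal \<dots> = (\<integral>\<^sup>+t. ennreal (r / (t + r) / (1 + r\<^sup>2)) \<partial>\<mu>)"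
    using r by (intro nn_integral_eq_integral[symmetric] integrable_divide int AE_I2) (simp add: om_represents_space[OF om])
  finally show ?thesis by (simp add: ac_simps)
qed

text \<open>Each regime matches one hypothesis: 1/t is \<mu>-integrable, and the second bound is the
  kernel of \<open>om_abs_neg\<close>. The threshold 1 arises because 1/(1+r) is at most r/(1+r^2)
  exactly from r = 1 on.\<close>

lemma kernel_bound:
  fixes t r :: real
  assumes t: "0 < t" and r: "0 < r"
  shows "t / ((t + r)\<^sup>2 * (1 + r)) \<le> (if r \<le> 1 then 1 / t else r / ((t + r) * (1 + r\<^sup>2)))"
proof (cases "r \<le> 1")
  case True
  have "t / ((t + r)\<^sup>2 * (1 + r)) \<le> t / (t\<^sup>2 * 1)"
    using t r by (intro divide_left_mono mult_mono power_mono mult_pos_pos) auto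
  then show ?thesis using True t by (simp add: power2_eq_square)
next
  case False
  have "t / ((t + r)\<^sup>2 * (1 + r)) \<le> (t + r) / ((t + r)\<^sup>2 * (1 + r))"
    using t r by (intro divide_right_mono) auto
  also have "\<dots> = 1 / ((t + r) * (1 + r))" using t r by (simp add: power2_eq_square)
  also have "\<dots> \<le> r / ((t + r) * (1 + r\<^sup>2))"
  proof -
    have "1 * (1 + r\<^sup>2) \<le> r * (1 + r)" using False by (simp add: power2_eq_square algebra_simps)
    moreover have p: "0 < 1 + r" "0 < 1 + r\<^sup>2" using r by (auto intro: add_pos_pos)
    ultimately have "1 \<le> r * (1 + r) / (1 + r\<^sup>2)" by (simp only: pos_le_divide_eq)
    then have "1 / (1 + r) \<le> r / (1 + r\<^sup>2)" using p(1) by (simp add: pos_divide_le_eq)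
    then have "1 / (t + r) * (1 / (1 + r)) \<le> 1 / (t + r) * (r / (1 + r\<^sup>2))" using t r by (intro mult_left_mono) auto
    then show ?thesis by simp
  qed
  finally show ?thesis using False by simp
qed

text \<open>Integrating over t first, \<open>kernel_bound\<close> leaves the integral of 1/t for r
  up to 1 and |\<phi>(-r)|/(1+r^2) beyond; both are integrable in r.\<close>

lemma integrable_ray_integrand_pair:
  assumes om: "om_represents \<mu> \<phi>" and i: "integrable \<mu> (\<lambda>t. 1 / t)"
    and fin: "(\<integral>\<^sup>+x\<in>{0<..}. ennreal (cmod (\<phi> (- complex_of_real x)) / (1 + x\<^sup>2)) \<partial>lborel) < \<infinity>"
    and s: "\<bar>s\<bar> = \<theta>" and e: "0 < \<epsilon>"
  shows "integrable (lborel \<Otimes>\<^sub>M \<mu>) (\<lambda>(r, t). indicator {0<..} r *\<^sub>R ray_integrand \<epsilon> s t r)"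
proof (rule integrableI_bounded)
  interpret sigma_finite_measure \<mu> by (rule om_sigma_finite[OF om])
  \<comment> \<open>Cutting off to r > 0 gives a Borel function on the whole line; the other factors
    of the integrand are jointly measurable by inspection.\<close>
  define u where "u r = indicator {0<..} r *\<^sub>R \<xi> (rcis r s + complex_of_real \<epsilon>)" for r
  have "{0<..} \<subseteq> {0::real..}" by auto
  from borel_measurable_continuous_on_indicator[OF _ continuous_on_subset[OF continuous_on_ray_shift[OF s e] this]]
  have [measurable]: "u \<in> borel_measurable borel" unfolding u_def by simp
  have [measurable]: "(\<lambda>t. t) \<in> borel_measurable \<mu>" by (rule om_represents_measurable[OF om]) measurable
  have "(\<lambda>(r, t). u r * (complex_of_real t / (complex_of_real t - complex_of_real r * cis s)\<^sup>2) * cis s)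
      \<in> borel_measurable (lborel \<Otimes>\<^sub>M \<mu>)" by measurable
  also have "(\<lambda>(r, t). u r * (complex_of_real t / (complex_of_real t - complex_of_real r * cis s)\<^sup>2) * cis s) =
      (\<lambda>(r, t). indicator {0<..} r *\<^sub>R ray_integrand \<epsilon> s t r)"
    by (auto simp: fun_eq_iff u_def ray_integrand_def rcis_def indicator_def)
  finally show meas: "(\<lambda>(r, t). indicator {0<..} r *\<^sub>R ray_integrand \<epsilon> s t r) \<in> borel_measurable (lborel \<Otimes>\<^sub>M \<mu>)" .
  define C where "C = K / min (cos \<theta>) \<epsilon> * (4 / (sin \<theta>)\<^sup>2)"
  have C: "0 \<le> C" using K_nonneg sin_cos_pos e by (simp add: C_def)
  define J where "J = (\<integral>t. 1 / t \<partial>\<mu>)"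
  have J: "(\<integral>\<^sup>+t. ennreal (1 / t) \<partial>\<mu>) = ennreal J"
    unfolding J_def using i by (intro nn_integral_eq_integral AE_I2) (auto simp: om_represents_space[OF om])
  have inner: "(\<integral>\<^sup>+t. ennreal (norm (indicator {0<..} r *\<^sub>R ray_integrand \<epsilon> s t r)) \<partial>\<mu>) \<le>
      ennreal C * (ennreal J * indicator {0..1} r + ennreal (cmod (\<phi> (- complex_of_real r)) / (1 + r\<^sup>2)) * indicator {0<..} r)" for r
  proof (cases "0 < r")
    case r: True
    have "(\<integral>\<^sup>+t. ennreal (norm (indicator {0<..} r *\<^sub>R ray_integrand \<epsilon> s t r)) \<partial>\<mu>) \<le>
        (\<integral>\<^sup>+t. ennreal C * ennreal (if r \<le> 1 then 1 / t else r / ((t + r) * (1 + r\<^sup>2))) \<partial>\<mu>)"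
    proof (rule nn_integral_mono)
      fix t assume "t \<in> space \<mu>"
      then have t: "t > 0" by (simp add: om_represents_space[OF om])
      have "norm (ray_integrand \<epsilon> s t r) \<le> C * (t / ((t + r)\<^sup>2 * (1 + r)))"
        using ray_integrand_bound[OF s _ t e, of r] r by (simp add: C_def)
      also have "\<dots> \<le> C * (if r \<le> 1 then 1 / t else r / ((t + r) * (1 + r\<^sup>2)))"
        by (intro mult_left_mono kernel_bound t r C)
      finally have "norm (ray_integrand \<epsilon> s t r) \<le> C * (if r \<le> 1 then 1 / t else r / ((t + r) * (1 + r\<^sup>2)))" .
      then have "ennreal (norm (ray_integrand \<epsilon> s t r)) \<le> ennreal (C * (if r \<le> 1 then 1 / t else r / ((t + r) * (1 + r\<^sup>2))))"
        by (rule ennreal_leI)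
      also have "\<dots> = ennreal C * ennreal (if r \<le> 1 then 1 / t else r / ((t + r) * (1 + r\<^sup>2)))"
        using C t r by (intro ennreal_mult) auto
      finally show "ennreal (norm (indicator {0<..} r *\<^sub>R ray_integrand \<epsilon> s t r)) \<le>
          ennreal C * ennreal (if r \<le> 1 then 1 / t else r / ((t + r) * (1 + r\<^sup>2)))" using r by simp
    qed
    also have "\<dots> = ennreal C * (\<integral>\<^sup>+t. ennreal (if r \<le> 1 then 1 / t else r / ((t + r) * (1 + r\<^sup>2))) \<partial>\<mu>)"
      by (rule nn_integral_cmult) measurable
    also have "\<dots> \<le> ennreal C * (ennreal J * indicator {0..1} r + ennreal (cmod (\<phi> (- complex_of_real r)) / (1 + r\<^sup>2)) * indicator {0<..} r)"
    proof (rule mult_left_mono)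
      show "(\<integral>\<^sup>+t. ennreal (if r \<le> 1 then 1 / t else r / ((t + r) * (1 + r\<^sup>2))) \<partial>\<mu>) \<le>
          ennreal J * indicator {0..1} r + ennreal (cmod (\<phi> (- complex_of_real r)) / (1 + r\<^sup>2)) * indicator {0<..} r"
      proof (cases "r \<le> 1")
        case True
        then show ?thesis using r J by simp
      next
        case False
        then show ?thesis using om_abs_neg[OF om, of r] r by simp
      qed
    qed simp
    finally show ?thesis .
  qed simp
  have "(\<integral>\<^sup>+p. ennreal (norm (case p of (r, t) \<Rightarrow> indicator {0<..} r *\<^sub>R ray_integrand \<epsilon> s t r)) \<partial>(lborel \<Otimes>\<^sub>M \<mu>)) =
      (\<integral>\<^sup>+r. \<integral>\<^sup>+t. ennreal (norm (indicator {0<..} r *\<^sub>R ray_integrand \<epsilon> s t r)) \<partial>\<mu> \<partial>lborel)"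
    using nn_integral_fst[of "\<lambda>p. ennreal (norm (case p of (r, t) \<Rightarrow> indicator {0<..} r *\<^sub>R ray_integrand \<epsilon> s t r))" lborel] meas
    by simp
  also have "\<dots> \<le> (\<integral>\<^sup>+r. ennreal C * (ennreal J * indicator {0..1} r +
      ennreal (cmod (\<phi> (- complex_of_real r)) / (1 + r\<^sup>2)) * indicator {0<..} r) \<partial>lborel)"
    by (intro nn_integral_mono inner)
  also have "\<dots> = ennreal C * (ennreal J * 1 + (\<integral>\<^sup>+x\<in>{0<..}. ennreal (cmod (\<phi> (- complex_of_real x)) / (1 + x\<^sup>2)) \<partial>lborel))"
  proof -
    \<comment> \<open>Measurability of r \<mapsto> \<phi>(-r) is obtained from the integral formula,
      which holds for r > 0; elsewhere the indicator is 0.\<close>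
    have "(\<lambda>r. ennreal (cmod (\<phi> (- complex_of_real r)) / (1 + r\<^sup>2)) * indicator {0<..} r) \<in> borel_measurable borel"
    proof -
      have "(\<lambda>r. \<integral>t. - complex_of_real r / (complex_of_real t - - complex_of_real r) \<partial>\<mu>) \<in> borel_measurable borel"
        by measurable
      then have "(\<lambda>r. ennreal (cmod (\<integral>t. - complex_of_real r / (complex_of_real t - - complex_of_real r) \<partial>\<mu>) / (1 + r\<^sup>2)) *
          indicator {0<..} r) \<in> borel_measurable borel" by measurable
      also have "(\<lambda>r. ennreal (cmod (\<integral>t. - complex_of_real r / (complex_of_real t - - complex_of_real r) \<partial>\<mu>) / (1 + r\<^sup>2)) *
          indicator {0<..} r) = (\<lambda>r. ennreal (cmod (\<phi> (- complex_of_real r)) / (1 + r\<^sup>2)) * indicator {0<..} r)"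
      proof
        fix r :: real
        show "ennreal (cmod (\<integral>t. - complex_of_real r / (complex_of_real t - - complex_of_real r) \<partial>\<mu>) / (1 + r\<^sup>2)) *
          indicator {0<..} r = ennreal (cmod (\<phi> (- complex_of_real r)) / (1 + r\<^sup>2)) * indicator {0<..} r"
          using om_neg[OF om, of r] by (cases "0 < r") simp_all
      qed
      finally show ?thesis .
    qed
    then show ?thesis
      by (subst nn_integral_cmult, simp, subst nn_integral_add, simp_all add: nn_integral_cmult)
  qed
  also have "\<dots> < \<infinity>" using fin by (simp add: ennreal_mult_less_top)
  finally show "(\<integral>\<^sup>+p. ennreal (norm (case p of (r, t) \<Rightarrow> indicator {0<..} r *\<^sub>R ray_integrand \<epsilon> s t r)) \<partial>(lborel \<Otimes>\<^sub>M \<mu>)) < \<infinity>" .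
qed

lemma ray_integrand_Fubini:
  assumes om: "om_represents \<mu> \<phi>" and i: "integrable \<mu> (\<lambda>t. 1 / t)"
    and fin: "(\<integral>\<^sup>+x\<in>{0<..}. ennreal (cmod (\<phi> (- complex_of_real x)) / (1 + x\<^sup>2)) \<partial>lborel) < \<infinity>"
    and s: "\<bar>s\<bar> = \<theta>" and e: "0 < \<epsilon>"
  shows "set_integrable lborel {0<..} (\<lambda>r. \<xi> (rcis r s + complex_of_real \<epsilon>) * deriv \<phi> (rcis r s) * cis s)"
    and "integrable \<mu> (\<lambda>t. LINT r:{0<..}|lborel. ray_integrand \<epsilon> s t r)"
    and "(LINT r:{0<..}|lborel. \<xi> (rcis r s + complex_of_real \<epsilon>) * deriv \<phi> (rcis r s) * cis s) =
      (\<integral>t. (LINT r:{0<..}|lborel. ray_integrand \<epsilon> s t r) \<partial>\<mu>)"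
proof -
  interpret M: sigma_finite_measure \<mu> by (rule om_sigma_finite[OF om])
  interpret pair_sigma_finite lborel \<mu> ..
  note int = integrable_ray_integrand_pair[OF om i fin s e]
  have inner: "(\<integral>t. indicator {0<..} r *\<^sub>R ray_integrand \<epsilon> s t r \<partial>\<mu>) =
      indicator {0<..} r *\<^sub>R (\<xi> (rcis r s + complex_of_real \<epsilon>) * deriv \<phi> (rcis r s) * cis s)" for r
  proof (cases "0 < r")
    case True
    then show ?thesis by (simp add: ray_integrand_def om_deriv_ray[OF om s True] mult.assoc del: times_divide_eq_right times_divide_eq_left)
  qed simp
  show "set_integrable lborel {0<..} (\<lambda>r. \<xi> (rcis r s + complex_of_real \<epsilon>) * deriv \<phi> (rcis r s) * cis s)"
    unfolding set_integrable_def using integrable_fst[OF int] by (simp only: inner)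
  show "integrable \<mu> (\<lambda>t. LINT r:{0<..}|lborel. ray_integrand \<epsilon> s t r)"
    unfolding set_lebesgue_integral_def using integrable_snd[OF int] .
  show "(LINT r:{0<..}|lborel. \<xi> (rcis r s + complex_of_real \<epsilon>) * deriv \<phi> (rcis r s) * cis s) =
      (\<integral>t. (LINT r:{0<..}|lborel. ray_integrand \<epsilon> s t r) \<partial>\<mu>)"
    unfolding set_lebesgue_integral_def using Fubini_integral[OF int] by (simp only: inner)
qed

lemma sector_boundary_integral_eq:
  assumes om: "om_represents \<mu> \<phi>" and i: "integrable \<mu> (\<lambda>t. 1 / t)"
    and fin: "(\<integral>\<^sup>+x\<in>{0<..}. ennreal (cmod (\<phi> (- complex_of_real x)) / (1 + x\<^sup>2)) \<partial>lborel) < \<infinity>"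
    and e: "0 < \<epsilon>"
  shows "sector_boundary_integrable \<theta> (\<lambda>z. \<xi> (z + complex_of_real \<epsilon>) * deriv \<phi> z)"
    and "1 / (2 * complex_of_real pi * \<i>) * sector_boundary_integral \<theta> (\<lambda>z. \<xi> (z + complex_of_real \<epsilon>) * deriv \<phi> z) =
      (\<integral>t. complex_of_real t * \<tau> (complex_of_real (t + \<epsilon>)) \<partial>\<mu>)"
proof -
  have s: "\<bar>- \<theta>\<bar> = \<theta>" "\<bar>\<theta>\<bar> = \<theta>" using \<theta> by auto
  note r1 = ray_integrand_Fubini[OF om i fin s(1) e] and r2 = ray_integrand_Fubini[OF om i fin s(2) e]
  show "sector_boundary_integrable \<theta> (\<lambda>z. \<xi> (z + complex_of_real \<epsilon>) * deriv \<phi> z)"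
    unfolding sector_boundary_integrable_def using r1(1) r2(1) by blast
  have "sector_boundary_integral \<theta> (\<lambda>z. \<xi> (z + complex_of_real \<epsilon>) * deriv \<phi> z) =
      (\<integral>t. (LINT r:{0<..}|lborel. ray_integrand \<epsilon> (- \<theta>) t r) - (LINT r:{0<..}|lborel. ray_integrand \<epsilon> \<theta> t r) \<partial>\<mu>)"
    unfolding sector_boundary_integral_def r1(3) r2(3)
    by (rule Bochner_Integration.integral_diff[symmetric, OF r1(2) r2(2)])
  also have "\<dots> = (\<integral>t. 2 * pi * \<i> * (complex_of_real t * \<tau> (complex_of_real (t + \<epsilon>))) \<partial>\<mu>)"
    by (rule Bochner_Integration.integral_cong[OF refl]) (rule LINT_ray_integrand_diff[OF _ e], simp add: om_represents_space[OF om])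
  also have "\<dots> = 2 * pi * \<i> * (\<integral>t. complex_of_real t * \<tau> (complex_of_real (t + \<epsilon>)) \<partial>\<mu>)"
    by (rule integral_mult_right_zero)
  finally show "1 / (2 * complex_of_real pi * \<i>) * sector_boundary_integral \<theta> (\<lambda>z. \<xi> (z + complex_of_real \<epsilon>) * deriv \<phi> z) =
      (\<integral>t. complex_of_real t * \<tau> (complex_of_real (t + \<epsilon>)) \<partial>\<mu>)" by simp
qed

lemma isCont_\<tau>: "z \<in> acute_cone c \<Longrightarrow> isCont \<tau> z"
proof -
  assume z: "z \<in> acute_cone c"
  have "\<xi> holomorphic_on acute_cone c" using \<xi> by (auto simp: holomorphic_on_open[OF open_acute_cone])
  then have "deriv \<xi> holomorphic_on acute_cone c" by (rule holomorphic_deriv[OF _ open_acute_cone])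
  then have "\<tau> holomorphic_on acute_cone c"
    by (rule holomorphic_cong[THEN iffD1, rotated -1]) (use DERIV_imp_deriv[OF \<xi>] in auto)
  then show ?thesis
    using z open_acute_cone by (metis continuous_on_eq_continuous_at holomorphic_on_imp_continuous_on)
qed

text \<open>The integrand is at most t K/(t+\<epsilon>)^2, hence at most K/t for every \<epsilon>,
  and dominated convergence applies. The limit is taken on this side of the trace formula because
  \<open>ray_integrand_bound\<close> is not uniform in \<epsilon>.\<close>

lemma tendsto_shift_integral:
  assumes om: "om_represents \<mu> \<phi>" and i: "integrable \<mu> (\<lambda>t. 1 / t)"
  shows "((\<lambda>\<epsilon>. \<integral>t. complex_of_real t * \<tau> (complex_of_real (t + \<epsilon>)) \<partial>\<mu>) \<longlongrightarrow>
    (\<integral>t. complex_of_real t * \<tau> (complex_of_real t) \<partial>\<mu>)) (at_right 0)"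
  unfolding tendsto_at_iff_sequentially o_def
proof safe
  fix X :: "nat \<Rightarrow> real" assume X: "\<forall>n. X n \<in> {0<..} - {0}" "X \<longlonglongrightarrow> 0"
  then have X0: "0 \<le> X n" for n by (auto simp: less_imp_le)
  have meas: "(\<lambda>t. complex_of_real t * \<tau> (complex_of_real (t + e))) \<in> borel_measurable \<mu>" if "0 \<le> e" for e
  proof -
    have "(\<lambda>t. complex_of_real t * \<tau> (complex_of_real t + complex_of_real e)) \<in> borel_measurable \<mu>"
    proof (rule measurable_of_isCont[OF om, of "\<lambda>z. z * \<tau> (z + complex_of_real e)"])
      fix t :: real assume t: "0 < t"
      have "complex_of_real t + complex_of_real e \<in> acute_cone c"
        by (rule acute_cone_add_of_real[OF of_real_in_acute_cone[OF c_pos t] c_pos that])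
      then have "isCont (\<lambda>z. \<tau> (z + complex_of_real e)) (complex_of_real t)"
        by (intro isCont_o2[where f="\<lambda>z. z + complex_of_real e" and g=\<tau>] isCont_\<tau> continuous_intros)
      then show "isCont (\<lambda>z. z * \<tau> (z + complex_of_real e)) (complex_of_real t)" by (intro continuous_intros)
    qed
    then show ?thesis by simp
  qed
  show "(\<lambda>n. \<integral>t. complex_of_real t * \<tau> (complex_of_real (t + X n)) \<partial>\<mu>) \<longlonglongrightarrow>
      (\<integral>t. complex_of_real t * \<tau> (complex_of_real t) \<partial>\<mu>)"
  proof (rule integral_dominated_convergence[where w="\<lambda>t. K * (1 / t)"])
    show "(\<lambda>t. complex_of_real t * \<tau> (complex_of_real t)) \<in> borel_measurable \<mu>" using meas[of 0] by simp
    show "(\<lambda>t. complex_of_real t * \<tau> (complex_of_real (t + X n))) \<in> borel_measurable \<mu>" for n by (rule meas[OF X0])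
    show "integrable \<mu> (\<lambda>t. K * (1 / t))" by (rule integrable_mult_right[OF i])
    show "AE t in \<mu>. (\<lambda>n. complex_of_real t * \<tau> (complex_of_real (t + X n))) \<longlonglongrightarrow> complex_of_real t * \<tau> (complex_of_real t)"
    proof (rule AE_I2)
      fix t assume "t \<in> space \<mu>"
      then have t: "t > 0" by (simp add: om_represents_space[OF om])
      have "(\<lambda>n. complex_of_real (t + X n)) \<longlonglongrightarrow> complex_of_real (t + 0)" by (intro tendsto_intros X)
      then have "(\<lambda>n. \<tau> (complex_of_real (t + X n))) \<longlonglongrightarrow> \<tau> (complex_of_real t)"
        using isCont_tendsto_compose[OF isCont_\<tau>[OF of_real_in_acute_cone[OF c_pos t]]] by simp
      then show "(\<lambda>n. complex_of_real t * \<tau> (complex_of_real (t + X n))) \<longlonglongrightarrow> complex_of_real t * \<tau> (complex_of_real t)"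
        by (rule tendsto_mult_left)
    qed
    show "AE t in \<mu>. norm (complex_of_real t * \<tau> (complex_of_real (t + X n))) \<le> K * (1 / t)" for n
    proof (rule AE_I2)
      fix t assume "t \<in> space \<mu>"
      then have t: "t > 0" by (simp add: om_represents_space[OF om])
      then have tX: "0 < t + X n" using X0[of n] by linarith
      have "norm (complex_of_real t * \<tau> (complex_of_real (t + X n))) \<le> t * (K / (t + X n)\<^sup>2)"
      proof -
        have "cmod (\<tau> (complex_of_real (t + X n))) \<le> K / (t + X n)\<^sup>2"
          using \<tau>_le[OF of_real_in_acute_cone[OF c_pos tX]] by simp
        then show ?thesis unfolding norm_mult using t by (intro mult_mono) auto
      qed
      also have "\<dots> \<le> t * (K / t\<^sup>2)"
        using t X0[of n] K_nonneg by (intro mult_left_mono divide_left_mono power_mono) auto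
      also have "\<dots> = K * (1 / t)" using t by (simp add: power2_eq_square)
      finally show "norm (complex_of_real t * \<tau> (complex_of_real (t + X n))) \<le> K * (1 / t)" .
    qed
  qed
qed

end

text \<open>The closed cone of slope tan \<theta> contains the sector and therefore its closure. As
  tan \<theta> < c, it lies in the open cone except for the vertex.\<close>

lemma closure_sector_subset:
  assumes \<theta>: "0 < \<theta>" "\<theta> < pi / 2" "tan \<theta> < c"
  shows "closure (sector \<theta>) - {0} \<subseteq> acute_cone c"
proof -
  let ?C = "{z. \<bar>Im z\<bar> \<le> tan \<theta> * Re z}"
  have pos: "0 < tan \<theta>" using \<theta> by (intro tan_gt_zero) auto
  have "sector \<theta> \<subseteq> ?C"
  proof
    fix z assume "z \<in> sector \<theta>"
    then have z: "z \<noteq> 0" "\<bar>Arg z\<bar> < \<theta>" by (auto simp: sector_def)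
    define a where "a = \<bar>Arg z\<bar>"
    have a: "0 \<le> a" "a < \<theta>" "cos a = cos (Arg z)" "sin a = \<bar>sin (Arg z)\<bar>"
    proof -
      show "0 \<le> a" "a < \<theta>" "cos a = cos (Arg z)" using z by (auto simp: a_def abs_if)
      then have "0 \<le> sin a" using \<theta> by (intro sin_ge_zero) auto
      then show "sin a = \<bar>sin (Arg z)\<bar>" by (auto simp: a_def abs_if split: if_splits)
    qed
    have ca: "0 < cos a" using a \<theta> by (intro cos_gt_zero_pi) auto
    have "tan a \<le> tan \<theta>" using a \<theta> by (intro tan_mono_le) auto
    moreover have "tan a = sin a / cos a" by (simp add: tan_def)
    ultimately have sa: "sin a \<le> tan \<theta> * cos a" using ca by (simp only: pos_divide_le_eq)
    have zr: "z = rcis (cmod z) (Arg z)" by (simp add: rcis_cmod_Arg)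
    have "\<bar>Im z\<bar> = cmod z * sin a" by (subst zr) (simp add: abs_mult a)
    also have "\<dots> \<le> cmod z * (tan \<theta> * cos a)" by (intro mult_left_mono sa) auto
    also have "\<dots> = tan \<theta> * Re z"
    proof -
      have "Re z = cmod z * cos a" by (subst zr) (simp add: a)
      then show ?thesis by simp
    qed
    finally show "z \<in> ?C" by simp
  qed
  moreover have "closed ?C" by (intro closed_Collect_le continuous_intros)
  ultimately have cl: "closure (sector \<theta>) \<subseteq> ?C" by (rule closure_minimal)
  show ?thesis
  proof
    fix z assume z: "z \<in> closure (sector \<theta>) - {0}"
    then have im: "\<bar>Im z\<bar> \<le> tan \<theta> * Re z" using cl by auto
    then have "0 \<le> Re z" using pos by (smt (verit) abs_ge_zero mult_pos_neg)
    moreover have "Re z \<noteq> 0" using im z by (auto simp: complex_eq_iff)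
    ultimately have "tan \<theta> * Re z < c * Re z" using \<theta> by simp
    then show "z \<in> acute_cone c" using im by (simp add: acute_cone_def)
  qed
qed

text \<open>\<theta> and \<xi> are chosen before \<phi>, so one sector serves all functions.
  Nuclearity and integrability are asserted along with the limit, because trace and integral are
  total functions with default values. The vertex is excluded: for A = 0 and B = -I on the complex
  line \<xi>(l) = log l - log(l+1), which is singular at 0.\<close>

theorem theorem4p12:
  fixes A B :: "'a::complex_banach operator"
  assumes "approximation_property TYPE('a)"
    and "A \<in> NP" and "B \<in> NP"
    and "Domain A \<subseteq> Domain B"
    and "nuclear_diff (Domain A) A B"
  shows "\<exists>\<theta> \<xi>. 0 < \<theta> \<and> \<theta> < pi / 2 \<and>
    \<xi> analytic_on (closure (sector \<theta>) - {0}) \<and>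
    (\<forall>l>0. \<xi> (complex_of_real l) = spectral_shift A B l) \<and>
    (\<forall>\<phi>\<in>OM_minus. om_deriv_minus_zero \<phi> \<noteq> \<infinity> \<longrightarrow>
      (\<integral>\<^sup>+x\<in>{0<..}. ennreal (cmod (\<phi> (- complex_of_real x)) / (1 + x\<^sup>2)) \<partial>lborel) < \<infinity> \<longrightarrow>
      nuclear_diff (Domain A) (om_calc \<phi> A) (om_calc \<phi> B) \<and>
      (\<forall>\<epsilon>>0. sector_boundary_integrable \<theta> (\<lambda>z. \<xi> (z + complex_of_real \<epsilon>) * deriv \<phi> z)) \<and>
      ((\<lambda>\<epsilon>. 1 / (2 * complex_of_real pi * \<i>) *
          sector_boundary_integral \<theta> (\<lambda>z. \<xi> (z + complex_of_real \<epsilon>) * deriv \<phi> z))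
        \<longlongrightarrow> nuclear_trace (diff_ext (Domain A) (om_calc \<phi> A) (om_calc \<phi> B))) (at_right 0))"
proof -
  obtain T f x where T: "extends_diff (Domain A) A B T" "nuclear_rep T f x"
    using assms(5) by (auto simp: nuclear_diff_def nuclear_def)
  interpret nuclear_perturbation A B T f x
    by unfold_locales (use assms T in \<open>auto simp: extends_diff_def\<close>)
  obtain c K where c: "0 < c" "tr_diff holomorphic_on acute_cone c"
    "\<And>z. z \<in> acute_cone c \<Longrightarrow> cmod (tr_diff z) \<le> K / (Re z)\<^sup>2"
    by (rule tr_diff_holomorphic) (rule that)
  obtain \<xi> where prim: "\<And>z. z \<in> acute_cone c \<Longrightarrow> (\<xi> has_field_derivative tr_diff z) (at z)"
    "\<And>z. z \<in> acute_cone c \<Longrightarrow> cmod (\<xi> z) \<le> K / Re z"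
    "\<And>l. 0 < l \<Longrightarrow> \<xi> (complex_of_real l) = - (LINT t:{l<..}|lborel. tr_diff (complex_of_real t))"
    using cone_primitive[OF c] by blast
  \<comment> \<open>Half the slope of the cone leaves room for the boundary of the sector.\<close>
  define \<theta> where "\<theta> = arctan (c / 2)"
  have \<theta>: "0 < \<theta>" "\<theta> < pi / 2" "tan \<theta> < c" using c(1) arctan_ubound by (auto simp: \<theta>_def tan_arctan)
  interpret cone_function c K \<theta> \<xi> tr_diff
    by unfold_locales (use \<theta> prim c in auto)
  have trace: "nuclear_diff (Domain A) (om_calc \<phi> A) (om_calc \<phi> B) \<and>
      (\<forall>\<epsilon>>0. sector_boundary_integrable \<theta> (\<lambda>z. \<xi> (z + complex_of_real \<epsilon>) * deriv \<phi> z)) \<and>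
      ((\<lambda>\<epsilon>. 1 / (2 * complex_of_real pi * \<i>) *
          sector_boundary_integral \<theta> (\<lambda>z. \<xi> (z + complex_of_real \<epsilon>) * deriv \<phi> z))
        \<longlongrightarrow> nuclear_trace (diff_ext (Domain A) (om_calc \<phi> A) (om_calc \<phi> B))) (at_right 0)"
    if \<phi>: "\<phi> \<in> OM_minus" "om_deriv_minus_zero \<phi> \<noteq> \<infinity>"
      and fin: "(\<integral>\<^sup>+x\<in>{0<..}. ennreal (cmod (\<phi> (- complex_of_real x)) / (1 + x\<^sup>2)) \<partial>lborel) < \<infinity>" for \<phi>
  proof -
    obtain \<mu> where om: "om_represents \<mu> \<phi>" using \<phi>(1) by (auto simp: OM_minus_def)
    note i = om_inverse_integrable[OF om \<phi>(2)]
    obtain D where D: "extends_diff (Domain A) (om_calc \<phi> A) (om_calc \<phi> B) D" "nuclear D"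
      "nuclear_trace D = (\<integral>t. complex_of_real t * tr_diff (complex_of_real t) \<partial>\<mu>)"
      by (rule om_calc_diff_nuclear[OF om i])
    have "\<forall>\<^sub>F \<epsilon> in at_right 0. (\<integral>t. complex_of_real t * tr_diff (complex_of_real (t + \<epsilon>)) \<partial>\<mu>) =
        1 / (2 * complex_of_real pi * \<i>) *
          sector_boundary_integral \<theta> (\<lambda>z. \<xi> (z + complex_of_real \<epsilon>) * deriv \<phi> z)"
      using eventually_at_right_less[of 0]
      by eventually_elim (rule sector_boundary_integral_eq(2)[OF om i fin, symmetric])
    from Lim_transform_eventually[OF tendsto_shift_integral[OF om i] this]
    show ?thesis
      using D sector_boundary_integral_eq(1)[OF om i fin] diff_ext_eq[OF dense D(1)]
      by (auto simp: nuclear_diff_def)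
  qed
  show ?thesis
  proof (intro exI[of _ \<theta>] exI[of _ \<xi>] conjI ballI allI impI)
    have "\<xi> holomorphic_on acute_cone c" using prim(1) by (auto simp: holomorphic_on_open[OF open_acute_cone])
    then have "\<xi> analytic_on acute_cone c" using analytic_on_open[OF open_acute_cone] by blast
    then show "\<xi> analytic_on (closure (sector \<theta>) - {0})"
      by (rule analytic_on_subset[OF _ closure_sector_subset[OF \<theta>]])
    show "\<xi> (complex_of_real l) = spectral_shift A B l" if "0 < l" for l
      using prim(3)[OF that] spectral_shift_eq[OF that] by simp
  qed (use \<theta> trace in blast)+
qed

end
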